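(* Let $X$ be a separable infinite dimensional Fréchet space such that there is an $\ell_1$-sequence with dense span in $X'_\beta$. Then there exists a dual hypercyclic operator $T\in L(X)$.
   Context: Spaces are over $\mathbb K$, which is $\mathbb R$ or $\mathbb C$; $\mathbb Z_+=\{0,1,2,\dots\}$. A Fréchet space is a complete metrizable locally convex space. $L(X)$ is the space of continuous linear operators on $X$, $X'$ the space of continuous linear functionals on $X$, and for $T\in L(X)$, $T':X'\to X'$ is given by $(T'f)(x)=f(Tx)$. $X'_\beta$ is $X'$ with the strong topology, i.e. the topology of uniform convergence on bounded subsets of $X$. A sequence $\{x_n\}_{n\in\mathbb Z_+}$ in a topological vector space $Z$ is an $\ell_1$-sequence if $x_n\to0$ in $Z$ and $\sum_{n=0}^\infty a_nx_n$ converges in $Z$ for each $a\in\ell_1$. An operator $S$ on a topological vector space $Z$ is hypercyclic if $\{S^nz:n\in\mathbb Z_+\}$ is dense in $Z$ for some $z\in Z$. $T\in L(X)$ is dual hypercyclic if $T$ is hypercyclic on $X$ and $T'$ is hypercyclic on $X'_\beta$. *)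

theory Defs
  imports "HOL-Analysis.Analysis" "HOL-Library.Function_Algebras"
begin

text \<open>
  The scalar field is a type \<open>'k\<close> of class \<open>real_normed_field\<close>, to be instantiated with
  \<open>real\<close> and with \<open>complex\<close>. The library has no class of complex vector spaces, so the scalar
  multiplication is an explicit parameter, as in the locale \<open>vector_space\<close>. The space \<open>X\<close>
  is a whole type; its dual and the strong topology on it live on a subset of the functions from
  \<open>X\<close> to \<open>'k\<close>, with the pointwise addition of \<open>HOL-Library.Function_Algebras\<close>.
\<close>

text \<open>
  In class \<open>uniform_topological_group_add\<close> addition is uniformly continuous, which forces the
  uniformity of the type to be the canonical one of the topological group: its entourages are
  generated by the sets of all \<open>(x, y)\<close> with \<open>x - y \<in> U\<close>, where \<open>U\<close> is a neighbourhood of 0.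
  Hence Cauchy filters and \<open>complete\<close> below have their usual meaning for topological vector
  spaces, and are independent of a choice of metric.
\<close>

locale topological_vector_space = vector_space smul
  for smul :: "'k::real_normed_field
      \<Rightarrow> 'a::{topological_ab_group_add, uniform_topological_group_add} \<Rightarrow> 'a" +
  assumes continuous_smul: "continuous_on UNIV (\<lambda>(c, x). smul c x)"

text \<open>The library's \<open>convex\<close> is tied to the class \<open>real_vector\<close>.\<close>

definition convex_wrt :: "('k::real_normed_field \<Rightarrow> 'a::ab_group_add \<Rightarrow> 'a) \<Rightarrow> 'a set \<Rightarrow> bool" where
  "convex_wrt smul S \<longleftrightarrow>
    (\<forall>x\<in>S. \<forall>y\<in>S. \<forall>u\<ge>0. \<forall>v\<ge>0. u + v = 1 \<longrightarrow> smul (of_real u) x + smul (of_real v) y \<in> S)"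

locale frechet_space = topological_vector_space smul
  for smul :: "'k::real_normed_field
      \<Rightarrow> 'a::{topological_ab_group_add, uniform_topological_group_add} \<Rightarrow> 'a" +
  assumes locally_convex:
      "\<And>U. open U \<Longrightarrow> 0 \<in> U \<Longrightarrow> \<exists>V. open V \<and> 0 \<in> V \<and> convex_wrt smul V \<and> V \<subseteq> U"
    and metrizable: "metrizable_space (euclidean :: 'a topology)"
    and complete: "complete (UNIV :: 'a set)"

definition infinite_dimensional :: "('k::field \<Rightarrow> 'a::ab_group_add \<Rightarrow> 'a) \<Rightarrow> bool" where
  "infinite_dimensional smul \<longleftrightarrow> \<not> (\<exists>B. finite B \<and> module.span smul B = UNIV)"

definition continuous_operators ::
    "('k::field \<Rightarrow> 'a::{topological_space, ab_group_add} \<Rightarrow> 'a) \<Rightarrow> ('a \<Rightarrow> 'a) set" where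
  "continuous_operators smul = {T. Vector_Spaces.linear smul smul T \<and> continuous_on UNIV T}"

definition continuous_dual ::
    "('k::real_normed_field \<Rightarrow> 'a::{topological_space, ab_group_add} \<Rightarrow> 'a) \<Rightarrow> ('a \<Rightarrow> 'k) set" where
  "continuous_dual smul = {f. Vector_Spaces.linear smul (*) f \<and> continuous_on UNIV f}"

definition dual_smul :: "'k::times \<Rightarrow> ('a \<Rightarrow> 'k) \<Rightarrow> 'a \<Rightarrow> 'k" where
  "dual_smul c f = (\<lambda>x. c * f x)"

definition dual_operator :: "('a \<Rightarrow> 'a) \<Rightarrow> ('a \<Rightarrow> 'k) \<Rightarrow> 'a \<Rightarrow> 'k" where
  "dual_operator T f = (\<lambda>x. f (T x))"

text \<open>Boundedness in the sense of topological vector spaces, not of any metric.\<close>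

definition tvs_bounded ::
    "('k::real_normed_field \<Rightarrow> 'a::{topological_space, ab_group_add} \<Rightarrow> 'a) \<Rightarrow> 'a set \<Rightarrow> bool" where
  "tvs_bounded smul B \<longleftrightarrow>
    (\<forall>U. open U \<and> 0 \<in> U \<longrightarrow> (\<exists>r>0. \<forall>c. norm c \<ge> r \<longrightarrow> B \<subseteq> smul c ` U))"

lemma tvs_bounded_Un:
  assumes "tvs_bounded smul A" "tvs_bounded smul B"
  shows "tvs_bounded smul (A \<union> B)"
  unfolding tvs_bounded_def
proof (intro allI impI)
  fix U :: "'b set"
  assume U: "open U \<and> 0 \<in> U"
  obtain r where r: "r > 0" "\<And>c. norm c \<ge> r \<Longrightarrow> A \<subseteq> smul c ` U"
    using assms(1) U unfolding tvs_bounded_def by blast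
  obtain s where s: "s > 0" "\<And>c. norm c \<ge> s \<Longrightarrow> B \<subseteq> smul c ` U"
    using assms(2) U unfolding tvs_bounded_def by blast
  show "\<exists>r>0. \<forall>c. norm c \<ge> r \<longrightarrow> A \<union> B \<subseteq> smul c ` U"
    using r s by (intro exI[of _ "max r s"]) auto
qed

text \<open>
  The topology of uniform convergence on bounded sets: the sets
  \<open>{g \<in> X'. \<forall>x\<in>B. norm (g x - f x) < e}\<close>, for bounded \<open>B\<close> and \<open>e > 0\<close>, form a
  neighbourhood base at \<open>f\<close>. They need not be open themselves.
\<close>

definition strong_dual_open ::
    "('k::real_normed_field \<Rightarrow> 'a::{topological_space, ab_group_add} \<Rightarrow> 'a) \<Rightarrow> ('a \<Rightarrow> 'k) set \<Rightarrow> bool" where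
  "strong_dual_open smul W \<longleftrightarrow> W \<subseteq> continuous_dual smul \<and>
    (\<forall>f\<in>W. \<exists>B e. tvs_bounded smul B \<and> e > 0 \<and>
      {g \<in> continuous_dual smul. \<forall>x\<in>B. norm (g x - f x) < e} \<subseteq> W)"

definition strong_dual ::
    "('k::real_normed_field \<Rightarrow> 'a::{topological_space, ab_group_add} \<Rightarrow> 'a) \<Rightarrow> ('a \<Rightarrow> 'k) topology" where
  "strong_dual smul = topology (strong_dual_open smul)"

lemma istopology_strong_dual_open: "istopology (strong_dual_open smul)"
  unfolding istopology_def
proof (intro conjI allI impI)
  fix S T
  assume S: "strong_dual_open smul S" and T: "strong_dual_open smul T"
  have "\<exists>B e. tvs_bounded smul B \<and> e > 0 \<and>
      {g \<in> continuous_dual smul. \<forall>x\<in>B. norm (g x - f x) < e} \<subseteq> S \<inter> T" if "f \<in> S \<inter> T" for f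
  proof -
    obtain A d where A: "tvs_bounded smul A" "d > 0"
        "{g \<in> continuous_dual smul. \<forall>x\<in>A. norm (g x - f x) < d} \<subseteq> S"
      using S \<open>f \<in> S \<inter> T\<close> unfolding strong_dual_open_def by blast
    obtain B e where B: "tvs_bounded smul B" "e > 0"
        "{g \<in> continuous_dual smul. \<forall>x\<in>B. norm (g x - f x) < e} \<subseteq> T"
      using T \<open>f \<in> S \<inter> T\<close> unfolding strong_dual_open_def by blast
    show ?thesis
      using A B by (intro exI[of _ "A \<union> B"] exI[of _ "min d e"]) (auto intro: tvs_bounded_Un)
  qed
  then show "strong_dual_open smul (S \<inter> T)"
    using S T unfolding strong_dual_open_def by blast
next
  fix \<K>
  assume "\<forall>K\<in>\<K>. strong_dual_open smul K"
  then show "strong_dual_open smul (\<Union>\<K>)"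
    unfolding strong_dual_open_def by (meson Union_iff Union_least Union_upper order_trans)
qed

lemma openin_strong_dual: "openin (strong_dual smul) = strong_dual_open smul"
  by (simp add: strong_dual_def istopology_strong_dual_open topology_inverse')

lemma topspace_strong_dual: "topspace (strong_dual smul) = continuous_dual smul"
proof -
  have "tvs_bounded smul {}"
    unfolding tvs_bounded_def by (auto intro: exI[of _ 1])
  then have "strong_dual_open smul (continuous_dual smul)"
    unfolding strong_dual_open_def by (auto intro!: exI[of _ "{}"] exI[of _ 1])
  then show ?thesis
    unfolding topspace_def openin_strong_dual
    by (intro antisym Union_least Union_upper) (auto simp: strong_dual_open_def)
qed

definition dense_in :: "'b topology \<Rightarrow> 'b set \<Rightarrow> bool" where
  "dense_in Z D \<longleftrightarrow> D \<subseteq> topspace Z \<and> Z closure_of D = topspace Z"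

definition ell1_sequence ::
    "('k::real_normed_field \<Rightarrow> 'b::ab_group_add \<Rightarrow> 'b) \<Rightarrow> 'b topology \<Rightarrow> (nat \<Rightarrow> 'b) \<Rightarrow> bool" where
  "ell1_sequence smul Z x \<longleftrightarrow> range x \<subseteq> topspace Z \<and> limitin Z x 0 sequentially \<and>
    (\<forall>a :: nat \<Rightarrow> 'k. summable (\<lambda>n. norm (a n)) \<longrightarrow>
      (\<exists>s. limitin Z (\<lambda>N. \<Sum>n<N. smul (a n) (x n)) s sequentially))"

definition hypercyclic :: "'b topology \<Rightarrow> ('b \<Rightarrow> 'b) \<Rightarrow> bool" where
  "hypercyclic Z S \<longleftrightarrow> (\<exists>z\<in>topspace Z. dense_in Z (range (\<lambda>n. (S ^^ n) z)))"

definition dual_hypercyclic ::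
    "('k::real_normed_field \<Rightarrow> 'a::{topological_space, ab_group_add} \<Rightarrow> 'a) \<Rightarrow> ('a \<Rightarrow> 'a) \<Rightarrow> bool" where
  "dual_hypercyclic smul T \<longleftrightarrow> T \<in> continuous_operators smul \<and>
    hypercyclic euclidean T \<and> hypercyclic (strong_dual smul) (dual_operator T)"

end

theory Submission
  imports Defs
begin

text \<open>
  The functionals of an \<open>\<ell>\<^sub>1\<close>-sequence in the strong dual are bounded on a common neighbourhood of 0.
  Biorthogonalisation, with Hahn--Banach for separation, yields \<open>x m \<in> X\<close> with dense span and
  biorthogonal functionals \<open>\<phi> m\<close>, indexed by the integers, with strongly dense span and still each
  bounded on that neighbourhood. Hence \<open>T x = x + (\<Sum>m. w (m + 1) * \<phi> (m + 1) x * x m)\<close> is a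
  continuous operator for small weights \<open>w\<close>, and in coordinates both \<open>T\<close> and its dual are the
  identity plus a bilateral weighted shift, in opposite directions, on bounded sequences.
  A finite window of weights behaves like a nilpotent Jordan block, for which \<open>T\<close> is the translation
  of polynomials; two polynomials of degree less than \<open>n\<close> can be joined by a long translation of a
  polynomial of degree less than \<open>2 * n\<close>. Choosing a weight at one end of each window tiny,
  alternately at the left end (for \<open>T\<close>) and at the right end (for the dual), makes the windows almost
  invariant, and hypercyclic vectors are then built by successive approximation.
\<close>


section \<open>Hahn--Banach separation\<close>

text \<open>\<open>T\<close> and its dual move mass in opposite directions along one and the same
  family of weights, so \<open>T\<close> wants a negligible weight at the left end of a window and
  the dual at the right end. The demands do not conflict: inside a window steering works for
  arbitrary positive weights, which influence only the time \<open>k\<close> and how small the one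
  leaking weight has to be. A weight made tiny for one window is therefore a harmless interior
  weight of the later windows. Nothing enters a window from the other end, because the steering
  vector vanishes there.

  The index set has to be two-sided: over the naturals the dual would leave the coordinate at 0
  unchanged along every orbit.

  The strong dual need not be metrizable, which rules out a category argument there. Both orbits are
  built among bounded scalar sequences with the sup norm, where only finitely supported targets have
  to be approached. They are then carried over by two synthesis maps that intertwine the operators;
  one is continuous into \<open>X\<close>, the other controls functionals uniformly on bounded
  sets.\<close>

definition sublinear_wrt :: "(real \<Rightarrow> 'a::ab_group_add \<Rightarrow> 'a) \<Rightarrow> ('a \<Rightarrow> real) \<Rightarrow> bool" where
  "sublinear_wrt s p \<longleftrightarrow> (\<forall>x y. p (x + y) \<le> p x + p y) \<and> (\<forall>c>0. \<forall>x. p (s c x) \<le> c * p x)"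

text \<open>Homogeneity is demanded only as an inequality, which is easier to check for infima;
  using it a second time with \<open>1 / c\<close> gives the reverse.\<close>

lemma sublinear_scale:
  fixes s :: "real \<Rightarrow> 'z::ab_group_add \<Rightarrow> 'z"
  assumes "vector_space s" "sublinear_wrt s p" "c > 0"
  shows "p (s c x) = c * p x"
proof -
  interpret s: vector_space s by fact
  have "p (s (1 / c) (s c x)) \<le> 1 / c * p (s c x)"
    using assms unfolding sublinear_wrt_def by (meson divide_pos_pos zero_less_one)
  then have "c * p x \<le> p (s c x)"
    using \<open>c > 0\<close> by (simp add: field_simps)
  then show ?thesis
    using assms unfolding sublinear_wrt_def by (meson antisym)
qed

lemma sublinear_zero:
  assumes "vector_space s" "sublinear_wrt s p"
  shows "p 0 = 0"
proof -
  interpret s: vector_space s by fact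
  have "p (s 2 0) = 2 * p 0"
    by (rule sublinear_scale[OF assms]) simp
  then show ?thesis by simp
qed

lemma sublinear_ge_minus:
  assumes "vector_space s" "sublinear_wrt s p"
  shows "- p (- x) \<le> p x"
proof -
  have "p (x + - x) \<le> p x + p (- x)"
    using assms(2) unfolding sublinear_wrt_def by blast
  then show ?thesis using sublinear_zero[OF assms] by simp
qed

text \<open>\<open>q\<close> is lowered in direction \<open>u\<close>: \<open>q' x\<close> is the
  infimum of \<open>q (x + t u) - t * q u\<close> over nonnegative \<open>t\<close>, bounded below
  by \<open>- q (- x)\<close>. The value \<open>t = 0\<close> shows \<open>q' \<le> q\<close>, and
  \<open>t = 1\<close> at \<open>- u\<close> gives the last claim.\<close>

lemma sublinear_reduce:
  fixes s :: "real \<Rightarrow> 'a::ab_group_add \<Rightarrow> 'a"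
  assumes "vector_space s" "sublinear_wrt s q"
  obtains q' where "sublinear_wrt s q'" "\<And>x. q' x \<le> q x" "q' (- u) \<le> - q u"
proof -
  interpret s: vector_space s by fact
  have sub: "q (x + y) \<le> q x + q y" for x y
    using assms(2) unfolding sublinear_wrt_def by blast
  have hom: "c > 0 \<Longrightarrow> q (s c x) = c * q x" for c x
    using sublinear_scale[OF assms] .
  define g where "g x t = q (x + s t u) - t * q u" for x t
  define q' where "q' x = (INF t\<in>{0..}. g x t)" for x
  have su: "q (s t u) = t * q u" if "t \<ge> 0" for t
    using hom[of t u] sublinear_zero[OF assms] that by (cases "t = 0") auto
  have lb: "- q (- x) \<le> g x t" if "t \<ge> 0" for x t
    using sub[of "x + s t u" "- x"] su[OF that] by (simp add: g_def)
  have bdd: "bdd_below (g x ` {0..})" for x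
    using lb by (intro bdd_belowI2[of _ "- q (- x)"]) auto
  have le: "q' x \<le> g x t" if "t \<ge> 0" for x t
    unfolding q'_def using that by (intro cINF_lower bdd) auto
  have "q' (x + y) \<le> q' x + q' y" for x y
  proof -
    have 1: "q' (x + y) \<le> g x a + g y b" if "a \<ge> 0" "b \<ge> 0" for a b
    proof -
      have "q' (x + y) \<le> g (x + y) (a + b)"
        using that by (intro le) auto
      also have "\<dots> \<le> g x a + g y b"
        using sub[of "x + s a u" "y + s b u"]
        by (simp add: g_def s.scale_left_distrib algebra_simps)
      finally show ?thesis .
    qed
    have 2: "q' (x + y) - g x a \<le> q' y" if "a \<ge> 0" for a
      unfolding q'_def[of y] using 1[OF that] by (intro cINF_greatest) (auto simp: algebra_simps)
    have "q' (x + y) - q' y \<le> q' x"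
      unfolding q'_def[of x] using 2 by (intro cINF_greatest) (auto simp: algebra_simps)
    then show ?thesis by simp
  qed
  moreover have "q' (s c x) \<le> c * q' x" if "c > 0" for c x
  proof -
    have "q' (s c x) / c \<le> q' x"
      unfolding q'_def[of x]
    proof (intro cINF_greatest)
      fix t :: real assume "t \<in> {0..}"
      then have "q' (s c x) \<le> g (s c x) (c * t)"
        using that by (intro le) auto
      also have "\<dots> = c * g x t"
        using hom[OF that, of "x + s t u"] by (simp add: g_def s.scale_right_distrib algebra_simps)
      finally show "q' (s c x) / c \<le> g x t"
        using that by (simp add: field_simps)
    qed auto
    then show ?thesis using that by (simp add: field_simps)
  qed
  ultimately have "sublinear_wrt s q'"
    unfolding sublinear_wrt_def by blast
  moreover have "q' x \<le> q x" for x
    using le[of 0 x] by (simp add: g_def)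
  moreover have "q' (- u) \<le> - q u"
    using le[of 1 "- u"] sublinear_zero[OF assms] by (simp add: g_def)
  ultimately show ?thesis using that by blast
qed

text \<open>A functional that is minimal among the sublinear ones is linear, by \<open>sublinear_reduce\<close>.\<close>

theorem hahn_banach_sublinear:
  fixes s :: "real \<Rightarrow> 'a::ab_group_add \<Rightarrow> 'a"
  assumes "vector_space s" "sublinear_wrt s p"
  obtains F where "\<And>x y. F (x + y) = F x + F y" "\<And>c x. F (s c x) = c * F x"
    "\<And>x. F x \<le> p x" "F u = p u"
proof -
  interpret s: vector_space s by fact
  \<comment> \<open>Lowering \<open>p\<close> in direction \<open>u\<close> beforehand forces
    \<open>F (- u) \<le> - p u\<close> for each minorant of \<open>p'\<close>, so a linear one
    attains \<open>p u\<close> at \<open>u\<close>.\<close>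
  obtain p' where p': "sublinear_wrt s p'" "\<And>x. p' x \<le> p x" "p' (- u) \<le> - p u"
    using sublinear_reduce[OF assms] by blast
  define A where "A = {q. sublinear_wrt s q \<and> (\<forall>x. q x \<le> p' x)}"
  \<comment> \<open>The order is reversed, so that the maximal element of Zorn's lemma is a minimal
    functional.\<close>
  define P where "P q r \<longleftrightarrow> (\<forall>x. r x \<le> q x)" for q r :: "'a \<Rightarrow> real"
  have "\<exists>m\<in>A. \<forall>a\<in>A. P m a \<longrightarrow> a = m"
  proof (rule predicate_Zorn)
    show "partial_order_on A (relation_of P A)"
    proof (rule partial_order_on_relation_ofI)
      show "P a c" if "P a b" "P b c" for a b c
        using that unfolding P_def by (meson order_trans)
      show "a = b" if "P a b" "P b a" for a b
        using that unfolding P_def by (intro ext antisym) auto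
    qed (simp add: P_def)
  next
    fix C assume C: "C \<in> Chains (relation_of P A)"
    show "\<exists>u\<in>A. \<forall>a\<in>C. P a u"
    proof (cases "C = {}")
      case True
      then show ?thesis using p' by (auto simp: A_def)
    next
      case False
      have CA: "C \<subseteq> A" and tot: "\<And>a b. a \<in> C \<Longrightarrow> b \<in> C \<Longrightarrow> P a b \<or> P b a"
        using C by (auto simp: Chains_def relation_of_def)
      have sub: "sublinear_wrt s q" and qp: "q x \<le> p' x" if "q \<in> C" for q x
        using CA that by (auto simp: A_def)
      define r where "r x = (INF q\<in>C. q x)" for x
      have lb: "- p' (- x) \<le> q x" if "q \<in> C" for q x
        using sublinear_ge_minus[OF assms(1) sub[OF that], of x] qp[OF that, of "- x"] by simp
      have bdd: "bdd_below ((\<lambda>q. q x) ` C)" for x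
        using lb by (intro bdd_belowI2[of _ "- p' (- x)"]) auto
      have le: "r x \<le> q x" if "q \<in> C" for q x
        unfolding r_def using that by (intro cINF_lower bdd) auto
      have "r (x + y) \<le> r x + r y" for x y
      proof -
        \<comment> \<open>Two members of a chain have a common lower member, which makes the infimum
          over the chain subadditive.\<close>
        have 1: "r (x + y) \<le> a x + b y" if ab: "a \<in> C" "b \<in> C" for a b
        proof -
          obtain c where "c \<in> C" "P a c" "P b c"
            using tot[OF ab] ab unfolding P_def by blast
          then have "r (x + y) \<le> c x + c y"
            using le[of c "x + y"] sub[of c] unfolding sublinear_wrt_def by (meson order_trans)
          then show ?thesis
            using \<open>P a c\<close> \<open>P b c\<close> unfolding P_def by (meson add_mono order_trans)
        qed
        have 2: "r (x + y) - a x \<le> r y" if "a \<in> C" for a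
          unfolding r_def[of y] using 1[OF that] False by (intro cINF_greatest) (auto simp: algebra_simps)
        have "r (x + y) - r y \<le> r x"
          unfolding r_def[of x] using 2 False by (intro cINF_greatest) (auto simp: algebra_simps)
        then show ?thesis by simp
      qed
      moreover have "r (s c x) \<le> c * r x" if "c > 0" for c x
      proof -
        have "r (s c x) / c \<le> r x"
          unfolding r_def[of x]
        proof (intro cINF_greatest)
          fix q assume "q \<in> C"
          then have "r (s c x) \<le> c * q x"
            using le[of q "s c x"] sub[of q] that unfolding sublinear_wrt_def by (meson order_trans)
          then show "r (s c x) / c \<le> q x"
            using that by (simp add: field_simps)
        qed (use False in auto)
        then show ?thesis using that by (simp add: field_simps)
      qed
      ultimately have "sublinear_wrt s r"
        unfolding sublinear_wrt_def by blast
      moreover have "r x \<le> p' x" for x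
        using False le qp by (meson all_not_in_conv order_trans)
      ultimately show ?thesis
        using le unfolding A_def P_def by blast
    qed
  qed
  then obtain F where F: "F \<in> A" and min: "\<And>q. q \<in> A \<Longrightarrow> P F q \<Longrightarrow> q = F"
    by blast
  have sF: "sublinear_wrt s F" and Fp: "F x \<le> p' x" for x
    using F by (auto simp: A_def)
  \<comment> \<open>By minimality, lowering \<open>F\<close> in direction \<open>v\<close> gives
    back \<open>F\<close>.\<close>
  have odd: "F (- v) = - F v" for v
  proof -
    obtain q where q: "sublinear_wrt s q" "\<And>x. q x \<le> F x" "q (- v) \<le> - F v"
      using sublinear_reduce[OF assms(1) sF] by blast
    have "q \<in> A" "P F q"
      using q Fp unfolding A_def P_def by (auto intro: order_trans)
    then have "q = F" by (rule min)
    then show ?thesis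
      using q(3) sublinear_ge_minus[OF assms(1) sF, of "- v"] by simp
  qed
  show ?thesis
  proof
    show add: "F (x + y) = F x + F y" for x y
    proof -
      have "F (x + y) \<le> F x + F y" "F (- x + - y) \<le> F (- x) + F (- y)"
        using sF unfolding sublinear_wrt_def by blast+
      moreover have "- x + - y = - (x + y)" by simp
      ultimately show ?thesis by (simp only: odd)
    qed
    show "F (s c x) = c * F x" for c x
    proof -
      consider "c > 0" | "c = 0" | "- c > 0" by linarith
      then show ?thesis
      proof cases
        case 1 then show ?thesis by (rule sublinear_scale[OF assms(1) sF])
      next
        case 2 then show ?thesis using sublinear_zero[OF assms(1) sF] by simp
      next
        case 3
        have "F (s c x) = - F (s (- c) x)"
          using odd[of "s (- c) x"] by simp
        also have "\<dots> = c * F x"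
          using sublinear_scale[OF assms(1) sF 3, of x] by simp
        finally show ?thesis .
      qed
    qed
    show "F x \<le> p x" for x
      using Fp p'(2) by (meson order_trans)
    then show "F u = p u"
      using p'(3) Fp[of "- u"] odd[of u] by (intro antisym) auto
  qed
qed

text \<open>\<open>p\<close> is the Minkowski gauge of \<open>V\<close>. A value below 1 at
  \<open>u\<close> would make \<open>u\<close> a convex combination of 0 and a point
  \<open>u / t\<close> of \<open>V\<close>.\<close>

lemma minkowski_sublinear:
  fixes s :: "real \<Rightarrow> 'a::ab_group_add \<Rightarrow> 'a"
  assumes "vector_space s"
    and cvx: "\<And>x y a b. x \<in> V \<Longrightarrow> y \<in> V \<Longrightarrow> a \<ge> 0 \<Longrightarrow> b \<ge> 0 \<Longrightarrow> a + b = 1 \<Longrightarrow> s a x + s b y \<in> V"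
    and absorb: "\<And>x. \<exists>t>0. s t x \<in> V"
    and "u \<notin> V"
  obtains p where "sublinear_wrt s p" "\<And>x. x \<in> V \<Longrightarrow> p x \<le> 1" "p u \<ge> 1"
proof -
  interpret s: vector_space s by fact
  define G where "G x = {t. t > 0 \<and> s (1 / t) x \<in> V}" for x
  define p where "p x = Inf (G x)" for x
  have ne: "G x \<noteq> {}" for x
  proof -
    obtain t where "t > 0" "s t x \<in> V" using absorb by blast
    then have "1 / t \<in> G x" by (simp add: G_def)
    then show ?thesis by blast
  qed
  have bdd: "bdd_below (G x)" for x
    by (rule bdd_belowI[of _ 0]) (auto simp: G_def)
  have le: "p x \<le> t" if "t \<in> G x" for x t
    unfolding p_def using that bdd by (rule cInf_lower)
  have "p (x + y) \<le> p x + p y" for x y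
  proof -
    have 1: "p (x + y) \<le> a + b" if "a \<in> G x" "b \<in> G y" for a b
    proof (rule le)
      have ab: "a > 0" "b > 0" "s (1 / a) x \<in> V" "s (1 / b) y \<in> V"
        using that by (auto simp: G_def)
      have "s (a / (a + b)) (s (1 / a) x) + s (b / (a + b)) (s (1 / b) y) \<in> V"
        using ab by (intro cvx) (auto simp: add_divide_distrib[symmetric])
      then have "s (1 / (a + b)) (x + y) \<in> V"
        using ab by (simp add: s.scale_right_distrib)
      then show "a + b \<in> G (x + y)"
        using ab by (simp add: G_def)
    qed
    have 2: "p (x + y) - a \<le> p y" if "a \<in> G x" for a
      unfolding p_def[of y] using 1[OF that] ne by (intro cInf_greatest) (auto simp: algebra_simps)
    have "p (x + y) - p y \<le> p x"
      unfolding p_def[of x] using 2 ne by (intro cInf_greatest) (auto simp: algebra_simps)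
    then show ?thesis by simp
  qed
  moreover have "p (s c x) \<le> c * p x" if "c > 0" for c x
  proof -
    have "p (s c x) / c \<le> p x"
      unfolding p_def[of x]
    proof (intro cInf_greatest ne)
      fix t assume "t \<in> G x"
      then have "c * t \<in> G (s c x)"
        using that by (auto simp: G_def)
      then have "p (s c x) \<le> c * t" by (rule le)
      then show "p (s c x) / c \<le> t"
        using that by (simp add: field_simps)
    qed
    then show ?thesis using that by (simp add: field_simps)
  qed
  ultimately have "sublinear_wrt s p"
    unfolding sublinear_wrt_def by blast
  moreover have "p x \<le> 1" if "x \<in> V" for x
    using that by (intro le) (simp add: G_def)
  moreover have "p u \<ge> 1"
    unfolding p_def
  proof (intro cInf_greatest ne)
    fix t assume t: "t \<in> G u"
    show "1 \<le> t"
    proof (rule ccontr)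
      assume "\<not> 1 \<le> t"
      moreover have "0 \<in> V"
        using cvx[of "s (1 / t) u" "s (1 / t) u" 1 0] absorb[of 0] by auto
      ultimately have "s t (s (1 / t) u) + s (1 - t) 0 \<in> V"
        using t by (intro cvx) (auto simp: G_def)
      then show False
        using t \<open>u \<notin> V\<close> by (simp add: G_def)
    qed
  qed
  ultimately show ?thesis using that by blast
qed

lemma continuous_on_additive:
  fixes f :: "'a::topological_ab_group_add \<Rightarrow> 'b::topological_ab_group_add"
  assumes add: "\<And>x y. f (x + y) = f x + f y"
    and 0: "\<And>W. open W \<Longrightarrow> 0 \<in> W \<Longrightarrow> \<exists>U. open U \<and> 0 \<in> U \<and> f ` U \<subseteq> W"
  shows "continuous_on UNIV f"
proof -
  have "\<exists>A. open A \<and> x \<in> A \<and> (\<forall>y\<in>A. f y \<in> B)" if B: "open B" "f x \<in> B" for x B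
  proof -
    have "open ((\<lambda>y. f x + y) -` B)"
      using B by (intro open_vimage continuous_intros)
    then obtain U where U: "open U" "0 \<in> U" "f ` U \<subseteq> (\<lambda>y. f x + y) -` B"
      using 0[of "(\<lambda>y. f x + y) -` B"] B by auto
    have "open ((\<lambda>y. y - x) -` U)"
      using U by (intro open_vimage continuous_intros)
    moreover have "f y \<in> B" if "y - x \<in> U" for y
    proof -
      have "f y = f x + f (y - x)"
        using add[of x "y - x"] by simp
      then show ?thesis
        using U that by auto
    qed
    ultimately show ?thesis
      using U by (intro exI[of _ "(\<lambda>y. y - x) -` U"]) auto
  qed
  then show ?thesis
    unfolding continuous_on_topological by (metis UNIV_I)
qed

context topological_vector_space
begin

lemma continuous_on_scale [continuous_intros]:
  assumes "continuous_on S f" "continuous_on S g"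
  shows "continuous_on S (\<lambda>x. smul (f x) (g x))"
proof -
  have "continuous_on S (\<lambda>x. (\<lambda>(c, y). smul c y) (f x, g x))"
    by (rule continuous_on_compose2[OF continuous_smul]) (auto intro!: continuous_intros assms)
  then show ?thesis by simp
qed

lemma real_vector_space: "vector_space (\<lambda>c. smul (of_real c))"
  by unfold_locales (simp_all add: scale_right_distrib scale_left_distrib)

end

context frechet_space
begin

lemma open_Compl_singleton: "open (- {u :: 'a})"
proof -
  have "t1_space (euclidean :: 'a topology)"
    using metrizable by (intro Hausdorff_imp_t1_space metrizable_imp_Hausdorff_space)
  then have "closedin (euclidean :: 'a topology) {u}"
    by (simp add: t1_space_closedin_singleton)
  then show ?thesis
    by (simp add: open_Compl)
qed

lemma real_functional_separates:
  assumes "u \<noteq> 0"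
  obtains F where "\<And>x y. F (x + y) = F x + F y" "\<And>c x. F (smul (of_real c) x) = c * F x"
    "continuous_on UNIV F" "F u \<noteq> 0"
proof -
  let ?s = "\<lambda>c. smul (of_real c)"
  have vs: "vector_space ?s" by (rule real_vector_space)
  obtain V where V: "open V" "0 \<in> V" "convex_wrt smul V" "V \<subseteq> - {u}"
    using locally_convex[OF open_Compl_singleton] assms by auto
  have absorb: "\<exists>t>0. ?s t x \<in> V" for x
  proof -
    have "open ((\<lambda>t. ?s t x) -` V)"
      using V by (intro open_vimage continuous_intros)
    moreover have "0 \<in> (\<lambda>t. ?s t x) -` V"
      using V by simp
    ultimately obtain e where "e > 0" "ball 0 e \<subseteq> (\<lambda>t. ?s t x) -` V"
      using open_contains_ball by metis
    moreover have "e / 2 \<in> ball 0 e"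
      using \<open>e > 0\<close> by (simp add: dist_norm)
    ultimately have "?s (e / 2) x \<in> V"
      by blast
    then show ?thesis using \<open>e > 0\<close> half_gt_zero by blast
  qed
  obtain p where p: "sublinear_wrt ?s p" "\<And>x. x \<in> V \<Longrightarrow> p x \<le> 1" "p u \<ge> 1"
  proof (rule minkowski_sublinear[OF vs _ absorb, of u])
    show "smul (of_real a) x + smul (of_real b) y \<in> V"
      if "x \<in> V" "y \<in> V" "0 \<le> a" "0 \<le> b" "a + b = 1" for x y a b
      using V(3) that unfolding convex_wrt_def by blast
  qed (use V in auto)
  obtain F where F: "\<And>x y. F (x + y) = F x + F y" "\<And>c x. F (?s c x) = c * F x"
      "\<And>x. F x \<le> p x" "F u = p u"
    using hahn_banach_sublinear[OF vs p(1)] by blast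
  have "continuous_on UNIV F"
  proof (rule continuous_on_additive[OF F(1)])
    fix W :: "real set" assume "open W" "0 \<in> W"
    then obtain e where e: "e > 0" "ball 0 e \<subseteq> W"
      by (meson open_contains_ball)
    \<comment> \<open>\<open>V\<close> is not known to be balanced, so both signs are required in
      order to bound \<open>F\<close> from above and from below. The factor 2 makes the bound
      strict.\<close>
    let ?U = "(\<lambda>x. ?s (2 / e) x) -` V \<inter> (\<lambda>x. ?s (- (2 / e)) x) -` V"
    have "open ?U"
      using V by (intro open_Int open_vimage continuous_intros)
    moreover have "F x \<in> W" if "x \<in> ?U" for x
    proof -
      have "2 / e * F x \<le> 1"
        using that F(2)[of "2 / e" x] F(3)[of "?s (2 / e) x"] p(2)[of "?s (2 / e) x"] by simp
      moreover have "- (2 / e) * F x \<le> 1"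
        using that F(2)[of "- (2 / e)" x] F(3)[of "?s (- (2 / e)) x"] p(2)[of "?s (- (2 / e)) x"] by auto
      ultimately have "\<bar>F x\<bar> < e"
        using e by (auto simp: field_simps abs_less_iff)
      then show ?thesis
        using e by (auto simp: subset_iff dist_norm)
    qed
    ultimately show "\<exists>U. open U \<and> 0 \<in> U \<and> F ` U \<subseteq> W"
      using V by (intro exI[of _ ?U]) auto
  qed
  then show ?thesis
    using that F p(3) by (metis not_one_le_zero)
qed

end

lemma dual_separates_real:
  fixes smul :: "real \<Rightarrow> 'a::{topological_ab_group_add, uniform_topological_group_add} \<Rightarrow> 'a"
  assumes "frechet_space smul" "u \<noteq> 0"
  shows "\<exists>f\<in>continuous_dual smul. f u \<noteq> 0"
proof -
  interpret frechet_space smul by fact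
  obtain F where F: "\<And>x y. F (x + y) = F x + F y" "\<And>c x. F (smul (of_real c) x) = c * F x"
      "continuous_on UNIV F" "F u \<noteq> 0"
    using real_functional_separates[OF assms(2)] by blast
  have "Vector_Spaces.linear smul (*) F"
    using F by unfold_locales (auto simp: algebra_simps)
  then show ?thesis
    using F unfolding continuous_dual_def by blast
qed

lemma dual_separates_complex:
  fixes smul :: "complex \<Rightarrow> 'a::{topological_ab_group_add, uniform_topological_group_add} \<Rightarrow> 'a"
  assumes "frechet_space smul" "u \<noteq> 0"
  shows "\<exists>f\<in>continuous_dual smul. f u \<noteq> 0"
proof -
  interpret frechet_space smul by fact
  obtain F where F: "\<And>x y. F (x + y) = F x + F y" "\<And>c x. F (smul (of_real c) x) = c * F x"
      "continuous_on UNIV F" "F u \<noteq> 0"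
    using real_functional_separates[OF assms(2)] by blast
  \<comment> \<open>The complex-linear functional whose real part is the real-linear
    \<open>F\<close>.\<close>
  define f where "f x = Complex (F x) (- F (smul \<i> x))" for x
  have sc: "F (smul c x) = Re c * F x + Im c * F (smul \<i> x)" for c x
  proof -
    have "smul c x = smul (of_real (Re c)) x + smul (of_real (Im c)) (smul \<i> x)"
      by (subst complex_eq[of c], subst scale_left_distrib) (simp add: mult.commute)
    then show ?thesis by (simp only: F(1,2))
  qed
  have sci: "F (smul (\<i> * c) x) = Re c * F (smul \<i> x) - Im c * F x" for c x
    using sc[of "\<i> * c" x] by (simp add: algebra_simps)
  have "f (smul c x) = c * f x" for c x
    using sc[of c x] sci[of c x] by (simp add: f_def complex_eq_iff algebra_simps)
  moreover have "f (x + y) = f x + f y" for x y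
    using F(1) by (simp add: f_def complex_eq_iff scale_right_distrib)
  ultimately have "Vector_Spaces.linear smul (*) f"
    by unfold_locales (auto simp: algebra_simps)
  moreover have "continuous_on UNIV f"
  proof -
    have "continuous_on UNIV (\<lambda>x. F (smul \<i> x))"
      by (rule continuous_on_compose2[OF F(3)]) (auto intro!: continuous_intros)
    then show ?thesis
      unfolding f_def Complex_eq by (intro continuous_intros F(3))
  qed
  moreover have "f u \<noteq> 0"
    using F(4) by (simp add: f_def complex_eq_iff)
  ultimately show ?thesis
    unfolding continuous_dual_def by blast
qed


section \<open>Steering polynomials by translation\<close>

text \<open>Iterated forward differences. The numbers \<open>fdiff l f t\<close> are the coordinates
  of the translate of \<open>f\<close> by \<open>t\<close>, and the recursion, read as
  \<open>fdiff l f (Suc t) = fdiff l f t + fdiff (Suc l) f t\<close>, says that translation by 1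
  acts on them as identity plus backward shift.\<close>

fun fdiff :: "nat \<Rightarrow> (nat \<Rightarrow> real) \<Rightarrow> nat \<Rightarrow> real" where
  "fdiff 0 f t = f t"
| "fdiff (Suc l) f t = fdiff l f (Suc t) - fdiff l f t"

lemma fdiff_inner: "fdiff (Suc l) f t = fdiff l (\<lambda>t. f (Suc t) - f t) t"
  by (induction l arbitrary: t) auto

lemma fdiff_add: "fdiff l (\<lambda>t. f t + g t) t = fdiff l f t + fdiff l g t"
  by (induction l arbitrary: t) auto

lemma fdiff_cmult: "fdiff l (\<lambda>t. c * f t) t = c * fdiff l f t"
  by (induction l arbitrary: t) (auto simp: algebra_simps)

lemma fdiff_shift: "fdiff l (\<lambda>t. f (t + k)) t = fdiff l f (t + k)"
  by (induction l arbitrary: t) auto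

lemma fdiff_tendsto:
  assumes "\<And>i. (\<lambda>k. F k i) \<longlonglongrightarrow> G i"
  shows "(\<lambda>k. fdiff l (F k) t) \<longlonglongrightarrow> fdiff l G t"
  by (induction l arbitrary: t) (auto intro!: assms tendsto_diff)

text \<open>A linear factor raises the degree by at most one. The induction rests on the discrete
  product rule: the difference of \<open>(a + b t) f\<close> is \<open>(a + b t)\<close> times the
  difference of \<open>f\<close>, plus \<open>b * f (t + 1)\<close>.\<close>

lemma fdiff_linear_mult:
  assumes "\<And>t. fdiff d f t = 0"
  shows "fdiff (Suc d) (\<lambda>t. (a + b * real t) * f t) t = 0"
  using assms
proof (induction d arbitrary: f t)
  case (Suc d)
  have "fdiff (Suc (Suc d)) (\<lambda>t. (a + b * real t) * f t) t
      = fdiff (Suc d) (\<lambda>t. (a + b * real t) * (f (Suc t) - f t) + b * f (t + 1)) t"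
    by (subst fdiff_inner) (simp add: algebra_simps)
  also have "\<dots> = fdiff (Suc d) (\<lambda>t. (a + b * real t) * (f (Suc t) - f t)) t
      + b * fdiff (Suc d) f (t + 1)"
    by (simp only: fdiff_add fdiff_cmult fdiff_shift)
  also have "\<dots> = 0"
    using Suc.IH[of "\<lambda>t. f (Suc t) - f t" t] Suc.prems fdiff_inner[of d f] by simp
  finally show ?case .
qed auto

lemma fdiff_linear_power_mult:
  assumes "\<And>t. fdiff d f t = 0"
  shows "fdiff (d + n) (\<lambda>t. f t * (a + b * real t) ^ n) t = 0"
proof (induction n arbitrary: t)
  case (Suc n)
  show ?case
    using fdiff_linear_mult[OF Suc, of a b t] by (simp add: algebra_simps)
qed (simp add: assms)

lemma fdiff_zero_mono:
  assumes "\<And>t. fdiff d f t = 0" "d \<le> e"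
  shows "fdiff e f t = 0"
  using assms(2) by (induction e arbitrary: t rule: dec_induct) (auto simp: assms(1))

text \<open>Pascal's rule, iterated. The real offset \<open>c\<close> also admits the negative
  arguments \<open>- k + t\<close> that occur in \<open>polynomial_steering\<close>.\<close>

lemma fdiff_gbinomial:
  "fdiff l (\<lambda>t. (c + real t) gchoose j) t = (if l \<le> j then (c + real t) gchoose (j - l) else 0)"
proof (induction l arbitrary: t)
  case (Suc l)
  consider "Suc l \<le> j" | "l = j" | "l > j" by linarith
  then show ?case
  proof cases
    case 1
    then obtain i where i: "j - l = Suc i" "j - Suc l = i"
      by (metis Suc_diff_Suc Suc_le_eq)
    show ?thesis
      using 1 Suc gbinomial_Suc_Suc[of "c + real t" i] by (simp add: i add.assoc add.commute[of 1])
  qed (use Suc in auto)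
qed simp

text \<open>The numerator has degree \<open>j\<close> in \<open>k\<close>. Raising \<open>j\<close>
  by one multiplies it by \<open>(c + d k - j) / (j + 1)\<close>, which stays bounded after division
  by \<open>k\<close>.\<close>

lemma gbinomial_over_power_tendsto:
  assumes "j < n"
  shows "(\<lambda>k. ((c + d * real k) gchoose j) / real k ^ n) \<longlonglongrightarrow> 0"
  using assms
proof (induction j arbitrary: n)
  case 0
  have "(\<lambda>k. (1 / real k) ^ n) \<longlonglongrightarrow> 0 ^ n"
    by (intro tendsto_power lim_1_over_n)
  then show ?case using 0 by (simp add: power_divide zero_power)
next
  case (Suc j)
  then obtain m where m: "n = Suc m" "j < m"
    by (metis Suc_lessE)
  have "(\<lambda>k. (c - real j) * (1 / real k) + d) \<longlonglongrightarrow> (c - real j) * 0 + d"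
    by (intro tendsto_intros lim_1_over_n)
  then have "(\<lambda>k. (((c + d * real k) gchoose j) / real k ^ m) *
      (((c - real j) * (1 / real k) + d) / real (Suc j))) \<longlonglongrightarrow> 0 * (((c - real j) * 0 + d) / real (Suc j))"
    by (intro tendsto_mult Suc.IH m tendsto_divide) auto
  moreover have "\<forall>\<^sub>F k in sequentially. (((c + d * real k) gchoose j) / real k ^ m) *
      (((c - real j) * (1 / real k) + d) / real (Suc j)) = ((c + d * real k) gchoose (Suc j)) / real k ^ n"
    using eventually_gt_at_top[of 0]
  proof eventually_elim
    case (elim k)
    have "((c + d * real k) gchoose (Suc j)) = ((c + d * real k) gchoose j) * (c + d * real k - real j) / real (Suc j)"
      using gbinomial_absorb_comp[of "c + d * real k" j] gbinomial_absorption[of j "c + d * real k - 1"]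
        gbinomial_mult_1[of "c + d * real k" j]
      by (simp add: field_simps)
    moreover have "g / x ^ m * (((c - real j) * (1 / x) + d) / s) = g * (c + d * x - real j) / s / x ^ Suc m"
      if "x > 0" "s > 0" for g x s :: real
      using that by (simp add: field_simps)
    ultimately show ?case using elim m(1) by simp
  qed
  ultimately show ?case
    by (simp add: tendsto_cong)
qed

text \<open>
  Given polynomials \<open>u\<close> and \<open>v\<close> of degree less than \<open>n\<close>, the polynomial
  \<open>p t = u t * (1 - t / k) ^ n + v (t - k) * (t / k) ^ n\<close> of degree less than \<open>2 * n\<close> is close
  to \<open>u\<close>, and its translate by \<open>k\<close> is close to \<open>v\<close>, when \<open>k\<close> is large.
\<close>

lemma polynomial_steering:
  fixes n :: nat and \<eta> :: real
  assumes "\<eta> > 0"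
  obtains k :: nat and P Q :: "nat \<Rightarrow> nat \<Rightarrow> real" where
    "\<And>j t. j < n \<Longrightarrow> fdiff (2 * n) (P j) t = 0"
    "\<And>j t. j < n \<Longrightarrow> fdiff (2 * n) (Q j) t = 0"
    "\<And>j l. j < n \<Longrightarrow> l < 2 * n \<Longrightarrow> \<bar>fdiff l (P j) 0 - of_bool (l = j)\<bar> \<le> \<eta>"
    "\<And>j l. j < n \<Longrightarrow> l < 2 * n \<Longrightarrow> \<bar>fdiff l (P j) k\<bar> \<le> \<eta>"
    "\<And>j l. j < n \<Longrightarrow> l < 2 * n \<Longrightarrow> \<bar>fdiff l (Q j) 0\<bar> \<le> \<eta>"
    "\<And>j l. j < n \<Longrightarrow> l < 2 * n \<Longrightarrow> \<bar>fdiff l (Q j) k - of_bool (l = j)\<bar> \<le> \<eta>"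
proof -
  \<comment> \<open>The basis polynomials \<open>t gchoose j\<close> are used for \<open>u\<close>
    and \<open>v\<close> because their differences at 0 are the unit vectors.\<close>
  define P where "P k j t = (real t gchoose j) * (1 + (- 1 / real k) * real t) ^ n" for k j t :: nat
  define Q where "Q k j t = ((- real k + real t) gchoose j) * (0 + (1 / real k) * real t) ^ n" for k j t :: nat
  \<comment> \<open>The degree is \<open>j + n\<close>, hence below \<open>2 * n\<close>: this is
    why a window is twice as long as the range of the targets.\<close>
  have vanish: "fdiff (2 * n) (\<lambda>t. ((c + real t) gchoose j) * (a + b * real t) ^ n) t = 0"
    if "j < n" for a b c j t
  proof (rule fdiff_zero_mono[where d = "Suc j + n"])
    show "fdiff (Suc j + n) (\<lambda>t. ((c + real t) gchoose j) * (a + b * real t) ^ n) t = 0" for t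
      by (rule fdiff_linear_power_mult) (simp add: fdiff_gbinomial)
  qed (use that in auto)
  have P0: "fdiff (2 * n) (P k j) t = 0" if "j < n" for k j t
    using vanish[OF that, of 0 1 "- 1 / real k" t] by (simp add: P_def[abs_def])
  have Q0: "fdiff (2 * n) (Q k j) t = 0" if "j < n" for k j t
    using vanish[OF that, of "- real k" 0 "1 / real k" t] by (simp add: Q_def[abs_def])
  have delta: "fdiff l (\<lambda>t. real t gchoose j) 0 = of_bool (l = j)" for l j
    using fdiff_gbinomial[of l 0 j 0] by (auto simp: gbinomial_0_left)
  have near: "(\<lambda>k. x * (1 + c * (1 / real k)) ^ n) \<longlonglongrightarrow> x" for c x :: real
  proof -
    have "(\<lambda>k. x * (1 + c * (1 / real k)) ^ n) \<longlonglongrightarrow> x * (1 + c * 0) ^ n"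
      by (intro tendsto_intros lim_1_over_n)
    then show ?thesis by simp
  qed
  have far: "(\<lambda>k. ((c + d * real k) gchoose j) * (e / real k) ^ n) \<longlonglongrightarrow> 0" if "j < n" for c d e j
    using tendsto_mult_right[OF gbinomial_over_power_tendsto[OF that, of c d], of "e ^ n"]
    by (simp add: power_divide)
  have "(\<lambda>k. P k j i) \<longlonglongrightarrow> real i gchoose j" for i j
    using near[of "real i gchoose j" "- real i"] by (simp add: P_def)
  then have 1: "(\<lambda>k. fdiff l (P k j) 0) \<longlonglongrightarrow> of_bool (l = j)" for l j
    using fdiff_tendsto[of "\<lambda>k. P k j" "\<lambda>i. real i gchoose j" l 0] by (simp add: delta)
  \<comment> \<open>At \<open>i + k\<close> the cut-off factor equals \<open>(- i / k) ^ n\<close>,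
    which beats the growth \<open>k ^ j\<close> of the binomial since \<open>j < n\<close>.\<close>
  have "(\<lambda>k. P k j (i + k)) \<longlonglongrightarrow> 0" if "j < n" for i j
  proof (rule Lim_transform_eventually[OF far[OF that, of "real i" 1 "- real i"]])
    show "\<forall>\<^sub>F k in sequentially. (real i + 1 * real k gchoose j) * (- real i / real k) ^ n = P k j (i + k)"
      using eventually_gt_at_top[of 0] by eventually_elim (simp add: P_def field_simps)
  qed
  then have 2: "(\<lambda>k. fdiff l (P k j) k) \<longlonglongrightarrow> 0" if "j < n" for l j
    using fdiff_tendsto[of "\<lambda>k t. P k j (t + k)" "\<lambda>i. 0" l 0] that fdiff_cmult[of l 0 "\<lambda>i. 0" 0]
    by (simp add: fdiff_shift)
  have "(\<lambda>k. Q k j i) \<longlonglongrightarrow> 0" if "j < n" for i j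
    using far[OF that, of "real i" "- 1" "real i"] by (simp add: Q_def)
  then have 3: "(\<lambda>k. fdiff l (Q k j) 0) \<longlonglongrightarrow> 0" if "j < n" for l j
    using fdiff_tendsto[of "\<lambda>k. Q k j" "\<lambda>i. 0" l 0] that fdiff_cmult[of l 0 "\<lambda>i. 0" 0]
    by simp
  have "(\<lambda>k. Q k j (i + k)) \<longlonglongrightarrow> real i gchoose j" for i j
  proof (rule Lim_transform_eventually[OF near[of "real i gchoose j" "real i"]])
    show "\<forall>\<^sub>F k in sequentially. (real i gchoose j) * (1 + real i * (1 / real k)) ^ n = Q k j (i + k)"
      using eventually_gt_at_top[of 0] by eventually_elim (simp add: Q_def field_simps)
  qed
  then have 4: "(\<lambda>k. fdiff l (Q k j) k) \<longlonglongrightarrow> of_bool (l = j)" for l j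
    using fdiff_tendsto[of "\<lambda>k t. Q k j (t + k)" "\<lambda>i. real i gchoose j" l 0]
    by (simp add: fdiff_shift delta)
  have close: "\<forall>\<^sub>F k in sequentially. \<bar>f k - L\<bar> \<le> \<eta>" if "f \<longlonglongrightarrow> L" for f :: "nat \<Rightarrow> real" and L
    using tendstoD[OF that assms] by eventually_elim (simp add: dist_norm)
  have "\<forall>\<^sub>F k in sequentially. \<forall>j\<in>{..<n}. \<forall>l\<in>{..<2 * n}.
      \<bar>fdiff l (P k j) 0 - of_bool (l = j)\<bar> \<le> \<eta> \<and> \<bar>fdiff l (P k j) k - 0\<bar> \<le> \<eta> \<and>
      \<bar>fdiff l (Q k j) 0 - 0\<bar> \<le> \<eta> \<and> \<bar>fdiff l (Q k j) k - of_bool (l = j)\<bar> \<le> \<eta>"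
    by (intro eventually_ball_finite ballI eventually_conj close 1 2 3 4) auto
  then obtain k where k: "\<forall>j\<in>{..<n}. \<forall>l\<in>{..<2 * n}.
      \<bar>fdiff l (P k j) 0 - of_bool (l = j)\<bar> \<le> \<eta> \<and> \<bar>fdiff l (P k j) k - 0\<bar> \<le> \<eta> \<and>
      \<bar>fdiff l (Q k j) 0 - 0\<bar> \<le> \<eta> \<and> \<bar>fdiff l (Q k j) k - of_bool (l = j)\<bar> \<le> \<eta>"
    using eventually_happens by fastforce
  show ?thesis
    by (rule that[of "P k" "Q k" k]) (use P0 Q0 k in auto)
qed


section \<open>Weighted shifts on bounded sequences\<close>

definition wshift :: "(int \<Rightarrow> real) \<Rightarrow> (int \<Rightarrow> 'k::real_normed_field) \<Rightarrow> int \<Rightarrow> 'k" where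
  "wshift w a m = a m + of_real (w (m + 1)) * a (m + 1)"

text \<open>With weights at most 1, \<open>wshift w\<close> has norm at most 2 for the sup
  norm.\<close>

lemma wshift_pow_diff_le:
  fixes a b :: "int \<Rightarrow> 'k::real_normed_field"
  assumes w: "\<And>m. 0 < w m" "\<And>m. w m \<le> 1" and ab: "\<And>m. norm (a m - b m) \<le> e"
  shows "norm ((wshift w ^^ k) a m - (wshift w ^^ k) b m) \<le> 2 ^ k * e"
proof (induction k arbitrary: m)
  case (Suc k)
  let ?d = "\<lambda>m. (wshift w ^^ k) a m - (wshift w ^^ k) b m"
  have "norm ((wshift w ^^ Suc k) a m - (wshift w ^^ Suc k) b m)
      = norm (?d m + of_real (w (m + 1)) * ?d (m + 1))"
    by (simp add: wshift_def algebra_simps)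
  also have "\<dots> \<le> norm (?d m) + w (m + 1) * norm (?d (m + 1))"
    using w(1)[of "m + 1"] by (intro norm_triangle_le) (simp add: norm_mult)
  also have "\<dots> \<le> 2 ^ k * e + 1 * (2 ^ k * e)"
    using w(1)[of "m + 1"] w(2)[of "m + 1"] Suc.IH
    by (intro add_mono mult_mono) auto
  finally show ?case by (simp add: mult_ac)
qed (simp add: ab)

text \<open>Topological transitivity in the sup norm, with a prescribed precision. The finite
  support of \<open>p\<close> allows the next step of a successive approximation to start from
  \<open>p\<close>.\<close>

definition steers :: "(int \<Rightarrow> real) \<Rightarrow> (int \<Rightarrow> 'k::real_normed_field) \<Rightarrow> (int \<Rightarrow> 'k) \<Rightarrow> real \<Rightarrow> bool" where
  "steers w u v \<epsilon> \<longleftrightarrow> (\<exists>k p. finite {m. p m \<noteq> 0} \<and> (\<forall>m. norm (p m - u m) \<le> \<epsilon>) \<and>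
      (\<forall>m. norm ((wshift w ^^ k) p m - v m) \<le> \<epsilon>))"

lemma steers_mono: "steers w u v \<epsilon> \<Longrightarrow> \<epsilon> \<le> \<epsilon>' \<Longrightarrow> steers w u v \<epsilon>'"
  unfolding steers_def by (meson order_trans)

lemma norm_weighted_combination_le:
  fixes u v :: "nat \<Rightarrow> 'k::real_normed_field"
  assumes "\<And>j. j < n \<Longrightarrow> \<bar>x j\<bar> \<le> \<eta>" "\<And>j. j < n \<Longrightarrow> \<bar>y j\<bar> \<le> \<eta>"
    "\<And>j. j < n \<Longrightarrow> 0 < W j" "\<And>j. j < n \<Longrightarrow> norm (u j) \<le> M" "\<And>j. j < n \<Longrightarrow> norm (v j) \<le> M"
    "0 \<le> \<eta>"
  shows "norm (\<Sum>j<n. of_real (x j * W j) * u j + of_real (y j * W j) * v j) \<le> 2 * \<eta> * M * (\<Sum>j<n. W j)"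
proof -
  have "norm (\<Sum>j<n. of_real (x j * W j) * u j + of_real (y j * W j) * v j)
      \<le> (\<Sum>j<n. 2 * \<eta> * M * W j)"
  proof (intro sum_norm_le)
    fix j assume "j \<in> {..<n}"
    then have j: "j < n" by simp
    have *: "norm (of_real (z j * W j) * a j) \<le> \<eta> * W j * M"
      if "\<bar>z j\<bar> \<le> \<eta>" "norm (a j) \<le> M" for z and a :: "nat \<Rightarrow> 'k"
      using that assms(3)[OF j] assms(6)
      by (simp add: norm_mult abs_mult) (intro mult_mono; simp)
    have "norm (of_real (x j * W j) * u j + of_real (y j * W j) * v j) \<le> \<eta> * W j * M + \<eta> * W j * M"
      by (intro norm_triangle_le add_mono * assms j)
    then show "norm (of_real (x j * W j) * u j + of_real (y j * W j) * v j) \<le> 2 * \<eta> * M * W j"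
      by (simp add: algebra_simps)
  qed
  then show ?thesis by (simp add: sum_distrib_left)
qed

text \<open>
  On the window \<open>A \<le> m < A + 2 * n\<close> the operator \<open>wshift w\<close> acts as the translation \<open>t \<mapsto> t + 1\<close>
  on polynomials in \<open>t\<close>, the coordinates of a polynomial being its differences, up to a scaling
  by products of weights. What leaks out of the window has to pass through the weight at \<open>A\<close>.
\<close>

lemma steers_window:
  fixes A :: int and n :: nat and w0 :: "int \<Rightarrow> real" and M \<epsilon> :: real
  assumes pos: "\<And>m. A < m \<Longrightarrow> m < A + 2 * int n \<Longrightarrow> 0 < w0 m" and "\<epsilon> > 0" "M > 0"
  obtains \<delta> where "\<delta> > 0"
    "\<And>w (u :: int \<Rightarrow> 'k::real_normed_field) v. (\<And>m. A < m \<Longrightarrow> m < A + 2 * int n \<Longrightarrow> w m = w0 m) \<Longrightarrow>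
       (\<And>m. 0 < w m) \<Longrightarrow> (\<And>m. w m \<le> 1) \<Longrightarrow> w A \<le> \<delta> \<Longrightarrow>
       (\<And>m. norm (u m) \<le> M) \<Longrightarrow> (\<And>m. norm (v m) \<le> M) \<Longrightarrow>
       (\<And>m. m < A \<or> A + int n \<le> m \<Longrightarrow> u m = 0 \<and> v m = 0) \<Longrightarrow> steers w u v \<epsilon>"
proof -
  \<comment> \<open>Dividing the \<open>l\<close>th difference by the product of the weights from
    \<open>A + 1\<close> to \<open>A + l\<close> turns the unweighted recursion of
    \<open>fdiff\<close> into that of \<open>wshift w\<close> on the window.\<close>
  define W where "W l = (\<Prod>i<l. w0 (A + 1 + int i))" for l
  have W_Suc: "W (Suc l) = W l * w0 (A + int l + 1)" for l
    by (simp add: W_def ac_simps)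
  have W_pos: "0 < W l" if "l < 2 * n" for l
    unfolding W_def by (rule prod_pos) (use that pos in auto)
  define C where "C = (\<Sum>j<n. W j)"
  define c where "c = (\<Sum>l<2 * n. 1 / W l)"
  have "C \<ge> 0" unfolding C_def by (intro sum_nonneg) (simp add: W_pos less_imp_le)
  have c: "1 / W l \<le> c" if "l < 2 * n" for l
    unfolding c_def using that W_pos by (intro member_le_sum) (auto simp: less_imp_le)
  have "c \<ge> 0" unfolding c_def by (intro sum_nonneg) (simp add: W_pos less_imp_le)
  \<comment> \<open>Undoing the scaling by \<open>W l\<close> costs at most the factor
    \<open>c\<close>, so the coordinate error \<open>2 * \<eta> * M * C\<close> may grow to
    \<open>2 * \<eta> * M * C * c\<close>; the 1 only keeps the denominator positive.\<close>
  define \<eta> where "\<eta> = \<epsilon> / (2 * M * C * c + 1)"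
  have "2 * M * C * c + 1 > 0"
    using \<open>C \<ge> 0\<close> \<open>c \<ge> 0\<close> \<open>M > 0\<close> by (simp add: add_nonneg_pos)
  then have \<eta>: "\<eta> > 0" "2 * \<eta> * M * C * c \<le> \<epsilon>"
    using \<open>\<epsilon> > 0\<close> by (auto simp: \<eta>_def field_simps)
  obtain k P Q where
    PQ: "\<And>j t. j < n \<Longrightarrow> fdiff (2 * n) (P j) t = 0" "\<And>j t. j < n \<Longrightarrow> fdiff (2 * n) (Q j) t = 0"
    and P: "\<And>j l. j < n \<Longrightarrow> l < 2 * n \<Longrightarrow> \<bar>fdiff l (P j) 0 - of_bool (l = j)\<bar> \<le> \<eta>"
      "\<And>j l. j < n \<Longrightarrow> l < 2 * n \<Longrightarrow> \<bar>fdiff l (P j) k\<bar> \<le> \<eta>"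
    and Q: "\<And>j l. j < n \<Longrightarrow> l < 2 * n \<Longrightarrow> \<bar>fdiff l (Q j) 0\<bar> \<le> \<eta>"
      "\<And>j l. j < n \<Longrightarrow> l < 2 * n \<Longrightarrow> \<bar>fdiff l (Q j) k - of_bool (l = j)\<bar> \<le> \<eta>"
    by (rule polynomial_steering[OF \<eta>(1), of n]) (rule that; assumption)
  \<comment> \<open>Only the values at times before \<open>k\<close> matter: the zeroth coordinate
    is the one that leaks through the weight at \<open>A\<close>.\<close>
  define \<beta> where "\<beta> = (\<Sum>t<k. \<Sum>j<n. \<bar>P j t\<bar> + \<bar>Q j t\<bar>)"
  have \<beta>: "\<bar>P j t\<bar> \<le> \<beta>" "\<bar>Q j t\<bar> \<le> \<beta>" if "j < n" "t < k" for j t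
  proof -
    have "\<bar>P j t\<bar> + \<bar>Q j t\<bar> \<le> (\<Sum>j<n. \<bar>P j t\<bar> + \<bar>Q j t\<bar>)"
      using that by (intro member_le_sum[of j "{..<n}" "\<lambda>j. \<bar>P j t\<bar> + \<bar>Q j t\<bar>"]) auto
    also have "\<dots> \<le> \<beta>"
      unfolding \<beta>_def using that
      by (intro member_le_sum[of t "{..<k}" "\<lambda>t. \<Sum>j<n. \<bar>P j t\<bar> + \<bar>Q j t\<bar>"]) (auto intro!: sum_nonneg)
    finally show "\<bar>P j t\<bar> \<le> \<beta>" "\<bar>Q j t\<bar> \<le> \<beta>" by auto
  qed
  have "\<beta> \<ge> 0" unfolding \<beta>_def by (intro sum_nonneg) auto
  define B where "B = 2 * \<beta> * M * C"
  have "B \<ge> 0" unfolding B_def using \<open>\<beta> \<ge> 0\<close> \<open>C \<ge> 0\<close> \<open>M > 0\<close> by simp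
  \<comment> \<open>The time \<open>k\<close> and the leak bound \<open>B\<close> are fixed by the
    interior weights before \<open>w A\<close> is restricted. At each step at most
    \<open>w A * B\<close> leaks out, and \<open>k\<close> steps amplify the total by less than
    \<open>2 ^ k\<close>.\<close>
  define \<delta> where "\<delta> = \<epsilon> / (2 ^ k * (B + 1))"
  have "\<delta> > 0" using \<open>B \<ge> 0\<close> \<open>\<epsilon> > 0\<close> by (simp add: \<delta>_def)
  have "2 ^ k * (\<delta> * B) = \<epsilon> * (B / (B + 1))"
    by (simp add: \<delta>_def)
  also have "\<dots> \<le> \<epsilon> * 1"
    using \<open>B \<ge> 0\<close> \<open>\<epsilon> > 0\<close> by (intro mult_left_mono) auto
  finally have \<delta>: "2 ^ k * (\<delta> * B) \<le> \<epsilon>" by simp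
  have "steers w u v \<epsilon>"
    if ww0: "\<And>m. A < m \<Longrightarrow> m < A + 2 * int n \<Longrightarrow> w m = w0 m" and w: "\<And>m. 0 < w m" "\<And>m. w m \<le> 1"
      and "w A \<le> \<delta>" and M: "\<And>m. norm (u m) \<le> M" "\<And>m. norm (v m) \<le> M"
      and supp: "\<And>m. m < A \<or> A + int n \<le> m \<Longrightarrow> u m = 0 \<and> v m = 0"
    for w and u v :: "int \<Rightarrow> 'k"
  proof -
    \<comment> \<open>The rescaled coordinates at time \<open>t\<close> of one polynomial. Its
      coefficients carry the factor \<open>W j\<close> so that division by \<open>W l\<close> leaves
      \<open>u\<close> near time 0 and \<open>v\<close> near time \<open>k\<close>.\<close>
    define \<Psi> where "\<Psi> l t = (\<Sum>j<n. of_real (fdiff l (P j) t * W j) * u (A + int j) +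
        of_real (fdiff l (Q j) t * W j) * v (A + int j)) / of_real (W l)" for l t
    define \<Phi> where "\<Phi> t m = (if A \<le> m \<and> m < A + 2 * int n then \<Psi> (nat (m - A)) t else 0)" for t m
    have \<Phi>A: "\<Phi> t (A + int l) = (if l < 2 * n then \<Psi> l t else 0)" for t l
      by (auto simp: \<Phi>_def)
    have \<Phi>A1: "\<Phi> t (A + int l + 1) = (if Suc l < 2 * n then \<Psi> (Suc l) t else 0)" for t l
      using \<Phi>A[of t "Suc l"] by (simp add: add.commute add.left_commute)
    have ge_cases: "\<exists>l. m = A + int l" if "A \<le> m" for m
      using that zle_iff_zadd by blast
    have step: "wshift w (\<Phi> t) m = \<Phi> (Suc t) m" if "A \<le> m" for t m
    proof -
      obtain l where m: "m = A + int l" using ge_cases[OF \<open>A \<le> m\<close>] by blast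
      consider "Suc l < 2 * n" | "Suc l = 2 * n" | "l \<ge> 2 * n" by linarith
      then show ?thesis
      proof cases
        case 1
        have wm: "w (m + 1) = w0 (A + int l + 1)"
          using 1 m ww0[of "m + 1"] by simp
        have "wshift w (\<Phi> t) m = \<Psi> l t + of_real (w0 (A + int l + 1)) * \<Psi> (Suc l) t"
          using 1 wm by (simp add: wshift_def m \<Phi>A \<Phi>A1)
        also have "of_real (w0 (A + int l + 1)) * \<Psi> (Suc l) t =
            (\<Sum>j<n. of_real (fdiff (Suc l) (P j) t * W j) * u (A + int j) +
              of_real (fdiff (Suc l) (Q j) t * W j) * v (A + int j)) / of_real (W l)"
          using W_pos[of l] pos[of "A + int l + 1"] 1
          unfolding \<Psi>_def by (simp add: W_Suc del: fdiff.simps)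
        also have "\<Psi> l t + \<dots> = \<Psi> l (Suc t)"
          unfolding \<Psi>_def
          by (simp add: add_divide_distrib[symmetric] sum.distrib[symmetric] algebra_simps)
        finally show ?thesis using 1 by (simp add: m \<Phi>A)
      next
        \<comment> \<open>At the right end the next coordinate is cut off. This agrees with the
          translation because the differences of order \<open>2 * n\<close> vanish.\<close>
        case 2
        have 0: "fdiff l (P j) (Suc t) = fdiff l (P j) t \<and> fdiff l (Q j) (Suc t) = fdiff l (Q j) t" if "j < n" for j
          using PQ[OF that, of t] by (simp flip: 2)
        have "\<Psi> l (Suc t) = \<Psi> l t"
          unfolding \<Psi>_def using 0 by (intro arg_cong2[where f = "(/)"] sum.cong) auto
        then show ?thesis
          using 2 by (simp add: wshift_def m \<Phi>A \<Phi>A1)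
      next
        case 3
        then show ?thesis
          by (simp add: wshift_def m \<Phi>A \<Phi>A1)
      qed
    qed
    have bound: "norm (\<Phi> t A) \<le> B" if "t < k" for t
    proof (cases "n = 0")
      case False
      have "norm (\<Psi> 0 t) \<le> 2 * \<beta> * M * (\<Sum>j<n. W j)"
        unfolding \<Psi>_def using \<beta> that \<open>\<beta> \<ge> 0\<close> W_pos M
        by (simp add: W_def[of 0] del: of_real_mult) (intro norm_weighted_combination_le; simp)
      then show ?thesis
        using \<Phi>A[of t 0] False by (simp add: B_def C_def)
    qed (use \<Phi>A[of t 0] \<open>B \<ge> 0\<close> in simp)
    \<comment> \<open>On the window and to its right the orbit is exactly \<open>\<Phi>\<close>. To
      the left, a bound \<open>b\<close> becomes at most \<open>2 * b + w A * B\<close> in one step,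
      which gives the factor \<open>2 ^ t - 1\<close>.\<close>
    have iter: "(\<forall>m\<ge>A. (wshift w ^^ t) (\<Phi> 0) m = \<Phi> t m) \<and>
        (\<forall>m<A. norm ((wshift w ^^ t) (\<Phi> 0) m) \<le> (2 ^ t - 1) * (w A * B))" if "t \<le> k" for t
      using that
    proof (induction t)
      case 0
      then show ?case by (simp add: \<Phi>_def)
    next
      case (Suc t)
      let ?a = "(wshift w ^^ t) (\<Phi> 0)"
      have IH: "?a m = \<Phi> t m" if "m \<ge> A" for m
        using that Suc by simp
      have IH': "norm (?a m) \<le> (2 ^ t - 1) * (w A * B)" if "m < A" for m
        using that Suc by simp
      have "wshift w ?a m = \<Phi> (Suc t) m" if "m \<ge> A" for m
        using step[OF that, of t] IH that by (simp add: wshift_def)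
      moreover have "norm (wshift w ?a m) \<le> (2 ^ Suc t - 1) * (w A * B)" if "m < A" for m
      proof -
        have wB: "0 \<le> w A * B"
          using w(1)[of A] \<open>B \<ge> 0\<close> by simp
        have "w (m + 1) * norm (?a (m + 1)) \<le> (2 ^ t - 1) * (w A * B) + w A * B"
        proof (cases "m + 1 = A")
          case True
          then have "w (m + 1) * norm (?a (m + 1)) \<le> w A * B"
            using IH[of A] bound[of t] Suc.prems w(1)[of A] by (auto intro!: mult_left_mono)
          moreover have "0 \<le> (2 ^ t - 1) * (w A * B)"
            by (intro mult_nonneg_nonneg[OF _ wB]) simp
          ultimately show ?thesis by linarith
        next
          case False
          then have "norm (?a (m + 1)) \<le> (2 ^ t - 1) * (w A * B)"
            using that by (intro IH') simp
          moreover have "w (m + 1) * norm (?a (m + 1)) \<le> 1 * norm (?a (m + 1))"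
            using w by (intro mult_right_mono) auto
          ultimately show ?thesis using wB by linarith
        qed
        moreover have "norm (wshift w ?a m) \<le> norm (?a m) + w (m + 1) * norm (?a (m + 1))"
          unfolding wshift_def using w(1)[of "m + 1"] by (intro norm_triangle_le) (simp add: norm_mult)
        ultimately show ?thesis
          using IH'[OF that] by (simp add: algebra_simps)
      qed
      ultimately show ?case by simp
    qed
    have near: "norm (\<Phi> t m - x m) \<le> \<epsilon>"
      if t: "\<And>l. l < 2 * n \<Longrightarrow> norm (\<Psi> l t * of_real (W l) - of_real (W l) * x (A + int l)) \<le> 2 * \<eta> * M * C"
        and x: "\<And>m. m < A \<or> A + int n \<le> m \<Longrightarrow> x m = 0" for t m and x :: "int \<Rightarrow> 'k"
    proof (cases "A \<le> m \<and> m < A + 2 * int n")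
      case True
      then obtain l where l: "m = A + int l" "l < 2 * n"
        using ge_cases[of m] by auto
      have "norm (\<Psi> l t - x m) * W l = norm (\<Psi> l t * of_real (W l) - of_real (W l) * x (A + int l))"
      proof -
        have "\<Psi> l t * of_real (W l) - of_real (W l) * x (A + int l) = (\<Psi> l t - x m) * of_real (W l)"
          by (simp add: l algebra_simps)
        then show ?thesis
          using W_pos[OF l(2)] by (simp add: norm_mult)
      qed
      then have "norm (\<Psi> l t - x m) \<le> 2 * \<eta> * M * C * (1 / W l)"
        using t[OF l(2)] W_pos[OF l(2)] by (simp add: field_simps)
      also have "\<dots> \<le> 2 * \<eta> * M * C * c"
        using c[OF l(2)] \<eta> \<open>M > 0\<close> \<open>C \<ge> 0\<close> by (intro mult_left_mono) auto
      finally show ?thesis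
        using \<eta>(2) l by (simp add: \<Phi>A)
    next
      case False
      then have "x m = 0" by (intro x) auto
      moreover have "\<Phi> t m = 0"
        unfolding \<Phi>_def using False by (rule if_not_P)
      ultimately show ?thesis using \<open>\<epsilon> > 0\<close> by simp
    qed
    have \<Psi>W: "\<Psi> l t * of_real (W l) = (\<Sum>j<n. of_real (fdiff l (P j) t * W j) * u (A + int j) +
        of_real (fdiff l (Q j) t * W j) * v (A + int j))" if "l < 2 * n" for l t
      using W_pos[OF that] by (simp add: \<Psi>_def)
    \<comment> \<open>The target is written as a sum of the same form, so that its difference from
      \<open>\<Psi>\<close> has coefficients bounded by \<open>\<eta>\<close>.\<close>
    have diag: "of_real (W l) * x (A + int l) = (\<Sum>j<n. of_real (of_bool (l = j) * W j) * x (A + int j))"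
      if "l < 2 * n" "\<And>m. m < A \<or> A + int n \<le> m \<Longrightarrow> x m = 0" for l and x :: "int \<Rightarrow> 'k"
    proof -
      have "(\<Sum>j<n. of_real (of_bool (l = j) * W j) * x (A + int j))
          = (\<Sum>j<n. if l = j then of_real (W j) * x (A + int j) else 0)"
        by (intro sum.cong) auto
      also have "\<dots> = (if l < n then of_real (W l) * x (A + int l) else 0)"
        by (simp add: sum.delta)
      finally show ?thesis using that(2)[of "A + int l"] by auto
    qed
    have "norm (\<Phi> 0 m - u m) \<le> \<epsilon>" for m
    proof (rule near)
      fix l assume l: "l < 2 * n"
      have "\<Psi> l 0 * of_real (W l) - of_real (W l) * u (A + int l) =
          (\<Sum>j<n. of_real ((fdiff l (P j) 0 - of_bool (l = j)) * W j) * u (A + int j) +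
            of_real (fdiff l (Q j) 0 * W j) * v (A + int j))"
        unfolding \<Psi>W[OF l] by (subst diag[OF l])
          (use supp in \<open>auto simp: sum_subtractf[symmetric] algebra_simps intro!: sum.cong\<close>)
      also have "norm \<dots> \<le> 2 * \<eta> * M * C"
        unfolding C_def
        by (rule norm_weighted_combination_le) (use P Q l M W_pos \<eta> in auto)
      finally show "norm (\<Psi> l 0 * of_real (W l) - of_real (W l) * u (A + int l)) \<le> 2 * \<eta> * M * C" .
    qed (use supp in auto)
    moreover have "norm (\<Phi> k m - v m) \<le> \<epsilon>" for m
    proof (rule near)
      fix l assume l: "l < 2 * n"
      have "\<Psi> l k * of_real (W l) - of_real (W l) * v (A + int l) =
          (\<Sum>j<n. of_real (fdiff l (P j) k * W j) * u (A + int j) +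
            of_real ((fdiff l (Q j) k - of_bool (l = j)) * W j) * v (A + int j))"
        unfolding \<Psi>W[OF l] by (subst diag[OF l])
          (use supp in \<open>auto simp: sum_subtractf[symmetric] algebra_simps intro!: sum.cong\<close>)
      also have "norm \<dots> \<le> 2 * \<eta> * M * C"
        unfolding C_def
        by (rule norm_weighted_combination_le) (use P Q l M W_pos \<eta> in auto)
      finally show "norm (\<Psi> l k * of_real (W l) - of_real (W l) * v (A + int l)) \<le> 2 * \<eta> * M * C" .
    qed (use supp in auto)
    \<comment> \<open>Left of the window \<open>v\<close> vanishes, so only the leaked mass has to
      be small.\<close>
    moreover have "norm ((wshift w ^^ k) (\<Phi> 0) m - v m) \<le> \<epsilon>" for m
    proof (cases "m < A")
      case True
      have wB: "0 \<le> w A * B" "w A * B \<le> \<delta> * B"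
        using w(1)[of A] \<open>B \<ge> 0\<close> \<open>w A \<le> \<delta>\<close> by (auto intro: mult_right_mono)
      have "norm ((wshift w ^^ k) (\<Phi> 0) m) \<le> (2 ^ k - 1) * (w A * B)"
        using iter[of k] True by simp
      also have "\<dots> \<le> 2 ^ k * (\<delta> * B)"
        using wB(1) by (intro mult_mono[OF _ wB(2)]) auto
      finally show ?thesis
        using supp[of m] True \<delta> by simp
    next
      case False
      then show ?thesis
        using iter[of k] calculation(2)[of m] by simp
    qed
    moreover have "finite {m. \<Phi> 0 m \<noteq> 0}"
      by (rule finite_subset[of _ "{A..A + 2 * int n}"]) (auto simp: \<Phi>_def split: if_splits)
    ultimately show "steers w u v \<epsilon>"
      unfolding steers_def by blast
  qed
  then show ?thesis using that \<open>\<delta> > 0\<close> by blast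
qed


text \<open>
  The weights at the positions \<open>s i\<close>, alternating between the two sides of the origin, are
  chosen one after the other, each small enough for \<open>steers_window\<close>; the window of the \<open>i\<close>th
  step, and its reflection for odd \<open>i\<close>, contains no \<open>s j\<close> with \<open>j > i\<close>.
\<close>

lemma bilateral_weights_exist:
  fixes \<beta> \<gamma> :: "int \<Rightarrow> real"
  assumes \<beta>: "\<And>m. 0 < \<beta> m" "\<And>m. \<beta> m \<le> 1" and \<gamma>: "\<And>m. 0 < \<gamma> m" "\<And>m. \<gamma> m * \<beta> (1 - m) \<le> 1"
  obtains w where "\<And>m. 0 < w m" "\<And>m. w m \<le> \<beta> m" "\<And>m. \<gamma> m * w (1 - m) \<le> 1"
    "\<And>u v \<epsilon>. finite {m. u m \<noteq> (0::'k::real_normed_field)} \<Longrightarrow> finite {m. v m \<noteq> 0} \<Longrightarrow> 0 < \<epsilon> \<Longrightarrow>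
      steers w u v \<epsilon> \<and> steers (\<lambda>m. \<gamma> m * w (1 - m)) u v \<epsilon>"
proof -
  \<comment> \<open>Negative for even \<open>i\<close>, where the left end of a window of
    \<open>w\<close> lies; positive for odd \<open>i\<close>, where the reflected window of the dual
    ends.\<close>
  define s :: "nat \<Rightarrow> int" where "s i = - ((- 10) ^ i)" for i
  have abs_s: "\<bar>s i\<bar> = 10 ^ i" for i
    by (simp add: s_def power_abs)
  have inj: "inj s"
  proof (rule injI)
    fix i j assume "s i = s j"
    then have "(10::int) ^ i = 10 ^ j" by (metis abs_s)
    then show "i = j" by simp
  qed
  define wt where "wt e m = \<beta> m * (if m \<in> range s then e (inv s m) else 1)" for e :: "nat \<Rightarrow> real" and m
  define rf where "rf w m = \<gamma> m * w (1 - m)" for w :: "int \<Rightarrow> real" and m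
  define W where "W i w = (if even i then w else rf w)" for i :: nat and w
  \<comment> \<open>The left end is placed so that its weight is the one at \<open>s i\<close>,
    after the reflection \<open>m \<mapsto> 1 - m\<close> when \<open>i\<close> is odd. The first
    half of the window contains all \<open>m\<close> with
    \<open>\<bar>m\<bar> < 10 ^ i\<close>.\<close>
  define A where "A i = (if even i then - (10 ^ i) else 1 - 10 ^ i :: int)" for i :: nat
  define n where "n i = (2 * 10 ^ i :: nat)" for i :: nat
  have wt_s: "wt e (s i) = \<beta> (s i) * e i" for e i
    using inj by (simp add: wt_def)
  have WA: "W i (wt e) (A i) \<le> e i" if "0 < e i" for e i
  proof (cases "even i")
    case True
    then have "A i = s i" by (simp add: A_def s_def)
    then show ?thesis
      using True wt_s[of e i] mult_right_mono[OF \<beta>(2), of "e i" "s i"] that by (simp add: W_def)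
  next
    case False
    then have "1 - A i = s i" by (simp add: A_def s_def)
    then have "W i (wt e) (A i) = \<gamma> (A i) * \<beta> (1 - A i) * e i"
      using False wt_s[of e i] by (simp add: W_def rf_def)
    then show ?thesis
      using mult_right_mono[OF \<gamma>(2), of "e i" "A i"] that by simp
  qed
  \<comment> \<open>The window, reflected for odd \<open>i\<close>, stays within distance
    \<open>3 * 10 ^ i\<close> of 0, whereas every later position has distance at least
    \<open>10 * 10 ^ i\<close>. The position \<open>s i\<close> itself is the excluded end.\<close>
  have index: "j < i" if "A i < m" "m < A i + 2 * int (n i)" "(if even i then m else 1 - m) = s j" for i j m
  proof (rule ccontr)
    assume "\<not> j < i"
    then have le: "i \<le> j" by simp
    have "j \<noteq> i"
    proof
      assume "j = i"
      then show False
        using that by (cases "even i") (auto simp: A_def s_def)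
    qed
    with le have "(10::int) ^ Suc i \<le> 10 ^ j"
      by (intro power_increasing) auto
    moreover have "(1::int) \<le> 10 ^ i" by simp
    ultimately have "\<bar>s j\<bar> \<ge> 10 * 10 ^ i" "(1::int) \<le> 10 ^ i"
      by (simp_all add: abs_s)
    then show False
      using that unfolding A_def n_def by (cases "even i") auto
  qed
  have wt_cong: "W i (wt e) m = W i (wt e') m"
    if "\<And>j. j < i \<Longrightarrow> e j = e' j" "A i < m" "m < A i + 2 * int (n i)" for e e' i m
    using index[OF that(2,3)] that(1) inj
    by (cases "even i") (auto simp: W_def rf_def wt_def)
  have wt_pos: "0 < W i (wt e) m"
    if "\<And>j. j < i \<Longrightarrow> 0 < e j" "A i < m" "m < A i + 2 * int (n i)" for e i m
    using index[OF that(2,3)] that(1) inj \<beta>(1) \<gamma>(1)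
    by (cases "even i") (auto simp: W_def rf_def wt_def)
  \<comment> \<open>The condition is imposed for all weights that agree with the current ones inside
    the window, so choices made later cannot spoil it. It involves only the earlier values of
    \<open>e\<close>, as the recursive choice requires.\<close>
  define P where "P e i r \<longleftrightarrow> 0 < r \<and> r \<le> 1 \<and>
      (\<forall>w. (\<forall>m. A i < m \<longrightarrow> m < A i + 2 * int (n i) \<longrightarrow> w m = W i (wt e) m) \<longrightarrow>
        (\<forall>m. 0 < w m) \<longrightarrow> (\<forall>m. w m \<le> 1) \<longrightarrow> w (A i) \<le> r \<longrightarrow>
        (\<forall>u v :: int \<Rightarrow> 'k. (\<forall>m. norm (u m) \<le> real (Suc i)) \<longrightarrow> (\<forall>m. norm (v m) \<le> real (Suc i)) \<longrightarrow>
          (\<forall>m. m < A i \<or> A i + int (n i) \<le> m \<longrightarrow> u m = 0 \<and> v m = 0) \<longrightarrow>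
          steers w u v (1 / real (Suc i))))" for e i r
  have "\<exists>e. \<forall>i. P e i (e i)"
  proof (rule dependent_wellorder_choice)
    show "P e i r = P e' i r" if "\<And>j. j < i \<Longrightarrow> e j = e' j" for e e' i r
      unfolding P_def using wt_cong[OF that] by simp
  next
    fix i e assume IH: "\<And>j. j < i \<Longrightarrow> P e j (e j)"
    have pos: "0 < W i (wt e) m" if "A i < m" "m < A i + 2 * int (n i)" for m
      using IH that by (intro wt_pos) (auto simp: P_def)
    obtain \<delta> where \<delta>: "\<delta> > 0" "\<And>w (u :: int \<Rightarrow> 'k) v.
        (\<And>m. A i < m \<Longrightarrow> m < A i + 2 * int (n i) \<Longrightarrow> w m = W i (wt e) m) \<Longrightarrow>
       (\<And>m. 0 < w m) \<Longrightarrow> (\<And>m. w m \<le> 1) \<Longrightarrow> w (A i) \<le> \<delta> \<Longrightarrow>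
       (\<And>m. norm (u m) \<le> real (Suc i)) \<Longrightarrow> (\<And>m. norm (v m) \<le> real (Suc i)) \<Longrightarrow>
       (\<And>m. m < A i \<or> A i + int (n i) \<le> m \<Longrightarrow> u m = 0 \<and> v m = 0) \<Longrightarrow> steers w u v (1 / real (Suc i))"
      by (rule steers_window[where A = "A i" and n = "n i" and ?w0.0 = "W i (wt e)"
            and M = "real (Suc i)" and \<epsilon> = "1 / real (Suc i)" and ?'k = 'k])
        (use pos in auto)
    have "P e i (min \<delta> 1)"
      unfolding P_def by (intro conjI allI impI \<delta>(2)) (use \<delta>(1) in auto)
    then show "\<exists>r. P e i r" ..
  qed
  then obtain e where e: "\<And>i. P e i (e i)" by blast
  have e01: "0 < e i" "e i \<le> 1" for i
    using e[of i] by (auto simp: P_def)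
  have w: "0 < wt e m" "wt e m \<le> \<beta> m" for m
    using \<beta>(1)[of m] e01 by (auto simp: wt_def mult_left_le)
  have rf: "0 < rf (wt e) m" "rf (wt e) m \<le> 1" for m
  proof -
    show "0 < rf (wt e) m" using \<gamma>(1) w(1) by (simp add: rf_def)
    have "rf (wt e) m \<le> \<gamma> m * \<beta> (1 - m)"
      unfolding rf_def using w \<gamma>(1)[of m] by (intro mult_left_mono) auto
    then show "rf (wt e) m \<le> 1" using \<gamma>(2) order_trans by blast
  qed
  have W01: "0 < W i (wt e) m" "W i (wt e) m \<le> 1" for i m
    using w rf order_trans[OF w(2) \<beta>(2), of m] by (auto simp: W_def)
  have steer: "steers (W i (wt e)) u v (1 / real (Suc i))"
    if "\<And>m. norm (u m) \<le> real (Suc i)" "\<And>m. norm (v m) \<le> real (Suc i)"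
       "\<And>m. m < A i \<or> A i + int (n i) \<le> m \<Longrightarrow> u m = 0 \<and> v m = 0" for i and u v :: "int \<Rightarrow> 'k"
    using e[of i] W01[of i] WA[of e i] e01[of i] that unfolding P_def by blast
  have "steers w u v \<epsilon>"
    if fin: "finite {m. u m \<noteq> 0}" "finite {m. v m \<noteq> 0}" "0 < \<epsilon>" and w: "w = wt e \<or> w = rf (wt e)"
    for u v :: "int \<Rightarrow> 'k" and \<epsilon> w
  proof -
    define S where "S = {m. u m \<noteq> 0} \<union> {m. v m \<noteq> 0}"
    \<comment> \<open>One number dominating the support, the sizes and the inverse precision: every
      large enough step then serves \<open>u\<close>, \<open>v\<close> and
      \<open>\<epsilon>\<close>.\<close>
    define b where "b = (\<Sum>m\<in>S. real_of_int \<bar>m\<bar> + norm (u m) + norm (v m)) + 1 / \<epsilon>"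
    have "finite S" using fin by (simp add: S_def)
    have nn: "0 \<le> (\<Sum>m\<in>S. real_of_int \<bar>m\<bar> + norm (u m) + norm (v m))"
      by (intro sum_nonneg) auto
    have "b \<ge> 0" "1 / \<epsilon> \<le> b" using nn \<open>0 < \<epsilon>\<close> by (simp_all add: b_def)
    have b: "real_of_int \<bar>m\<bar> \<le> b \<and> norm (u m) \<le> b \<and> norm (v m) \<le> b" if "m \<in> S" for m
    proof -
      have "real_of_int \<bar>m\<bar> + norm (u m) + norm (v m) \<le> b - 1 / \<epsilon>"
        unfolding b_def using \<open>finite S\<close> that
          member_le_sum[of m S "\<lambda>m. real_of_int \<bar>m\<bar> + norm (u m) + norm (v m)"] by auto
      moreover have "1 / \<epsilon> > 0" using \<open>0 < \<epsilon>\<close> by simp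
      ultimately show ?thesis by (smt (verit) norm_ge_zero abs_ge_zero of_int_0_le_iff)
    qed
    obtain N where N: "b < real N" using reals_Archimedean2 by blast
    \<comment> \<open>The parity selects the side, even steps for \<open>w\<close> and odd steps for
      its reflection.\<close>
    define i where "i = (if w = wt e then 2 * N else 2 * N + 1)"
    have Wi: "W i (wt e) = w"
      using w by (auto simp: W_def i_def)
    have iN: "N \<le> i" by (simp add: i_def)
    have ub: "norm (u m) \<le> real (Suc i) \<and> norm (v m) \<le> real (Suc i)" for m
    proof (cases "m \<in> S")
      case True
      then show ?thesis using b[OF True] N iN by linarith
    qed (auto simp: S_def)
    have "u m = 0 \<and> v m = 0" if m: "m < A i \<or> A i + int (n i) \<le> m" for m
    proof (rule ccontr)
      assume "\<not> (u m = 0 \<and> v m = 0)"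
      then have "m \<in> S" by (auto simp: S_def)
      then have "real_of_int \<bar>m\<bar> < real N" using b N by fastforce
      then have "\<bar>m\<bar> < int N" by linarith
      moreover have "int i < 10 ^ i"
      proof -
        have "i < 10 ^ i" by (rule less_exp[THEN less_le_trans]) (simp add: power_mono)
        then show ?thesis by (metis of_nat_less_iff of_nat_numeral of_nat_power)
      qed
      ultimately have "\<bar>m\<bar> < 10 ^ i" using iN by linarith
      then show False
        using m by (auto simp: A_def n_def split: if_splits)
    qed
    then have "steers w u v (1 / real (Suc i))"
      using steer[of u i v] ub Wi by simp
    moreover have "1 / real (Suc i) \<le> \<epsilon>"
    proof -
      have "1 / \<epsilon> \<le> real (Suc i)" using \<open>1 / \<epsilon> \<le> b\<close> N iN by linarith
      then show ?thesis using \<open>0 < \<epsilon>\<close> by (simp add: field_simps)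
    qed
    ultimately show ?thesis by (rule steers_mono)
  qed
  then show ?thesis
    using that[of "wt e"] w rf by (simp add: rf_def[abs_def])
qed

section \<open>Bounded sequences with dense orbits\<close>

text \<open>Such a function is read off from an association list over the countable set of
  index-value pairs.\<close>

lemma countable_finite_support:
  fixes D :: "'k::zero set"
  assumes "countable D"
  shows "countable {u :: int \<Rightarrow> 'k. finite {m. u m \<noteq> 0} \<and> (\<forall>m. u m \<noteq> 0 \<longrightarrow> u m \<in> D)}"
proof -
  define f :: "(int \<times> 'k) list \<Rightarrow> int \<Rightarrow> 'k" where
    "f xs m = (case map_of xs m of None \<Rightarrow> 0 | Some c \<Rightarrow> c)" for xs m
  have "u \<in> f ` lists (UNIV \<times> D)"
    if u: "finite {m. u m \<noteq> 0}" "\<And>m. u m \<noteq> 0 \<Longrightarrow> u m \<in> D" for u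
  proof -
    obtain ms where ms: "set ms = {m. u m \<noteq> 0}" using u(1) finite_list by blast
    have "u = f (map (\<lambda>m. (m, u m)) ms)"
      using ms by (auto simp: f_def map_of_map_restrict restrict_map_def fun_eq_iff)
    moreover have "map (\<lambda>m. (m, u m)) ms \<in> lists (UNIV \<times> D)"
      using ms u(2) by auto
    ultimately show ?thesis by blast
  qed
  moreover have "countable (f ` lists (UNIV \<times> D))"
    using assms by (intro countable_image countable_lists countable_SIGMA) auto
  ultimately show ?thesis
    by (elim countable_subset[rotated]) auto
qed

text \<open>Arbitrarily late indices are provided because the construction in
  \<open>hypercyclic_sequence\<close> approaches the \<open>i\<close>th target only up to a multiple
  of \<open>(1/2) ^ i\<close>.\<close>

lemma dense_sequence_finite_support:
  obtains v :: "nat \<Rightarrow> int \<Rightarrow> 'k::{real_normed_field, second_countable_topology}" where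
    "\<And>i. finite {m. v i m \<noteq> 0}"
    "\<And>u \<delta> i0. finite {m. u m \<noteq> 0} \<Longrightarrow> 0 < \<delta> \<Longrightarrow> \<exists>i\<ge>i0. \<forall>m. norm (v i m - u m) \<le> \<delta>"
proof -
  obtain D :: "'k set" where D: "countable D" "\<And>X. open X \<Longrightarrow> X \<noteq> {} \<Longrightarrow> \<exists>d\<in>D. d \<in> X"
    using countable_dense_setE by blast
  define U where "U = {u :: int \<Rightarrow> 'k. finite {m. u m \<noteq> 0} \<and> (\<forall>m. u m \<noteq> 0 \<longrightarrow> u m \<in> D)}"
  have "countable U" unfolding U_def by (rule countable_finite_support[OF D(1)])
  moreover have "(\<lambda>_. 0) \<in> U" by (simp add: U_def)
  ultimately have range: "range (from_nat_into U) = U"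
    by (intro range_from_nat_into) auto
  \<comment> \<open>Taking the first component of a decoded pair lists every element of
    \<open>U\<close> infinitely often.\<close>
  define v where "v i = from_nat_into U (fst (prod_decode i))" for i
  have "v i \<in> U" for i
    using range unfolding v_def by blast
  moreover have "\<exists>i\<ge>i0. \<forall>m. norm (v i m - u m) \<le> \<delta>" if u: "finite {m. u m \<noteq> 0}" "0 < \<delta>" for u \<delta> i0
  proof -
    have "\<exists>d\<in>D. d \<in> ball c \<delta>" for c
      using u(2) by (intro D(2)) auto
    then obtain g where g: "\<And>c. g c \<in> D" "\<And>c. dist c (g c) < \<delta>"
      by (metis mem_ball)
    define u' where "u' m = (if u m = 0 then 0 else g (u m))" for m
    have "finite {m. u' m \<noteq> 0}"
      by (rule finite_subset[OF _ u(1)]) (auto simp: u'_def)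
    then have "u' \<in> U"
      using g(1) unfolding U_def by (auto simp: u'_def split: if_splits)
    then obtain a where a: "from_nat_into U a = u'" using range by (metis imageE)
    have "v (prod_encode (a, i0)) = u'" by (simp add: v_def a)
    moreover have "norm (u' m - u m) \<le> \<delta>" for m
      using g(2)[of "u m"] u(2) by (auto simp: u'_def dist_norm norm_minus_commute less_imp_le)
    ultimately show ?thesis
      using le_prod_encode_2[of i0 a] by metis
  qed
  ultimately show ?thesis
    using that[of v] by (simp add: U_def)
qed

text \<open>\<open>z\<close> is a limit of finitely supported sequences, each steered from its
  predecessor to the next target. Corrections are so small that powers of the shift up to the
  largest time used so far, which amplify by at most \<open>2 ^ k\<close>, do not destroy earlier
  approximations.\<close>

lemma hypercyclic_sequence:
  fixes w :: "int \<Rightarrow> real"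
  assumes w: "\<And>m. 0 < w m" "\<And>m. w m \<le> 1"
    and steer: "\<And>u v \<epsilon>. finite {m. u m \<noteq> (0::'k::{real_normed_field, banach, second_countable_topology})} \<Longrightarrow>
      finite {m. v m \<noteq> 0} \<Longrightarrow> 0 < \<epsilon> \<Longrightarrow> steers w u v \<epsilon>"
  obtains z :: "int \<Rightarrow> 'k::{real_normed_field, banach, second_countable_topology}" and C where "\<And>m. norm (z m) \<le> C"
    "\<And>u \<delta>. finite {m. u m \<noteq> 0} \<Longrightarrow> 0 < \<delta> \<Longrightarrow> \<exists>k. \<forall>m. norm ((wshift w ^^ k) z m - u m) \<le> \<delta>"
proof -
  obtain v :: "nat \<Rightarrow> int \<Rightarrow> 'k" where v: "\<And>i. finite {m. v i m \<noteq> 0}"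
    "\<And>u \<delta> i0. finite {m. u m \<noteq> 0} \<Longrightarrow> 0 < \<delta> \<Longrightarrow> \<exists>i\<ge>i0. \<forall>m. norm (v i m - u m) \<le> \<delta>"
    using dense_sequence_finite_support by blast
  \<comment> \<open>The second component of a state bounds all the times used so far; the next
    correction is discounted by that power of 2.\<close>
  define R where "R i s s' \<longleftrightarrow> (\<forall>m. norm (fst s' m - fst s m) \<le> (1/2) ^ (i + snd s)) \<and> snd s \<le> snd s' \<and>
    (\<exists>k\<le>snd s'. \<forall>m. norm ((wshift w ^^ k) (fst s') m - v i m) \<le> (1/2) ^ i)"
    for i and s s' :: "(int \<Rightarrow> 'k) \<times> nat"
  have "\<exists>f. \<forall>i. finite {m. fst (f i) m \<noteq> 0} \<and> R i (f i) (f (Suc i))"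
  proof (rule dependent_nat_choice)
    show "\<exists>s :: (int \<Rightarrow> 'k) \<times> nat. finite {m. fst s m \<noteq> 0}"
      by (rule exI[of _ "(\<lambda>_. 0, 0)"]) simp
  next
    fix s :: "(int \<Rightarrow> 'k) \<times> nat" and i
    assume s: "finite {m. fst s m \<noteq> 0}"
    obtain k p where kp: "finite {m. p m \<noteq> 0}" "\<And>m. norm (p m - fst s m) \<le> (1/2) ^ (i + snd s)"
      "\<And>m. norm ((wshift w ^^ k) p m - v i m) \<le> (1/2) ^ (i + snd s)"
      using steer[OF s v(1)[of i], of "(1/2) ^ (i + snd s)"] unfolding steers_def by auto
    have "(1/2::real) ^ (i + snd s) \<le> (1/2) ^ i"
      by (intro power_decreasing) auto
    then have "norm ((wshift w ^^ k) p m - v i m) \<le> (1/2) ^ i" for m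
      using kp(3)[of m] by linarith
    then have "R i s (p, max k (snd s))"
      unfolding R_def using kp(2) by (auto intro!: exI[of _ k])
    then show "\<exists>s'. finite {m. fst s' m \<noteq> 0} \<and> R i s s'"
      using kp(1) by (intro exI[of _ "(p, max k (snd s))"]) simp
  qed
  then obtain f where f: "\<And>i. R i (f i) (f (Suc i))" "\<And>i. finite {m. fst (f i) m \<noteq> 0}" by blast
  define z' where "z' i = fst (f i)" for i
  define K where "K i = snd (f i)" for i
  have z': "norm (z' (Suc i) m - z' i m) \<le> (1/2) ^ (i + K i)" and K: "K i \<le> K (Suc i)"
    and ex: "\<exists>k\<le>K (Suc i). \<forall>m. norm ((wshift w ^^ k) (z' (Suc i)) m - v i m) \<le> (1/2) ^ i" for i m
    using f(1)[of i] by (auto simp: R_def z'_def K_def)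
  have "mono K" using K by (simp add: mono_iff_le_Suc)
  \<comment> \<open>The corrections from step \<open>i\<close> on form a geometric series with sum
    \<open>2 * (1/2) ^ (i + K i)\<close>, since \<open>K\<close> is monotone.\<close>
  have diff: "norm (z' (i + l) m - z' i m) \<le> (2 - 2 * (1/2) ^ l) * (1/2) ^ (i + K i)" for i l m
  proof (induction l)
    case (Suc l)
    have "norm (z' (i + Suc l) m - z' i m) \<le> norm (z' (Suc (i + l)) m - z' (i + l) m) + norm (z' (i + l) m - z' i m)"
      using norm_triangle_ineq[of "z' (Suc (i + l)) m - z' (i + l) m" "z' (i + l) m - z' i m"] by simp
    also have "norm (z' (Suc (i + l)) m - z' (i + l) m) \<le> (1/2) ^ (i + l + K (i + l))"
      by (rule z')
    also have "\<dots> \<le> (1/2) ^ (l + (i + K i))"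
      using monoD[OF \<open>mono K\<close>, of i "i + l"] by (intro power_decreasing) auto
    also have "\<dots> = (1/2) ^ l * (1/2) ^ (i + K i)"
      by (simp add: power_add)
    finally show ?case using Suc by (simp add: algebra_simps)
  qed simp
  have diff2: "norm (z' (i + l) m - z' i m) \<le> 2 * (1/2) ^ (i + K i)" for i l m
  proof -
    have "(2 - 2 * (1/2) ^ l) * (1/2) ^ (i + K i) \<le> 2 * (1/2::real) ^ (i + K i)"
      by (intro mult_right_mono) auto
    then show ?thesis using diff[of i l m] by linarith
  qed
  have "Cauchy (\<lambda>i. z' i m)" for m
  proof (rule metric_CauchyI)
    fix e :: real assume "0 < e"
    obtain i where i: "(1/2::real) ^ i < e / 4"
      using real_arch_pow_inv[of "e / 4" "1/2"] \<open>0 < e\<close> by auto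
    have "norm (z' a m - z' i m) < e / 2" if "i \<le> a" for a
    proof -
      have "(1/2::real) ^ (i + K i) \<le> (1/2) ^ i" by (intro power_decreasing) auto
      then show ?thesis
        using diff2[of i "a - i" m] that i by (simp only: le_add_diff_inverse)
    qed
    then show "\<exists>i. \<forall>a\<ge>i. \<forall>b\<ge>i. dist (z' a m) (z' b m) < e"
      by (metis dist_norm dist_triangle_half_l norm_minus_commute)
  qed
  then have lim: "(\<lambda>i. z' i m) \<longlonglongrightarrow> lim (\<lambda>i. z' i m)" for m
    by (simp add: Cauchy_convergent_iff convergent_LIMSEQ_iff)
  define z where "z m = lim (\<lambda>i. z' i m)" for m
  have near: "norm (z m - z' i m) \<le> 2 * (1/2) ^ (i + K i)" for i m
  proof (rule tendsto_upperbound)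
    show "((\<lambda>l. norm (z' l m - z' i m)) \<longlongrightarrow> norm (z m - z' i m)) sequentially"
      unfolding z_def by (intro tendsto_intros lim)
    show "\<forall>\<^sub>F l in sequentially. norm (z' l m - z' i m) \<le> 2 * (1/2) ^ (i + K i)"
      using eventually_ge_at_top[of i]
      by eventually_elim (metis diff2 le_add_diff_inverse)
  qed simp
  have orbit: "\<exists>k. \<forall>m. norm ((wshift w ^^ k) z m - v i m) \<le> 2 * (1/2) ^ i" for i
  proof -
    obtain k where k: "k \<le> K (Suc i)" "\<And>m. norm ((wshift w ^^ k) (z' (Suc i)) m - v i m) \<le> (1/2) ^ i"
      using ex by blast
    have "norm ((wshift w ^^ k) z m - v i m) \<le> 2 * (1/2) ^ i" for m
    proof -
      have "norm ((wshift w ^^ k) z m - (wshift w ^^ k) (z' (Suc i)) m) \<le> 2 ^ k * (2 * (1/2) ^ (Suc i + K (Suc i)))"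
        by (rule wshift_pow_diff_le[OF w near])
      also have "\<dots> = 2 ^ k * (1/2) ^ K (Suc i) * (1/2) ^ i"
        by (simp add: power_add)
      also have "\<dots> \<le> 1 * (1/2) ^ i"
      proof (intro mult_right_mono)
        have "2 ^ k * (1/2::real) ^ K (Suc i) \<le> 2 ^ K (Suc i) * (1/2) ^ K (Suc i)"
          using k(1) by (intro mult_right_mono power_increasing) auto
        then show "2 ^ k * (1/2::real) ^ K (Suc i) \<le> 1"
          by (simp add: power_mult_distrib[symmetric])
      qed simp
      finally show ?thesis
        using k(2)[of m] norm_triangle_ineq[of "(wshift w ^^ k) z m - (wshift w ^^ k) (z' (Suc i)) m"
            "(wshift w ^^ k) (z' (Suc i)) m - v i m"] by simp
    qed
    then show ?thesis by blast
  qed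
  obtain C where C: "\<And>m. norm (z' 0 m) \<le> C"
  proof -
    have fin: "finite {m. z' 0 m \<noteq> 0}" using f(2) by (simp add: z'_def)
    have "norm (z' 0 m) \<le> (\<Sum>m\<in>{m. z' 0 m \<noteq> 0}. norm (z' 0 m))" for m
    proof (cases "z' 0 m = 0")
      case False
      then show ?thesis using fin by (intro member_le_sum) auto
    qed (simp add: sum_nonneg)
    then show ?thesis using that by blast
  qed
  show ?thesis
  proof
    show "norm (z m) \<le> C + 2" for m
    proof -
      have "norm (z m - z' 0 m) \<le> 2 * (1/2) ^ K 0" using near[of m 0] by simp
      also have "\<dots> \<le> 2" by (simp add: power_le_one)
      finally show ?thesis using C[of m] norm_triangle_sub[of "z m" "z' 0 m"] by linarith
    qed
    fix u :: "int \<Rightarrow> 'k" and \<delta> :: real assume u: "finite {m. u m \<noteq> 0}" "0 < \<delta>"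
    obtain i0 where i0: "(1/2::real) ^ i0 < \<delta> / 4"
      using real_arch_pow_inv[of "\<delta> / 4" "1/2"] \<open>0 < \<delta>\<close> by auto
    obtain i where i: "i \<ge> i0" "\<And>m. norm (v i m - u m) \<le> \<delta> / 2"
      using v(2)[OF u(1), of "\<delta> / 2" i0] \<open>0 < \<delta>\<close> by auto
    obtain k where k: "\<And>m. norm ((wshift w ^^ k) z m - v i m) \<le> 2 * (1/2) ^ i"
      using orbit by blast
    have "(1/2::real) ^ i \<le> (1/2) ^ i0" using i(1) by (intro power_decreasing) auto
    then have "norm ((wshift w ^^ k) z m - u m) \<le> \<delta>" for m
      using dist_triangle[of "(wshift w ^^ k) z m" "u m" "v i m"] k[of m] i(2)[of m] i0
      unfolding dist_norm by linarith
    then show "\<exists>k. \<forall>m. norm ((wshift w ^^ k) z m - u m) \<le> \<delta>" by blast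
  qed
qed


section \<open>Strong duals and biorthogonal systems\<close>

lemma module_dual_smul: "module (dual_smul :: 'k::comm_ring_1 \<Rightarrow> ('a \<Rightarrow> 'k) \<Rightarrow> 'a \<Rightarrow> 'k)"
  by unfold_locales (auto simp: dual_smul_def fun_eq_iff algebra_simps)

context topological_vector_space
begin

lemma dualI:
  assumes "\<And>x y. f (x + y) = f x + f y" "\<And>c x. f (smul c x) = c * f x" "continuous_on UNIV f"
  shows "f \<in> continuous_dual smul"
proof -
  have "Vector_Spaces.linear smul (*) f"
    using assms by unfold_locales (auto simp: algebra_simps)
  then show ?thesis using assms by (simp add: continuous_dual_def)
qed

lemma dualD:
  assumes "f \<in> continuous_dual smul"
  shows "f (x + y) = f x + f y" "f (smul c x) = c * f x" "f 0 = 0" "f (x - y) = f x - f y"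
    "f (- x) = - f x" "f (sum h A) = (\<Sum>i\<in>A. f (h i))" "continuous_on UNIV f"
proof -
  have "Vector_Spaces.linear smul (*) f" using assms by (simp add: continuous_dual_def)
  then interpret f: Vector_Spaces.linear smul "(*)" f .
  show "f (x + y) = f x + f y" "f (smul c x) = c * f x" "f 0 = 0" "f (x - y) = f x - f y"
    "f (- x) = - f x" "f (sum h A) = (\<Sum>i\<in>A. f (h i))"
    by (rule f.add f.scale f.zero f.diff f.neg f.sum)+
  show "continuous_on UNIV f" using assms by (simp add: continuous_dual_def)
qed

lemma dual_add: "f \<in> continuous_dual smul \<Longrightarrow> h \<in> continuous_dual smul \<Longrightarrow> (\<lambda>x. f x + h x) \<in> continuous_dual smul"
  by (rule dualI) (simp_all add: dualD(1,2) algebra_simps continuous_on_add dualD(7))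

lemma dual_cmult: "f \<in> continuous_dual smul \<Longrightarrow> (\<lambda>x. c * f x) \<in> continuous_dual smul"
  by (rule dualI) (simp_all add: dualD(1,2) algebra_simps continuous_on_mult continuous_on_const dualD(7))

lemma scale_near_zero:
  assumes "open U" "0 \<in> U"
  shows "\<forall>\<^sub>F c in nhds 0. smul c x \<in> U"
proof -
  have "open ((\<lambda>c. smul c x) -` U)"
    using assms by (intro open_vimage continuous_intros)
  then show ?thesis
    using assms unfolding eventually_nhds by (intro exI[of _ "(\<lambda>c. smul c x) -` U"]) auto
qed

lemma scale_near_zero_radius:
  assumes "open U" "0 \<in> U"
  obtains d where "d > 0" "\<And>c. norm c \<le> d \<Longrightarrow> smul c x \<in> U"
proof -
  obtain d where "d > 0" "\<And>c. dist c 0 < d \<Longrightarrow> smul c x \<in> U"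
    using scale_near_zero[OF assms, of x] unfolding eventually_nhds_metric by blast
  then show ?thesis using that[of "d / 2"] by (simp add: dist_norm)
qed

lemma absorbing:
  assumes "open U" "0 \<in> U"
  obtains r :: real where "r > 0" "smul (of_real (1 / r)) x \<in> U"
proof -
  obtain d where "d > 0" "\<And>c. norm c \<le> d \<Longrightarrow> smul c x \<in> U"
    using scale_near_zero_radius[OF assms] by blast
  then show ?thesis using that[of "1 / d"] by simp
qed

text \<open>Joint continuity of the scalar multiplication at 0 takes care of a tail of the sequence;
  the finitely many remaining terms are absorbed one by one.\<close>

lemma null_sequence_bounded:
  assumes "x \<longlonglongrightarrow> 0"
  shows "tvs_bounded smul (range x)"
  unfolding tvs_bounded_def
proof (intro allI impI)
  fix U :: "'a set" assume U: "open U \<and> 0 \<in> U"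
  have "open ((\<lambda>(c, y). smul c y) -` U)"
    using U by (intro open_vimage continuous_smul) auto
  moreover have "(0, 0) \<in> (\<lambda>(c, y). smul c y) -` U" using U by simp
  ultimately obtain A V where AV': "open A" "open V" "(0, 0) \<in> A \<times> V"
      "A \<times> V \<subseteq> (\<lambda>(c, y). smul c y) -` U"
    by (rule open_prod_elim)
  then have AV: "open A" "open V" "0 \<in> A" "0 \<in> V" "\<And>c y. c \<in> A \<Longrightarrow> y \<in> V \<Longrightarrow> smul c y \<in> U"
    by auto
  have "\<forall>\<^sub>F k in sequentially. x k \<in> V"
    using assms AV by (intro topological_tendstoD)
  then obtain K where K: "\<And>k. k \<ge> K \<Longrightarrow> x k \<in> V"
    unfolding eventually_sequentially by blast
  have "\<forall>\<^sub>F c in nhds 0. c \<in> A \<and> (\<forall>k\<in>{..<K}. smul c (x k) \<in> U)"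
    using U AV by (intro eventually_conj eventually_ball_finite ballI scale_near_zero eventually_nhds_in_open) auto
  then obtain d where d: "d > 0" "\<And>c. dist c 0 < d \<Longrightarrow> c \<in> A \<and> (\<forall>k\<in>{..<K}. smul c (x k) \<in> U)"
    unfolding eventually_nhds_metric by blast
  have small: "smul c (x k) \<in> U" if "norm c < d" for c k
    using d(2)[of c] that AV(5) K[of k] by (cases "k < K") (auto simp: dist_norm)
  show "\<exists>r>0. \<forall>c. norm c \<ge> r \<longrightarrow> range x \<subseteq> smul c ` U"
  proof (intro exI conjI allI impI)
    show "2 / d > 0" using d by simp
    fix c :: 'k assume c: "2 / d \<le> norm c"
    then have "c \<noteq> 0" using d(1) by (auto simp: field_simps)
    have "norm (1 / c) < d"
      using c d(1) \<open>c \<noteq> 0\<close> by (simp add: norm_divide field_simps)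
    then have "smul (1 / c) (x k) \<in> U" for k by (rule small)
    moreover have "x k = smul c (smul (1 / c) (x k))" for k
      using \<open>c \<noteq> 0\<close> by simp
    ultimately show "range x \<subseteq> smul c ` U" by blast
  qed
qed

text \<open>The basic set for \<open>B\<close> and \<open>e\<close> need not be open. Asking for a
  uniform bound \<open>r\<close> strictly below \<open>e\<close> leaves room for a smaller basic set
  around each member.\<close>

lemma strong_dual_neighbourhood:
  assumes "f \<in> continuous_dual smul" "tvs_bounded smul B" "e > 0"
  obtains W where "openin (strong_dual smul) W" "f \<in> W"
    "\<And>h x. h \<in> W \<Longrightarrow> x \<in> B \<Longrightarrow> norm (h x - f x) < e"
proof
  define W where "W = {h \<in> continuous_dual smul. \<exists>r<e. \<forall>x\<in>B. norm (h x - f x) \<le> r}"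
  have "strong_dual_open smul W"
    unfolding strong_dual_open_def
  proof (intro conjI ballI)
    fix h assume "h \<in> W"
    then obtain r where r: "r < e" "\<And>x. x \<in> B \<Longrightarrow> norm (h x - f x) \<le> r"
      by (auto simp: W_def)
    have "h' \<in> W" if h': "h' \<in> continuous_dual smul" "\<forall>x\<in>B. norm (h' x - h x) < (e - r) / 2" for h'
    proof -
      have "norm (h' x - f x) \<le> (e + r) / 2" if "x \<in> B" for x
        using norm_triangle_ineq[of "h' x - h x" "h x - f x"] r(2)[OF that] h'(2) that by force
      moreover have "(e + r) / 2 < e" using r by simp
      ultimately show ?thesis using h' unfolding W_def by blast
    qed
    then show "\<exists>B e. tvs_bounded smul B \<and> e > 0 \<and> {g \<in> continuous_dual smul. \<forall>x\<in>B. norm (g x - h x) < e} \<subseteq> W"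
      using assms r by (intro exI[of _ B] exI[of _ "(e - r) / 2"]) auto
  qed (auto simp: W_def)
  then show "openin (strong_dual smul) W" by (simp add: openin_strong_dual)
  show "f \<in> W" using assms by (auto simp: W_def intro!: exI[of _ 0])
  show "norm (h x - f x) < e" if "h \<in> W" "x \<in> B" for h x
    using that by (force simp: W_def)
qed

lemma strong_dual_dense_approx:
  assumes "dense_in (strong_dual smul) D" "f \<in> continuous_dual smul" "tvs_bounded smul B" "e > 0"
  obtains h where "h \<in> D" "\<And>x. x \<in> B \<Longrightarrow> norm (h x - f x) < e"
proof -
  obtain W where W: "openin (strong_dual smul) W" "f \<in> W"
    "\<And>h x. h \<in> W \<Longrightarrow> x \<in> B \<Longrightarrow> norm (h x - f x) < e"
    using strong_dual_neighbourhood[OF assms(2-4)] by blast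
  have "f \<in> strong_dual smul closure_of D"
    using assms(1,2) by (simp add: dense_in_def topspace_strong_dual)
  then obtain h where "h \<in> D" "h \<in> W"
    using W unfolding in_closure_of by blast
  then show ?thesis using that W by blast
qed

lemma bounded_singleton: "tvs_bounded smul {x}"
  unfolding tvs_bounded_def
proof (intro allI impI)
  fix U :: "'a set" assume "open U \<and> 0 \<in> U"
  then obtain d where d: "d > 0" "\<And>c. norm c \<le> d \<Longrightarrow> smul c x \<in> U"
    using scale_near_zero_radius by blast
  show "\<exists>r>0. \<forall>c. norm c \<ge> r \<longrightarrow> {x} \<subseteq> smul c ` U"
  proof (intro exI conjI allI impI)
    show "1 / d > 0" using d by simp
    fix c :: 'k assume c: "1 / d \<le> norm c"
    then have "c \<noteq> 0" using d(1) by (auto simp: field_simps)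
    then have "smul (1 / c) x \<in> U" "x = smul c (smul (1 / c) x)"
      using c d by (auto simp: norm_divide field_simps)
    then show "{x} \<subseteq> smul c ` U" by blast
  qed
qed

end

context frechet_space
begin

lemma sequence_limit_unique:
  fixes x :: "nat \<Rightarrow> 'a"
  assumes "x \<longlonglongrightarrow> a" "x \<longlonglongrightarrow> b"
  shows "a = b"
  using assms metrizable_imp_Hausdorff_space[OF metrizable]
    limitin_Hausdorff_unique[of "euclidean :: 'a topology" x a sequentially b]
  by simp

text \<open>This base does the work of a translation-invariant metric: passing to the next member
  plays the role of halving a radius.\<close>

lemma zero_neighbourhood_base:
  obtains V :: "nat \<Rightarrow> 'a set" where "\<And>n. open (V n)" "\<And>n. 0 \<in> V n"
    "\<And>n x y. x \<in> V (Suc n) \<Longrightarrow> y \<in> V (Suc n) \<Longrightarrow> x + y \<in> V n"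
    "\<And>U. open U \<Longrightarrow> 0 \<in> U \<Longrightarrow> \<exists>n. V n \<subseteq> U"
proof -
  have "first_countable (euclidean :: 'a topology)"
    using metrizable by (rule metrizable_imp_first_countable)
  then have "\<exists>\<B> :: 'a set set. countable \<B> \<and> (\<forall>B\<in>\<B>. open B) \<and>
      (\<forall>U. open U \<and> 0 \<in> U \<longrightarrow> (\<exists>B\<in>\<B>. 0 \<in> B \<and> B \<subseteq> U))"
    by (simp add: first_countable_def)
  then obtain \<B> :: "'a set set" where "countable \<B> \<and> (\<forall>B\<in>\<B>. open B) \<and>
      (\<forall>U. open U \<and> 0 \<in> U \<longrightarrow> (\<exists>B\<in>\<B>. 0 \<in> B \<and> B \<subseteq> U))" ..
  then have \<B>: "countable \<B>" "\<And>B. B \<in> \<B> \<Longrightarrow> open B"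
    "\<And>U. open U \<Longrightarrow> 0 \<in> U \<Longrightarrow> \<exists>B\<in>\<B>. 0 \<in> B \<and> B \<subseteq> U"
    by simp_all
  \<comment> \<open>\<open>UNIV\<close> makes the family nonempty, so that it can be
    enumerated.\<close>
  define N where "N = insert UNIV {B \<in> \<B>. 0 \<in> B}"
  have "countable N" using \<B>(1) by (simp add: N_def)
  then have rN: "range (from_nat_into N) = N"
    by (intro range_from_nat_into) (auto simp: N_def)
  have N: "open (from_nat_into N n) \<and> 0 \<in> from_nat_into N n" for n
  proof -
    have "from_nat_into N n \<in> N" using rN by blast
    then show ?thesis using \<B>(2) by (auto simp: N_def)
  qed
  have "\<exists>V. \<forall>n. (open (V n) \<and> 0 \<in> V n) \<and>
      (V (Suc n) \<subseteq> from_nat_into N n \<and> (\<forall>x\<in>V (Suc n). \<forall>y\<in>V (Suc n). x + y \<in> V n))"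
  proof (rule dependent_nat_choice)
    fix V :: "'a set" and n assume V: "open V \<and> 0 \<in> V"
    have "open ((\<lambda>(x, y). x + y) -` V)"
      unfolding case_prod_unfold using V by (intro open_vimage continuous_intros) auto
    moreover have "(0, 0) \<in> (\<lambda>(x, y). x + y) -` V" using V by simp
    ultimately obtain A B where "open A" "open B" "(0, 0) \<in> A \<times> B" "A \<times> B \<subseteq> (\<lambda>(x, y). x + y) -` V"
      by (rule open_prod_elim)
    then show "\<exists>V'. (open V' \<and> 0 \<in> V') \<and> (V' \<subseteq> from_nat_into N n \<and> (\<forall>x\<in>V'. \<forall>y\<in>V'. x + y \<in> V))"
      using N[of n] by (intro exI[of _ "A \<inter> B \<inter> from_nat_into N n"]) auto
  qed (auto intro!: exI[of _ UNIV])
  then obtain V where VV: "\<forall>n. (open (V n) \<and> 0 \<in> V n) \<and>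
      (V (Suc n) \<subseteq> from_nat_into N n \<and> (\<forall>x\<in>V (Suc n). \<forall>y\<in>V (Suc n). x + y \<in> V n))" ..
  then have V: "\<And>n. open (V n)" "\<And>n. 0 \<in> V n" "\<And>n. V (Suc n) \<subseteq> from_nat_into N n"
    "\<And>n x y. x \<in> V (Suc n) \<Longrightarrow> y \<in> V (Suc n) \<Longrightarrow> x + y \<in> V n"
    by simp_all
  have base: "\<exists>n. V n \<subseteq> U" if U: "open U" "0 \<in> U" for U
  proof -
    obtain B where "B \<in> \<B>" "0 \<in> B" "B \<subseteq> U" using \<B>(3)[OF U] by blast
    then have "B \<in> range (from_nat_into N)" unfolding rN by (simp add: N_def)
    then obtain n where "from_nat_into N n = B" by auto
    then show ?thesis using V(3)[of n] \<open>B \<subseteq> U\<close> by blast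
  qed
  show ?thesis by (rule that[OF V(1,2,4) base])
qed

text \<open>
  Otherwise some null sequence, which is a bounded set, would show that \<open>g\<close> does not tend to 0
  uniformly on bounded sets.
\<close>

lemma strongly_null_equicontinuous:
  assumes g: "\<And>n. g n \<in> continuous_dual smul" "limitin (strong_dual smul) g 0 sequentially"
  obtains U where "open U" "0 \<in> U" "\<And>n x. x \<in> U \<Longrightarrow> norm (g n x) \<le> 1"
proof -
  obtain V :: "nat \<Rightarrow> 'a set" where V: "\<And>n. open (V n)" "\<And>n. 0 \<in> V n"
    "\<And>n x y. x \<in> V (Suc n) \<Longrightarrow> y \<in> V (Suc n) \<Longrightarrow> x + y \<in> V n"
    "\<And>U. open U \<Longrightarrow> 0 \<in> U \<Longrightarrow> \<exists>n. V n \<subseteq> U"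
    using zero_neighbourhood_base by blast
  have V_mono: "V l \<subseteq> V k" if "k \<le> l" for k l
    using that
  proof (induction l rule: dec_induct)
    case (step l)
    then show ?case using V(2)[of "Suc l"] V(3)[of _ l 0] by force
  qed simp
  obtain k where k: "\<forall>n. \<forall>x\<in>V k. norm (g n x) \<le> 1"
  proof (rule ccontr)
    assume no: "\<not> thesis"
    have "\<forall>k. \<exists>x n. x \<in> V k \<and> norm (g n x) > 1"
      using no that by (metis not_le)
    \<comment> \<open>\<open>x\<close> tends to 0 because its terms follow the base, so its range is
      bounded.\<close>
    then obtain x n where xn: "\<And>k. x k \<in> V k" "\<And>k. norm (g (n k) (x k)) > 1" by metis
    have "x \<longlonglongrightarrow> 0"
    proof (rule topological_tendstoI)
      fix U :: "'a set" assume "open U" "0 \<in> U"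
      then obtain k where "V k \<subseteq> U" using V(4) by blast
      then show "\<forall>\<^sub>F k in sequentially. x k \<in> U"
        unfolding eventually_sequentially using xn(1) V_mono by blast
    qed
    then have bdd: "tvs_bounded smul (range x)" by (rule null_sequence_bounded)
    have "0 \<in> continuous_dual smul"
      using g(2) by (simp add: limitin_def topspace_strong_dual)
    then obtain W where W: "openin (strong_dual smul) W" "0 \<in> W"
      "\<And>h y. h \<in> W \<Longrightarrow> y \<in> range x \<Longrightarrow> norm (h y - 0 y) < 1"
      using strong_dual_neighbourhood[OF _ bdd, of 0 1] by auto
    have "\<forall>\<^sub>F j in sequentially. g j \<in> W"
      using g(2) W by (simp add: limitin_def)
    then obtain N where "\<And>j. j \<ge> N \<Longrightarrow> g j \<in> W"
      unfolding eventually_sequentially by blast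
    \<comment> \<open>For \<open>j \<ge> N\<close> strong convergence bounds \<open>g j\<close> on
      all of \<open>range x\<close>; the finitely many other \<open>g j\<close> are small along
      \<open>x\<close> by continuity. A suitable \<open>k\<close> then contradicts the choice of
      \<open>n k\<close>, whichever range that index lies in.\<close>
    then have N: "norm (g j (x k)) < 1" if "j \<ge> N" for j k
      using W(3)[of "g j" "x k"] that by simp
    have "\<forall>\<^sub>F k in sequentially. norm (g j (x k)) < 1" for j
    proof -
      have "(\<lambda>k. g j (x k)) \<longlonglongrightarrow> g j 0"
        using \<open>x \<longlonglongrightarrow> 0\<close> dualD(7)[OF g(1)] by (intro continuous_on_tendsto_compose[of UNIV "g j"]) auto
      then have "(\<lambda>k. norm (g j (x k))) \<longlonglongrightarrow> 0"
        using dualD(3)[OF g(1)[of j]] by (intro tendsto_norm_zero) simp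
      then show ?thesis by (rule order_tendstoD) simp
    qed
    then have "\<forall>\<^sub>F k in sequentially. \<forall>j\<in>{..<N}. norm (g j (x k)) < 1"
      by (intro eventually_ball_finite) auto
    then obtain k where k: "\<forall>j\<in>{..<N}. norm (g j (x k)) < 1"
      using eventually_happens'[OF sequentially_bot] by blast
    show False
    proof (cases "n k < N")
      case True
      then show False using bspec[OF k, of "n k"] xn(2)[of k] by simp
    next
      case False
      then show False using N[of "n k" k] xn(2)[of k] by simp
    qed
  qed
  show ?thesis by (rule that[of "V k"]) (use k V(1,2) in simp_all)
qed

end

section \<open>Biorthogonalisation\<close>

text \<open>The scalar field stays generic: Hahn-Banach enters through
  \<open>dual_separates\<close>, whose proofs for real and complex scalars differ.\<close>

locale dual_ell1_frechet_space = frechet_space smul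
  for smul :: "'k::{real_normed_field, banach, second_countable_topology}
      \<Rightarrow> 'a::{topological_ab_group_add, uniform_topological_group_add} \<Rightarrow> 'a" +
  fixes g :: "nat \<Rightarrow> 'a \<Rightarrow> 'k"
  assumes separable: "separable_space (euclidean :: 'a topology)"
    and infinite_dim: "infinite_dimensional smul"
    and dual_separates: "\<And>u. u \<noteq> 0 \<Longrightarrow> \<exists>f\<in>continuous_dual smul. f u \<noteq> 0"
    and ell1: "ell1_sequence dual_smul (strong_dual smul) g"
    and dense_span: "dense_in (strong_dual smul) (module.span dual_smul (range g))"
begin

lemma g_dual: "g n \<in> continuous_dual smul"
  using ell1 by (auto simp: ell1_sequence_def topspace_strong_dual)

text \<open>If every \<open>g n\<close> vanished at \<open>u\<close>, so would their span, and by
  strong density, tested on the bounded set \<open>{u}\<close>, so would all continuous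
  functionals.\<close>

lemma g_separates:
  assumes "u \<noteq> 0"
  obtains n where "g n u \<noteq> 0"
proof (rule ccontr)
  assume "\<not> thesis"
  with that have 0: "g n u = 0" for n by blast
  interpret D: module "dual_smul :: 'k \<Rightarrow> ('a \<Rightarrow> 'k) \<Rightarrow> 'a \<Rightarrow> 'k" by (rule module_dual_smul)
  have span0: "h u = 0" if "h \<in> D.span (range g)" for h
    using that by (induction rule: D.span_induct_alt) (auto simp: 0 dual_smul_def)
  obtain f where f: "f \<in> continuous_dual smul" "f u \<noteq> 0"
    using dual_separates[OF assms] by blast
  obtain h where "h \<in> D.span (range g)" "norm (h u - f u) < norm (f u)"
    using strong_dual_dense_approx[OF dense_span f(1) bounded_singleton[of u], of "norm (f u)"] f(2)
    by auto
  then show False using span0[of h] by simp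
qed

definition equicontinuity_nbhd :: "'a set" where
  "equicontinuity_nbhd = (SOME U. open U \<and> 0 \<in> U \<and> (\<forall>n. \<forall>x\<in>U. norm (g n x) \<le> 1))"

lemma equicontinuity_nbhd:
  shows "open equicontinuity_nbhd" "0 \<in> equicontinuity_nbhd"
    "\<And>n x. x \<in> equicontinuity_nbhd \<Longrightarrow> norm (g n x) \<le> 1"
proof -
  have "limitin (strong_dual smul) g 0 sequentially"
    using ell1 by (simp add: ell1_sequence_def)
  then obtain U where "open U \<and> 0 \<in> U \<and> (\<forall>n. \<forall>x\<in>U. norm (g n x) \<le> 1)"
    by (rule strongly_null_equicontinuous[OF g_dual]) blast
  then have "open equicontinuity_nbhd \<and> 0 \<in> equicontinuity_nbhd \<and>
      (\<forall>n. \<forall>x\<in>equicontinuity_nbhd. norm (g n x) \<le> 1)"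
    unfolding equicontinuity_nbhd_def by (rule someI)
  then show "open equicontinuity_nbhd" "0 \<in> equicontinuity_nbhd"
    "\<And>n x. x \<in> equicontinuity_nbhd \<Longrightarrow> norm (g n x) \<le> 1"
    by blast+
qed

text \<open>The linear span of the polar of the common neighbourhood. It contains every
  \<open>g n\<close> and is closed under finite combinations, so biorthogonalisation does not leave
  it.\<close>

definition bounded_dual :: "('a \<Rightarrow> 'k) set" where
  "bounded_dual = {f \<in> continuous_dual smul. \<exists>C. \<forall>x\<in>equicontinuity_nbhd. norm (f x) \<le> C}"

lemma bounded_dual_add:
  assumes "f \<in> bounded_dual" "h \<in> bounded_dual"
  shows "(\<lambda>x. f x + h x) \<in> bounded_dual"
proof -
  obtain C D where "\<forall>x\<in>equicontinuity_nbhd. norm (f x) \<le> C" "\<forall>x\<in>equicontinuity_nbhd. norm (h x) \<le> D"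
    using assms by (auto simp: bounded_dual_def)
  then have "\<forall>x\<in>equicontinuity_nbhd. norm (f x + h x) \<le> C + D"
    by (meson add_mono norm_triangle_le)
  then show ?thesis
    using assms dual_add unfolding bounded_dual_def by blast
qed

lemma bounded_dual_cmult:
  assumes "f \<in> bounded_dual"
  shows "(\<lambda>x. c * f x) \<in> bounded_dual"
proof -
  obtain C where "\<forall>x\<in>equicontinuity_nbhd. norm (f x) \<le> C"
    using assms by (auto simp: bounded_dual_def)
  then have "\<forall>x\<in>equicontinuity_nbhd. norm (c * f x) \<le> norm c * C"
    by (auto simp: norm_mult intro: mult_left_mono)
  then show ?thesis
    using assms dual_cmult unfolding bounded_dual_def by blast
qed

lemma g_bounded_dual: "g n \<in> bounded_dual"
  using g_dual equicontinuity_nbhd(3) unfolding bounded_dual_def by blast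

lemma bounded_dual_sum:
  assumes "finite I" "\<And>i. i \<in> I \<Longrightarrow> f i \<in> bounded_dual"
  shows "(\<lambda>x. \<Sum>i\<in>I. c i * f i x) \<in> bounded_dual"
  using assms
proof (induction I)
  case empty
  show ?case using bounded_dual_cmult[OF g_bounded_dual, of 0 0] by simp
next
  case (insert i I)
  then show ?case
    by (auto intro!: bounded_dual_add bounded_dual_cmult)
qed

text \<open>Two-sided Gram-Schmidt. Here \<open>rest m y = g m (y - proj y)\<close>, so a single
  nonzero value \<open>rest m v\<close> suffices to bring \<open>v\<close> into the span of the
  points and \<open>g m\<close> into that of the functionals. The alternatives
  \<open>u = proj u\<close> and \<open>rest l = 0\<close> record that elements already in these
  spans stay there.\<close>

lemma biorthogonal_step:
  fixes x :: "nat \<Rightarrow> 'a" and \<phi> :: "nat \<Rightarrow> 'a \<Rightarrow> 'k"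
  assumes \<phi>: "\<And>i. i < n \<Longrightarrow> \<phi> i \<in> bounded_dual"
    and biorth: "\<And>i j. i < n \<Longrightarrow> j < n \<Longrightarrow> \<phi> i (x j) = of_bool (i = j)"
  defines "proj \<equiv> \<lambda>y. \<Sum>i<n. smul (\<phi> i y) (x i)"
    and "rest \<equiv> \<lambda>m y. g m y - (\<Sum>i<n. g m (x i) * \<phi> i y)"
  assumes ne: "rest m v \<noteq> 0"
  shows "\<exists>a f. f \<in> bounded_dual \<and> f a = 1 \<and> (\<forall>i<n. f (x i) = 0 \<and> \<phi> i a = 0) \<and>
    (\<forall>u. u = v \<or> u = proj u \<longrightarrow> u = proj u + smul (f u) a) \<and>
    (\<forall>l. l = m \<or> (\<forall>y. rest l y = 0) \<longrightarrow> (\<forall>y. g l y = (\<Sum>i<n. g l (x i) * \<phi> i y) + g l a * f y))"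
proof -
  define a where "a = v - proj v"
  define f where "f y = rest m y / rest m v" for y
  have \<phi>D: "\<phi> i \<in> continuous_dual smul" if "i < n" for i
    using \<phi>[OF that] by (simp add: bounded_dual_def)
  have \<phi>proj: "\<phi> i (proj y) = \<phi> i y" if "i < n" for i y
  proof -
    have "\<phi> i (proj y) = (\<Sum>j<n. if i = j then \<phi> j y else 0)"
      unfolding proj_def dualD(6)[OF \<phi>D[OF that]] using that
      by (intro sum.cong) (auto simp: dualD(2)[OF \<phi>D[OF that]] biorth)
    then show ?thesis using that by simp
  qed
  have rest_x: "rest l (x j) = 0" if "j < n" for l j
  proof -
    have "(\<Sum>i<n. g l (x i) * \<phi> i (x j)) = (\<Sum>i<n. if j = i then g l (x i) else 0)"
      using that by (intro sum.cong) (auto simp: biorth)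
    then show ?thesis using that by (simp add: rest_def)
  qed
  have \<phi>a: "\<phi> i a = 0" if "i < n" for i
    using \<phi>proj[OF that] dualD(4)[OF \<phi>D[OF that]] by (simp add: a_def)
  have rest_a: "rest l a = g l a" for l
    using \<phi>a by (simp add: rest_def)
  have g_proj: "g l (proj y) = (\<Sum>i<n. g l (x i) * \<phi> i y)" for l y
    unfolding proj_def dualD(6)[OF g_dual] by (simp add: dualD(2)[OF g_dual] mult.commute)
  have ga: "g m a = rest m v"
    unfolding a_def dualD(4)[OF g_dual] g_proj by (simp add: rest_def)
  have f_bd: "f \<in> bounded_dual"
  proof -
    have "(\<lambda>y. 1 / rest m v * (g m y + (- 1) * (\<Sum>i<n. g m (x i) * \<phi> i y))) \<in> bounded_dual"
      by (intro bounded_dual_cmult bounded_dual_add g_bounded_dual bounded_dual_sum \<phi>) auto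
    then show ?thesis by (simp add: f_def[abs_def] rest_def)
  qed
  have fx: "f (x i) = 0" if "i < n" for i
    using rest_x[OF that] by (simp add: f_def)
  have fa: "f a = 1" using ne by (simp add: f_def rest_a ga)
  have f_proj: "f (proj u) = 0" for u
  proof -
    have fD: "f \<in> continuous_dual smul" using f_bd by (simp add: bounded_dual_def)
    show ?thesis
      unfolding proj_def dualD(6)[OF fD] by (simp add: dualD(2)[OF fD] fx)
  qed
  have "u = proj u + smul (f u) a" if u: "u = v \<or> u = proj u" for u
  proof (cases "u = v")
    case True
    then show ?thesis using ne by (simp add: f_def a_def)
  next
    case False
    then have "u = proj u" using u by blast
    then show ?thesis using f_proj[of u] by simp
  qed
  moreover have "g l y = (\<Sum>i<n. g l (x i) * \<phi> i y) + g l a * f y"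
    if l: "l = m \<or> (\<forall>y. rest l y = 0)" for l y
  proof (cases "l = m")
    case True
    then show ?thesis using ne ga by (simp add: f_def) (simp add: rest_def)
  next
    case False
    then have "rest l y = 0" "g l a = 0" using l rest_a[of l] by auto
    then show ?thesis by (simp add: rest_def)
  qed
  ultimately show ?thesis
    using f_bd fa fx \<phi>a by (intro exI[of _ a] exI[of _ f]) blast
qed

lemma biorthogonal_exists:
  fixes u :: "nat \<Rightarrow> 'a"
  obtains x :: "nat \<Rightarrow> 'a" and \<phi> :: "nat \<Rightarrow> 'a \<Rightarrow> 'k" where
    "\<And>i. \<phi> i \<in> bounded_dual" "\<And>i j. \<phi> i (x j) = of_bool (i = j)"
    "\<And>k. \<exists>n. u k = (\<Sum>i<n. smul (\<phi> i (u k)) (x i))"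
    "\<And>k. \<exists>n. \<forall>y. g k y = (\<Sum>i<n. g k (x i) * \<phi> i y)"
proof -
  \<comment> \<open>Step \<open>2 * k\<close> puts \<open>u k\<close> into the span of the points,
    step \<open>2 * k + 1\<close> puts \<open>g k\<close> into the span of the functionals.\<close>
  define P where "P F n r \<longleftrightarrow> snd r \<in> bounded_dual \<and> snd r (fst r) = 1 \<and>
    (\<forall>i<n. snd r (fst (F i)) = 0 \<and> snd (F i) (fst r) = 0) \<and>
    (even n \<longrightarrow> u (n div 2) = (\<Sum>i<n. smul (snd (F i) (u (n div 2))) (fst (F i))) +
       smul (snd r (u (n div 2))) (fst r)) \<and>
    (odd n \<longrightarrow> (\<forall>y. g (n div 2) y = (\<Sum>i<n. g (n div 2) (fst (F i)) * snd (F i) y) +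
       g (n div 2) (fst r) * snd r y))"
    for F :: "nat \<Rightarrow> 'a \<times> ('a \<Rightarrow> 'k)" and n :: nat and r
  have "\<exists>F. \<forall>n. P F n (F n)"
  proof (rule dependent_wellorder_choice)
    show "P F n r = P G n r" if "\<And>i. i < n \<Longrightarrow> F i = G i" for F G n r
      using that by (simp add: P_def)
  next
    fix n F assume IH: "\<And>i. i < n \<Longrightarrow> P F i (F i)"
    define x where "x i = fst (F i)" for i
    define \<phi> where "\<phi> i = snd (F i)" for i
    define proj where "proj y = (\<Sum>i<n. smul (\<phi> i y) (x i))" for y
    define rest where "rest m y = g m y - (\<Sum>i<n. g m (x i) * \<phi> i y)" for m y
    have \<phi>: "\<phi> i \<in> bounded_dual" if "i < n" for i
      using IH[OF that] by (simp add: P_def \<phi>_def)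
    have diag: "\<phi> i (x i) = 1" and off: "j < i \<Longrightarrow> \<phi> i (x j) = 0 \<and> \<phi> j (x i) = 0" if "i < n" for i j
      using IH[OF that] unfolding P_def x_def \<phi>_def by blast+
    have biorth: "\<phi> i (x j) = of_bool (i = j)" if "i < n" "j < n" for i j
      using diag[OF that(1)] off[OF that(1), of j] off[OF that(2), of i] by (cases i j rule: linorder_cases) simp_all
    have "rest m v = g m (v - proj v)" for m v
      unfolding rest_def proj_def dualD(4)[OF g_dual] dualD(6)[OF g_dual]
      by (simp add: dualD(2)[OF g_dual] mult.commute)
    then have ex_m: "\<exists>m. rest m v \<noteq> 0" if "v \<noteq> proj v" for v
      using that by (metis eq_iff_diff_eq_0 g_separates)
    \<comment> \<open>Infinite dimension keeps the construction going when the element scheduled for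
      this step is already in the span.\<close>
    have "\<exists>v. v \<noteq> proj v"
    proof (rule ccontr)
      assume "\<nexists>v. v \<noteq> proj v"
      then have eq: "v = proj v" for v by blast
      have "proj v \<in> span (x ` {..<n})" for v
        unfolding proj_def by (intro span_sum span_scale span_base) auto
      then have "span (x ` {..<n}) = UNIV" using eq by (metis UNIV_eq_I)
      then show False using infinite_dim unfolding infinite_dimensional_def by blast
    qed
    then obtain v0 m0 where vm0: "rest m0 v0 \<noteq> 0" using ex_m by blast
    define k where "k = n div 2"
    obtain v m where vm: "rest m v \<noteq> 0" "even n \<Longrightarrow> u k = v \<or> u k = proj (u k)"
      "odd n \<Longrightarrow> k = m \<or> (\<forall>y. rest k y = 0)"
    proof (cases "even n")
      case True
      show ?thesis
      proof (cases "u k = proj (u k)")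
        case eq: True
        show ?thesis by (rule that[OF vm0]) (use eq True in auto)
      next
        case False
        then obtain m where "rest m (u k) \<noteq> 0" using ex_m by blast
        then show ?thesis by (rule that) (use True in auto)
      qed
    next
      case False
      show ?thesis
      proof (cases "\<forall>y. rest k y = 0")
        case all: True
        show ?thesis by (rule that[OF vm0]) (use all False in auto)
      next
        case n0: False
        then obtain v where "rest k v \<noteq> 0" by blast
        then show ?thesis by (rule that) (use False in auto)
      qed
    qed
    have step: "\<exists>a f. f \<in> bounded_dual \<and> f a = 1 \<and> (\<forall>i<n. f (x i) = 0 \<and> \<phi> i a = 0) \<and>
      (\<forall>u. u = v \<or> u = proj u \<longrightarrow> u = proj u + smul (f u) a) \<and>
      (\<forall>l. l = m \<or> (\<forall>y. rest l y = 0) \<longrightarrow> (\<forall>y. g l y = (\<Sum>i<n. g l (x i) * \<phi> i y) + g l a * f y))"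
      unfolding proj_def rest_def
      by (rule biorthogonal_step) (use \<phi> biorth vm(1) in \<open>simp_all add: rest_def\<close>)
    obtain a f where af: "f \<in> bounded_dual" "f a = 1" "\<And>i. i < n \<Longrightarrow> f (x i) = 0 \<and> \<phi> i a = 0"
      "\<And>u. u = v \<or> u = proj u \<Longrightarrow> u = proj u + smul (f u) a"
      "\<And>l y. l = m \<or> (\<forall>y. rest l y = 0) \<Longrightarrow> g l y = (\<Sum>i<n. g l (x i) * \<phi> i y) + g l a * f y"
      using step by (elim exE conjE) (rule that; blast)
    have "P F n (a, f)"
      unfolding P_def fst_conv snd_conv x_def[symmetric] \<phi>_def[symmetric] k_def[symmetric] proj_def[symmetric]
      by (intro conjI impI allI af(1,2) af(4) af(5) vm(2,3)) (use af(3) in simp_all)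
    then show "\<exists>r. P F n r" ..
  qed
  then obtain F where F: "\<And>n. P F n (F n)" by blast
  define x where "x i = fst (F i)" for i
  define \<phi> where "\<phi> i = snd (F i)" for i
  show ?thesis
  proof
    show "\<phi> i \<in> bounded_dual" for i
      using F[of i] by (simp add: P_def \<phi>_def)
    have diag: "\<phi> i (x i) = 1" and off: "j < i \<Longrightarrow> \<phi> i (x j) = 0 \<and> \<phi> j (x i) = 0" for i j
      using F[of i] unfolding P_def x_def \<phi>_def by blast+
    show "\<phi> i (x j) = of_bool (i = j)" for i j
      using diag[of i] off[of j i] off[of i j] by (cases i j rule: linorder_cases) simp_all
    show "\<exists>n. u k = (\<Sum>i<n. smul (\<phi> i (u k)) (x i))" for k
    proof -
      have k: "2 * k div 2 = k" "even (2 * k)" by simp_all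
      have "u k = (\<Sum>i<Suc (2 * k). smul (\<phi> i (u k)) (x i))"
        unfolding sum.lessThan_Suc x_def \<phi>_def using F[of "2 * k"] k(2) unfolding P_def k(1) by blast
      then show ?thesis ..
    qed
    show "\<exists>n. \<forall>y. g k y = (\<Sum>i<n. g k (x i) * \<phi> i y)" for k
    proof -
      have k: "(2 * k + 1) div 2 = k" "odd (2 * k + 1)" by simp_all
      have "\<forall>y. g k y = (\<Sum>i<Suc (2 * k + 1). g k (x i) * \<phi> i y)"
        unfolding sum.lessThan_Suc[of _ "2 * k + 1"] x_def \<phi>_def
        using F[of "2 * k + 1"] k(2) unfolding P_def k(1) by blast
      then show ?thesis ..
    qed
  qed
qed

end


section \<open>Fast null sequences\<close>

context frechet_space
begin

text \<open>
  A sequence decaying so fast along a neighbourhood base that \<open>\<Sum>i. smul (b i) (e i)\<close> converges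
  for every bounded \<open>b\<close>, and depends continuously on \<open>b\<close> in the sup norm.
\<close>

definition fast_null :: "(nat \<Rightarrow> 'a) \<Rightarrow> bool" where
  "fast_null e \<longleftrightarrow> (\<exists>V. (\<forall>n. open (V n) \<and> 0 \<in> V n) \<and>
    (\<forall>n. \<forall>x\<in>V (Suc n). \<forall>y\<in>V (Suc n). x + y \<in> V n) \<and>
    (\<forall>U. open U \<longrightarrow> 0 \<in> U \<longrightarrow> (\<exists>n. V n \<subseteq> U)) \<and>
    (\<forall>i c. norm c \<le> real (Suc i) \<longrightarrow> smul c (e i) \<in> V i))"

lemma fast_nullE:
  assumes "fast_null e"
  obtains V where "\<And>n. open (V n)" "\<And>n. 0 \<in> V n"
    "\<And>n x y. x \<in> V (Suc n) \<Longrightarrow> y \<in> V (Suc n) \<Longrightarrow> x + y \<in> V n"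
    "\<And>U. open U \<Longrightarrow> 0 \<in> U \<Longrightarrow> \<exists>n. V n \<subseteq> U"
    "\<And>i c. norm c \<le> real (Suc i) \<Longrightarrow> smul c (e i) \<in> V i"
proof -
  obtain V where "(\<forall>n. open (V n) \<and> 0 \<in> V n) \<and>
    (\<forall>n. \<forall>x\<in>V (Suc n). \<forall>y\<in>V (Suc n). x + y \<in> V n) \<and>
    (\<forall>U. open U \<longrightarrow> 0 \<in> U \<longrightarrow> (\<exists>n. V n \<subseteq> U)) \<and>
    (\<forall>i c. norm c \<le> real (Suc i) \<longrightarrow> smul c (e i) \<in> V i)"
    using assms unfolding fast_null_def ..
  then show ?thesis by (intro that[of V]) (simp_all del: of_nat_Suc)
qed

text \<open>\<open>V i\<close> absorbs \<open>x i\<close>, which yields \<open>t i\<close>. The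
  permitted size \<open>Suc i\<close> of the coefficients grows, so any fixed bound on coefficients
  is permitted from some index on.\<close>

lemma fast_null_scaling_exists:
  obtains t :: "nat \<Rightarrow> real" where "\<And>i. t i > 0" "fast_null (\<lambda>i. smul (of_real (t i)) (x i))"
proof -
  obtain V :: "nat \<Rightarrow> 'a set" where V: "\<And>n. open (V n)" "\<And>n. 0 \<in> V n"
    "\<And>n x y. x \<in> V (Suc n) \<Longrightarrow> y \<in> V (Suc n) \<Longrightarrow> x + y \<in> V n"
    "\<And>U. open U \<Longrightarrow> 0 \<in> U \<Longrightarrow> \<exists>n. V n \<subseteq> U"
    using zero_neighbourhood_base by blast
  have "\<exists>t>0. \<forall>c. norm c \<le> real (Suc i) \<longrightarrow> smul c (smul (of_real t) (x i)) \<in> V i" for i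
  proof -
    obtain d where d: "d > 0" "\<And>c. norm c \<le> d \<Longrightarrow> smul c (x i) \<in> V i"
      using scale_near_zero_radius[OF V(1,2)] by blast
    have "smul c (smul (of_real (d / real (Suc i))) (x i)) \<in> V i" if "norm c \<le> real (Suc i)" for c
    proof -
      have "norm (c * of_real (d / real (Suc i))) \<le> real (Suc i) * (d / real (Suc i))"
        unfolding norm_mult norm_of_real using that d(1) by (intro mult_mono) auto
      also have "\<dots> = d" by simp
      finally have "norm (c * of_real (d / real (Suc i))) \<le> d" .
      then show ?thesis using d(2) by simp
    qed
    then show ?thesis using d(1) by (intro exI[of _ "d / real (Suc i)"]) auto
  qed
  then obtain t where t: "\<And>i. t i > 0"
    "\<And>i c. norm c \<le> real (Suc i) \<Longrightarrow> smul c (smul (of_real (t i)) (x i)) \<in> V i"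
    by metis
  have "fast_null (\<lambda>i. smul (of_real (t i)) (x i))"
    unfolding fast_null_def using V t(2) by (intro exI[of _ V]) simp
  then show ?thesis using that t(1) by blast
qed

definition series :: "(nat \<Rightarrow> 'a) \<Rightarrow> (nat \<Rightarrow> 'k) \<Rightarrow> 'a" where
  "series e b = (SOME s. (\<lambda>N. \<Sum>i<N. smul (b i) (e i)) \<longlonglongrightarrow> s)"

text \<open>Split off the first term: it lies in \<open>V (Suc k)\<close>, and so does the remaining
  sum by induction.\<close>

lemma tail_sum_in_base:
  fixes V :: "nat \<Rightarrow> 'a set" and y :: "nat \<Rightarrow> 'a"
  assumes "\<And>n. 0 \<in> V n" "\<And>n x y. x \<in> V (Suc n) \<Longrightarrow> y \<in> V (Suc n) \<Longrightarrow> x + y \<in> V n"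
    "\<And>i. m \<le> i \<Longrightarrow> i < m + d \<Longrightarrow> y i \<in> V (Suc (k + (i - m)))"
  shows "(\<Sum>i=m..<m + d. y i) \<in> V k"
  using assms(3)
proof (induction d arbitrary: m k)
  case (Suc d)
  have "(\<Sum>i=Suc m..<Suc m + d. y i) \<in> V (Suc k)"
  proof (rule Suc.IH)
    fix i assume "Suc m \<le> i" "i < Suc m + d"
    then show "y i \<in> V (Suc (Suc k + (i - Suc m)))"
      using Suc.prems[of i] by (simp add: Suc_diff_Suc)
  qed
  moreover have "y m \<in> V (Suc k)" using Suc.prems[of m] by simp
  ultimately have "y m + (\<Sum>i=Suc m..<Suc m + d. y i) \<in> V k" using assms(2) by blast
  then show ?case
    using sum.atLeast_Suc_lessThan[of m "m + Suc d" y] by (simp del: sum.op_ivl_Suc)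
qed (use assms(1) in simp)

lemma series_tendsto:
  assumes "fast_null e" and b: "\<And>i. norm (b i) \<le> C"
  shows "(\<lambda>N. \<Sum>i<N. smul (b i) (e i)) \<longlonglongrightarrow> series e b"
proof -
  obtain V where V: "\<And>n. open (V n)" "\<And>n. 0 \<in> V n"
    "\<And>n x y. x \<in> V (Suc n) \<Longrightarrow> y \<in> V (Suc n) \<Longrightarrow> x + y \<in> V n"
    "\<And>U. open U \<Longrightarrow> 0 \<in> U \<Longrightarrow> \<exists>n. V n \<subseteq> U"
    "\<And>i c. norm c \<le> real (Suc i) \<Longrightarrow> smul c (e i) \<in> V i"
    by (rule fast_nullE[OF assms(1)]) (rule that; assumption)
  have V_mono: "V l \<subseteq> V k" if "k \<le> l" for k l
    using that
  proof (induction l rule: dec_induct)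
    case (step l)
    then show ?case using V(2)[of "Suc l"] V(3)[of _ l 0] by force
  qed simp
  let ?S = "\<lambda>N. \<Sum>i<N. smul (b i) (e i)"
  \<comment> \<open>From index \<open>K0\<close> on, all coefficients of size at most
    \<open>C\<close> are permitted by \<open>fast_null\<close>.\<close>
  obtain K0 where K0: "C \<le> real K0" using real_arch_simple by blast
  have diff: "?S l - ?S m \<in> V k \<and> ?S m - ?S l \<in> V k" if "max (Suc k) K0 \<le> m" "m \<le> l" for k l m
  proof -
    have S: "?S l - ?S m = (\<Sum>i=m..<m + (l - m). smul (b i) (e i))"
      using that sum_diff_nat_ivl[of 0 m l "\<lambda>i. smul (b i) (e i)"] by (simp add: atLeast0LessThan)
    have in_V: "smul c (e i) \<in> V (Suc (k + (i - m)))" if "m \<le> i" "norm c \<le> C" for i c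
    proof -
      have "norm c \<le> real (Suc i)" using that K0 \<open>max (Suc k) K0 \<le> m\<close> by linarith
      then have "smul c (e i) \<in> V i" by (rule V(5))
      moreover have "Suc (k + (i - m)) \<le> i" using that \<open>max (Suc k) K0 \<le> m\<close> by linarith
      ultimately show ?thesis using V_mono by blast
    qed
    have "(\<Sum>i=m..<m + (l - m). smul (b i) (e i)) \<in> V k"
      by (rule tail_sum_in_base[of V]) (use V(2,3) b in_V in auto)
    \<comment> \<open>The sets \<open>V k\<close> are not known to be symmetric; the opposite
      difference is handled as the sum with coefficients \<open>- b\<close>.\<close>
    moreover have "(\<Sum>i=m..<m + (l - m). smul (- b i) (e i)) \<in> V k"
      by (rule tail_sum_in_base[of V]) (use V(2,3) b in_V[of _ "- b _"] in auto)
    moreover have "?S m - ?S l = (\<Sum>i=m..<m + (l - m). smul (- b i) (e i))"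
      unfolding minus_diff_eq[of "?S l", symmetric] S by (simp add: sum_negf)
    ultimately show ?thesis using S by simp
  qed
  have "cauchy_filter (filtermap ?S sequentially)"
    unfolding cauchy_filter_def cauchy_seq_finset_iff_vanishing le_filter_def eventually_filtercomap
  proof (intro allI impI)
    fix P :: "'a \<times> 'a \<Rightarrow> bool" assume "\<exists>Q. eventually Q (nhds 0) \<and> (\<forall>x. Q (case x of (x, y) \<Rightarrow> y - x) \<longrightarrow> P x)"
    then obtain Q :: "'a \<Rightarrow> bool" where Q: "eventually Q (nhds 0)" "\<And>x y. Q (y - x) \<Longrightarrow> P (x, y)"
      by fastforce
    obtain U :: "'a set" where U: "open U" "0 \<in> U" "\<And>x. x \<in> U \<Longrightarrow> Q x"
      using Q(1) unfolding eventually_nhds by blast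
    obtain k where k: "V k \<subseteq> U" using V(4)[OF U(1,2)] by blast
    have "P (?S l, ?S m)" if "max (Suc k) K0 \<le> m" "max (Suc k) K0 \<le> l" for l m
      using diff[of k l m] diff[of k m l] that k U(3) Q(2) by (cases "m \<le> l") auto
    moreover define R where "R x \<longleftrightarrow> (\<exists>m\<ge>max (Suc k) K0. x = ?S m)" for x
    moreover have "\<forall>\<^sub>F m in sequentially. R (?S m)"
      using eventually_ge_at_top[of "max (Suc k) K0"] by eventually_elim (auto simp: R_def)
    ultimately show "eventually P (filtermap ?S sequentially \<times>\<^sub>F filtermap ?S sequentially)"
      unfolding eventually_prod_same eventually_filtermap by (intro exI[of _ R]) auto
  qed
  from cauchy_filter_complete_converges[OF this complete]
  have "\<exists>s. filtermap ?S sequentially \<le> nhds s"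
    by (simp add: filtermap_bot_iff)
  then obtain s where "filtermap ?S sequentially \<le> nhds s" ..
  then have "?S \<longlonglongrightarrow> s" by (simp add: filterlim_def)
  then show ?thesis unfolding series_def by (rule someI)
qed

lemma series_small:
  assumes "fast_null e" "open W" "0 \<in> W"
  obtains d where "d > 0" "\<And>b :: nat \<Rightarrow> 'k. (\<And>i. norm (b i) \<le> d) \<Longrightarrow> series e b \<in> W"
proof -
  obtain V where V: "\<And>n. open (V n)" "\<And>n. 0 \<in> V n"
    "\<And>n x y. x \<in> V (Suc n) \<Longrightarrow> y \<in> V (Suc n) \<Longrightarrow> x + y \<in> V n"
    "\<And>U. open U \<Longrightarrow> 0 \<in> U \<Longrightarrow> \<exists>n. V n \<subseteq> U"
    "\<And>i c. norm c \<le> real (Suc i) \<Longrightarrow> smul c (e i) \<in> V i"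
    by (rule fast_nullE[OF assms(1)]) (rule that; assumption)
  obtain k where k: "V k \<subseteq> W" using V(4)[OF assms(2,3)] by blast
  \<comment> \<open>Two halvings: head and tail of a partial sum lie in \<open>V K\<close>, hence
    their sum in \<open>V (Suc k)\<close>, and adding the remainder of the series leads to
    \<open>V k\<close>. Only the head needs the smallness of \<open>d\<close>.\<close>
  define K where "K = Suc (Suc k)"
  have "\<forall>\<^sub>F c in nhds 0. \<forall>i\<in>{..<Suc K}. smul c (e i) \<in> V (Suc (K + i))"
    by (intro eventually_ball_finite ballI scale_near_zero V) auto
  then obtain d where d: "d > 0" "\<And>c i. dist c 0 < d \<Longrightarrow> i < Suc K \<Longrightarrow> smul c (e i) \<in> V (Suc (K + i))"
    unfolding eventually_nhds_metric by blast
  show ?thesis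
  proof
    show "min (d / 2) 1 > 0" using d by simp
    fix b :: "nat \<Rightarrow> 'k" assume b: "\<And>i. norm (b i) \<le> min (d / 2) 1"
    let ?S = "\<lambda>N. \<Sum>i<N. smul (b i) (e i)"
    have "?S N \<in> V (Suc k)" if "Suc K \<le> N" for N
    proof -
      have "norm (b i) \<le> d / 2" for i
        using b[of i] by simp
      then have bd: "dist (b i) 0 < d" for i
        using d(1) by (smt (verit) dist_norm diff_zero field_sum_of_halves half_gt_zero)
      have "(\<Sum>i=0..<0 + Suc K. smul (b i) (e i)) \<in> V K"
        by (rule tail_sum_in_base[of V]) (use V(2,3) d(2)[OF bd] in auto)
      moreover have "(\<Sum>i=Suc K..<Suc K + (N - Suc K). smul (b i) (e i)) \<in> V K"
      proof (rule tail_sum_in_base[of V])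
        fix i assume i: "Suc K \<le> i"
        have "norm (b i) \<le> real (Suc i)" using b[of i] by simp
        then have "smul (b i) (e i) \<in> V i" by (rule V(5))
        then show "smul (b i) (e i) \<in> V (Suc (K + (i - Suc K)))" using i by simp
      qed (use V(2,3) in auto)
      moreover have "?S N = (\<Sum>i=0..<0 + Suc K. smul (b i) (e i)) + (\<Sum>i=Suc K..<Suc K + (N - Suc K). smul (b i) (e i))"
        using that sum.atLeastLessThan_concat[of 0 "Suc K" N "\<lambda>i. smul (b i) (e i)"]
        by (simp add: atLeast0LessThan del: sum.lessThan_Suc sum.op_ivl_Suc)
      ultimately show ?thesis using V(3)[of _ "Suc k"] by (simp add: K_def del: sum.lessThan_Suc sum.op_ivl_Suc)
    qed
    moreover have "\<forall>\<^sub>F N in sequentially. series e b - ?S N \<in> V (Suc k)"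
    proof -
      have "(\<lambda>N. series e b - ?S N) \<longlonglongrightarrow> series e b - series e b"
        using b by (intro tendsto_intros series_tendsto[OF assms(1), of b 1]) simp
      then show ?thesis using V(1,2) by (intro topological_tendstoD) auto
    qed
    then obtain N0 where "\<And>N. N \<ge> N0 \<Longrightarrow> series e b - ?S N \<in> V (Suc k)"
      unfolding eventually_sequentially by blast
    ultimately have "(series e b - ?S (max N0 (Suc K))) + ?S (max N0 (Suc K)) \<in> V k"
      by (intro V(3)) auto
    then show "series e b \<in> W" using k by auto
  qed
qed

lemma series_add:
  assumes "fast_null e" "\<And>i. norm (b i) \<le> C" "\<And>i. norm (c i) \<le> D"
  shows "series e (\<lambda>i. b i + c i) = series e b + series e c"
proof (rule sequence_limit_unique)
  have "norm (b i + c i) \<le> C + D" for i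
    using assms(2,3)[of i] norm_triangle_ineq[of "b i" "c i"] by linarith
  then show "(\<lambda>N. \<Sum>i<N. smul (b i + c i) (e i)) \<longlonglongrightarrow> series e (\<lambda>i. b i + c i)"
    by (rule series_tendsto[OF assms(1)])
  show "(\<lambda>N. \<Sum>i<N. smul (b i + c i) (e i)) \<longlonglongrightarrow> series e b + series e c"
    unfolding scale_left_distrib sum.distrib
    using assms by (intro tendsto_add series_tendsto)
qed

lemma series_scale:
  assumes "fast_null e" "\<And>i. norm (b i) \<le> C"
  shows "series e (\<lambda>i. a * b i) = smul a (series e b)"
proof (rule sequence_limit_unique)
  have "norm (a * b i) \<le> norm a * C" for i
    using assms(2)[of i] by (simp add: norm_mult mult_left_mono)
  then show "(\<lambda>N. \<Sum>i<N. smul (a * b i) (e i)) \<longlonglongrightarrow> series e (\<lambda>i. a * b i)"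
    by (rule series_tendsto[OF assms(1)])
  have "(\<lambda>N. smul a (\<Sum>i<N. smul (b i) (e i))) \<longlonglongrightarrow> smul a (series e b)"
    using series_tendsto[OF assms]
    by (rule continuous_on_tendsto_compose[of UNIV "smul a", rotated]) (auto intro!: continuous_intros)
  then show "(\<lambda>N. \<Sum>i<N. smul (a * b i) (e i)) \<longlonglongrightarrow> smul a (series e b)"
    by (simp add: scale_sum_right)
qed

lemma series_finite:
  assumes "fast_null e" "\<And>i. i \<ge> n \<Longrightarrow> b i = 0" "\<And>i. norm (b i) \<le> C"
  shows "series e b = (\<Sum>i<n. smul (b i) (e i))"
proof (rule sequence_limit_unique)
  show "(\<lambda>N. \<Sum>i<N. smul (b i) (e i)) \<longlonglongrightarrow> series e b"
    by (rule series_tendsto[OF assms(1,3)])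
  have "(\<Sum>i<N. smul (b i) (e i)) = (\<Sum>i<n. smul (b i) (e i))" if "n \<le> N" for N
    using that assms(2) by (intro sum.mono_neutral_right) auto
  then have "\<forall>\<^sub>F N in sequentially. (\<Sum>i<n. smul (b i) (e i)) = (\<Sum>i<N. smul (b i) (e i))"
    unfolding eventually_sequentially by metis
  then show "(\<lambda>N. \<Sum>i<N. smul (b i) (e i)) \<longlonglongrightarrow> (\<Sum>i<n. smul (b i) (e i))"
    by (rule Lim_transform_eventually[OF tendsto_const])
qed

lemma dual_series:
  assumes "fast_null e" "\<And>i. norm (b i) \<le> C" and f: "f \<in> continuous_dual smul"
    and "\<And>i. i \<noteq> j \<Longrightarrow> f (e i) = 0"
  shows "f (series e b) = b j * f (e j)"
proof -
  have "(\<lambda>N. f (\<Sum>i<N. smul (b i) (e i))) \<longlonglongrightarrow> f (series e b)"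
    using series_tendsto[OF assms(1,2)] dualD(7)[OF f]
    by (intro continuous_on_tendsto_compose[of UNIV f]) auto
  moreover have "f (\<Sum>i<N. smul (b i) (e i)) = b j * f (e j)" if "Suc j \<le> N" for N
  proof -
    have "f (\<Sum>i<N. smul (b i) (e i)) = (\<Sum>i<N. if i = j then b j * f (e j) else 0)"
      unfolding dualD(6)[OF f] by (intro sum.cong) (auto simp: dualD(2)[OF f] assms(4))
    then show ?thesis using that by simp
  qed
  then have "\<forall>\<^sub>F N in sequentially. f (\<Sum>i<N. smul (b i) (e i)) = b j * f (e j)"
    unfolding eventually_sequentially by blast
  then have "(\<lambda>N. f (\<Sum>i<N. smul (b i) (e i))) \<longlonglongrightarrow> b j * f (e j)"
    by (rule tendsto_eventually)
  ultimately show ?thesis by (rule LIMSEQ_unique)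
qed

end


section \<open>Weighted shifts on a Frechet space\<close>

text \<open>Two normalisations of the same functionals: \<open>w\<close> keeps the coefficients of
  \<open>shift\<close> bounded on \<open>U\<close>, whereas \<open>s\<close> makes the sum of the
  \<open>s m * \<phi> m\<close> with bounded coefficients converge absolutely.\<close>

locale frechet_shift = frechet_space smul
  for smul :: "'k::{real_normed_field, banach} \<Rightarrow> 'a::{topological_ab_group_add, uniform_topological_group_add} \<Rightarrow> 'a" +
  fixes e :: "int \<Rightarrow> 'a" and \<phi> :: "int \<Rightarrow> 'a \<Rightarrow> 'k" and w s :: "int \<Rightarrow> real" and U :: "'a set"
  assumes fast: "fast_null (\<lambda>i. e (int_decode i))"
    and \<phi>_dual: "\<And>m. \<phi> m \<in> continuous_dual smul"
    and biorth: "\<And>m n. \<phi> m (e n) = of_bool (m = n)"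
    and U: "open U" "0 \<in> U"
    and w: "\<And>m. 0 < w m" "\<And>m. w m \<le> 1" "\<And>m x. x \<in> U \<Longrightarrow> w m * norm (\<phi> m x) \<le> 1"
    and s: "\<And>m. 0 < s m" "\<And>m x. x \<in> U \<Longrightarrow> s m * norm (\<phi> m x) \<le> (1 / 2) ^ int_encode m"
begin

definition synth :: "(int \<Rightarrow> 'k) \<Rightarrow> 'a" where
  "synth a = series (\<lambda>i. e (int_decode i)) (\<lambda>i. a (int_decode i))"

definition shift :: "'a \<Rightarrow> 'a" where
  "shift x = x + synth (\<lambda>m. of_real (w (m + 1)) * \<phi> (m + 1) x)"

lemma synth_add:
  assumes "\<And>m. norm (a m) \<le> C" "\<And>m. norm (b m) \<le> D"
  shows "synth (\<lambda>m. a m + b m) = synth a + synth b"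
  unfolding synth_def using assms by (intro series_add[OF fast])

lemma synth_diff:
  assumes "\<And>m. norm (a m) \<le> C" "\<And>m. norm (b m) \<le> D"
  shows "synth (\<lambda>m. a m - b m) = synth a - synth b"
proof -
  have "norm (a m - b m) \<le> C + D" for m
    using assms[of m] norm_triangle_ineq4[of "a m" "b m"] by linarith
  then have "synth (\<lambda>m. (a m - b m) + b m) = synth (\<lambda>m. a m - b m) + synth b"
    using assms(2) by (intro synth_add)
  then show ?thesis by simp
qed

lemma synth_scale:
  assumes "\<And>m. norm (a m) \<le> C"
  shows "synth (\<lambda>m. c * a m) = smul c (synth a)"
  unfolding synth_def using assms by (intro series_scale[OF fast])

lemma synth_small:
  assumes "open W" "0 \<in> W"
  obtains d where "d > 0" "\<And>a. (\<And>m. norm (a m) \<le> d) \<Longrightarrow> synth a \<in> W"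
proof -
  obtain d where d: "d > 0" "\<And>b :: nat \<Rightarrow> 'k. (\<And>i. norm (b i) \<le> d) \<Longrightarrow> series (\<lambda>i. e (int_decode i)) b \<in> W"
    using series_small[OF fast assms] by metis
  show ?thesis
  proof (rule that[OF d(1)])
    show "synth a \<in> W" if "\<And>m. norm (a m) \<le> d" for a
      unfolding synth_def by (rule d(2)) (rule that)
  qed
qed

lemma dual_synth:
  assumes "\<And>m. norm (a m) \<le> C"
  shows "\<phi> n (synth a) = a n"
proof -
  have "\<phi> n (synth a) = a (int_decode (int_encode n)) * \<phi> n (e (int_decode (int_encode n)))"
    unfolding synth_def
  proof (rule dual_series[OF fast _ \<phi>_dual])
    fix i assume "i \<noteq> int_encode n"
    then have "n \<noteq> int_decode i" by auto
    then show "\<phi> n (e (int_decode i)) = 0" by (simp add: biorth)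
  qed (rule assms)
  then show ?thesis by (simp add: biorth)
qed

lemma shift_coeff_le:
  assumes "r > 0" "smul (of_real (1 / r)) x \<in> U"
  shows "norm (of_real (w m) * \<phi> m x) \<le> r"
proof -
  have "w m * (norm (\<phi> m x) / r) \<le> 1"
    using w(3)[OF assms(2), of m] dualD(2)[OF \<phi>_dual] assms(1) by (simp add: norm_mult norm_divide)
  then show ?thesis
    using assms(1) w(1)[of m] by (simp add: norm_mult field_simps)
qed

lemma shift_coeff_bounded:
  obtains r where "\<And>m. norm (of_real (w m) * \<phi> m x) \<le> r"
  using absorbing[OF U, of x] shift_coeff_le by metis

lemma shift_additive: "shift (x + y) = shift x + shift y"
proof -
  obtain q r where "\<And>m. norm (of_real (w m) * \<phi> m x) \<le> q" "\<And>m. norm (of_real (w m) * \<phi> m y) \<le> r"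
    using shift_coeff_bounded by metis
  then have "synth (\<lambda>m. of_real (w (m + 1)) * \<phi> (m + 1) x + of_real (w (m + 1)) * \<phi> (m + 1) y) =
      synth (\<lambda>m. of_real (w (m + 1)) * \<phi> (m + 1) x) + synth (\<lambda>m. of_real (w (m + 1)) * \<phi> (m + 1) y)"
    by (intro synth_add)
  then show ?thesis
    unfolding shift_def dualD(1)[OF \<phi>_dual] by (simp add: algebra_simps)
qed

lemma shift_scale: "shift (smul c x) = smul c (shift x)"
proof -
  obtain r where "\<And>m. norm (of_real (w m) * \<phi> m x) \<le> r"
    using shift_coeff_bounded by metis
  then have "synth (\<lambda>m. c * (of_real (w (m + 1)) * \<phi> (m + 1) x)) =
      smul c (synth (\<lambda>m. of_real (w (m + 1)) * \<phi> (m + 1) x))"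
    by (intro synth_scale)
  then show ?thesis
    unfolding shift_def dualD(2)[OF \<phi>_dual] by (simp add: scale_right_distrib mult.left_commute)
qed

lemma shift_continuous: "continuous_on UNIV shift"
proof -
  \<comment> \<open>A small point of \<open>X\<close> has uniformly small weighted coefficients, and
    \<open>synth\<close> sends these to a small vector.\<close>
  let ?S = "\<lambda>x. shift x - x"
  have "continuous_on UNIV ?S"
  proof (rule continuous_on_additive)
    show "?S (x + y) = ?S x + ?S y" for x y by (simp add: shift_additive)
    fix W :: "'a set" assume "open W" "0 \<in> W"
    then obtain d where d: "d > 0" "\<And>a. (\<And>m. norm (a m) \<le> d) \<Longrightarrow> synth a \<in> W"
      using synth_small by blast
    let ?V = "(\<lambda>x. smul (of_real (1 / d)) x) -` U"
    have "open ?V" using U by (intro open_vimage continuous_intros)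
    moreover have "0 \<in> ?V" using U by simp
    moreover have "?S x \<in> W" if "x \<in> ?V" for x
      using shift_coeff_le[OF d(1), of x] that d(2) by (simp add: shift_def)
    ultimately show "\<exists>V. open V \<and> 0 \<in> V \<and> ?S ` V \<subseteq> W" by blast
  qed
  from continuous_on_add[OF this continuous_on_id] show ?thesis by (simp only: diff_add_cancel)
qed

lemma shift_operator: "shift \<in> continuous_operators smul"
proof -
  have "Vector_Spaces.linear smul smul shift"
    by unfold_locales (simp_all add: shift_additive shift_scale)
  then show ?thesis using shift_continuous by (simp add: continuous_operators_def)
qed

lemma wshift_bounded:
  assumes "\<And>m. norm (a m) \<le> C" "\<And>m. 0 < v m" "\<And>m. v m \<le> 1"
  shows "norm (wshift v a m) \<le> 2 * C"
proof -
  have "norm (wshift v a m) \<le> norm (a m) + v (m + 1) * norm (a (m + 1))"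
    unfolding wshift_def using assms(2)[of "m + 1"] by (intro norm_triangle_le) (simp add: norm_mult)
  moreover have "v (m + 1) * norm (a (m + 1)) \<le> 1 * C"
    using assms(1)[of "m + 1"] assms(2,3)[of "m + 1"] by (intro mult_mono) auto
  ultimately show ?thesis using assms(1)[of m] by linarith
qed

lemma wshift_pow_bounded:
  assumes "\<And>m. norm (a m) \<le> C" "\<And>m. 0 < v m" "\<And>m. v m \<le> 1"
  shows "norm ((wshift v ^^ k) a m) \<le> 2 ^ k * C"
proof (induction k arbitrary: m)
  case (Suc k)
  have "norm (wshift v ((wshift v ^^ k) a) m) \<le> 2 * (2 ^ k * C)"
    by (rule wshift_bounded[OF Suc assms(2,3)])
  then show ?case by simp
qed (simp add: assms(1))

text \<open>By biorthogonality \<open>\<phi> n (synth a) = a n\<close>, so \<open>synth\<close>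
  intertwines the scalar shift with \<open>shift\<close>.\<close>

lemma shift_synth:
  assumes "\<And>m. norm (a m) \<le> C"
  shows "shift (synth a) = synth (wshift w a)"
proof -
  have "norm (of_real (w (m + 1)) * a (m + 1)) \<le> 1 * C" for m
    unfolding norm_mult using assms[of "m + 1"] w(1,2)[of "m + 1"] by (intro mult_mono) auto
  then have "synth (\<lambda>m. a m + of_real (w (m + 1)) * a (m + 1)) =
      synth a + synth (\<lambda>m. of_real (w (m + 1)) * a (m + 1))"
    using assms by (intro synth_add)
  then show ?thesis
    unfolding shift_def dual_synth[OF assms] by (simp add: wshift_def[abs_def])
qed

lemma shift_pow_synth:
  assumes "\<And>m. norm (a m) \<le> C"
  shows "(shift ^^ k) (synth a) = synth ((wshift w ^^ k) a)"
proof (induction k)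
  case (Suc k)
  have "shift (synth ((wshift w ^^ k) a)) = synth (wshift w ((wshift w ^^ k) a))"
    by (rule shift_synth[OF wshift_pow_bounded[OF assms w(1,2)]])
  then show ?case using Suc by simp
qed simp

text \<open>Finite combinations of the \<open>e m\<close> are images of finitely supported
  sequences, and \<open>synth_small\<close> turns sup-norm closeness of the scalar orbit into
  closeness in \<open>X\<close>.\<close>

lemma shift_hypercyclic:
  fixes z :: "int \<Rightarrow> 'k"
  assumes z: "\<And>m. norm (z m) \<le> C"
      "\<And>u d. finite {m. u m \<noteq> 0} \<Longrightarrow> 0 < d \<Longrightarrow> \<exists>k. \<forall>m. norm ((wshift w ^^ k) z m - u m) \<le> d"
    and dense: "\<And>G. open G \<Longrightarrow> G \<noteq> {} \<Longrightarrow> \<exists>u n. (\<Sum>i<n. smul (u i) (e (int_decode i))) \<in> G"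
  shows "hypercyclic euclidean shift"
proof -
  have "\<exists>k. (shift ^^ k) (synth z) \<in> G" if G: "open G" "G \<noteq> {}" for G
  proof -
    obtain u n where un: "(\<Sum>i<n. smul (u i) (e (int_decode i))) \<in> G"
      using dense[OF G] by blast
    define b where "b i = (if i < n then u i else 0)" for i
    define a where "a m = b (int_encode m)" for m
    have fin: "finite {m. a m \<noteq> 0}"
      by (rule finite_subset[of _ "int_decode ` {..<n}"])
        (auto simp: a_def b_def image_iff split: if_splits intro!: bexI[of _ "int_encode _"])
    define D where "D = (\<Sum>i<n. norm (u i))"
    have b: "norm (b i) \<le> D" for i
      unfolding D_def b_def by (auto intro!: member_le_sum sum_nonneg)
    have a: "norm (a m) \<le> D" for m using b by (simp add: a_def)
    have "series (\<lambda>i. e (int_decode i)) b = (\<Sum>i<n. smul (b i) (e (int_decode i)))"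
      by (rule series_finite[OF fast _ b]) (simp add: b_def)
    then have "synth a = (\<Sum>i<n. smul (b i) (e (int_decode i)))"
      by (simp add: synth_def a_def)
    then have aO: "synth a \<in> G" using un by (simp add: b_def)
    let ?W = "(\<lambda>x. synth a + x) -` G"
    have "open ?W" using G by (intro open_vimage continuous_intros)
    moreover have "0 \<in> ?W" using aO by simp
    ultimately obtain d where d: "d > 0" "\<And>c. (\<And>m. norm (c m) \<le> d) \<Longrightarrow> synth c \<in> ?W"
      using synth_small by blast
    obtain k where k: "\<And>m. norm ((wshift w ^^ k) z m - a m) \<le> d"
      using z(2)[OF fin d(1)] by blast
    have "synth (\<lambda>m. (wshift w ^^ k) z m - a m) \<in> ?W"
      using k by (intro d)
    then have "(shift ^^ k) (synth z) \<in> G"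
      unfolding synth_diff[where a = "(wshift w ^^ k) z" and b = a, OF wshift_pow_bounded[OF z(1) w(1,2)] a]
        shift_pow_synth[OF z(1)] by simp
    then show ?thesis ..
  qed
  then have "x \<in> euclidean closure_of (range (\<lambda>k. (shift ^^ k) (synth z)))" for x
    unfolding in_closure_of by (metis UNIV_I empty_iff open_openin rangeI topspace_euclidean)
  then have "dense_in euclidean (range (\<lambda>k. (shift ^^ k) (synth z)))"
    unfolding dense_in_def by auto
  then show ?thesis
    unfolding hypercyclic_def by (intro bexI[of _ "synth z"]) simp_all
qed

section \<open>The dual operator in coordinates\<close>

definition half_powers :: real where
  "half_powers = (\<Sum>\<^sub>\<infinity>m. (1 / 2) ^ int_encode m)"

lemma half_powers_summable: "(\<lambda>m. (1 / 2 :: real) ^ int_encode m) summable_on UNIV"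
proof -
  have "(\<lambda>i. (1 / 2 :: real) ^ i) summable_on UNIV"
    by (rule norm_summable_imp_summable_on) (simp add: summable_geometric)
  then show ?thesis
    using summable_on_reindex_bij_betw[OF bij_int_encode, of "\<lambda>i. (1 / 2 :: real) ^ i"] by simp
qed

definition dual_synth_fun :: "(int \<Rightarrow> 'k) \<Rightarrow> 'a \<Rightarrow> 'k" where
  "dual_synth_fun a x = (\<Sum>\<^sub>\<infinity>m. a (- m) * (of_real (s m) * \<phi> m x))"

lemma dual_term_le:
  assumes "\<And>m. norm (a m) \<le> C" "r > 0" "smul (of_real (1 / r)) x \<in> U"
  shows "norm (a n * (of_real (s m) * \<phi> m x)) \<le> C * r * (1 / 2) ^ int_encode m"
proof -
  have "s m * (norm (\<phi> m x) / r) \<le> (1 / 2) ^ int_encode m"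
    using s(2)[OF assms(3), of m] dualD(2)[OF \<phi>_dual] assms(2) by (simp add: norm_mult norm_divide)
  then have "s m * norm (\<phi> m x) \<le> r * (1 / 2) ^ int_encode m"
    using assms(2) by (simp add: field_simps)
  then have "norm (a n) * (s m * norm (\<phi> m x)) \<le> C * (r * (1 / 2) ^ int_encode m)"
    using s(1)[of m] order_trans[OF norm_ge_zero assms(1)]
    by (intro mult_mono[OF assms(1)]) auto
  then show ?thesis
    using s(1)[of m] by (simp add: norm_mult mult_ac)
qed

lemma dual_term_summable:
  assumes "\<And>m. norm (a m) \<le> C"
  shows "(\<lambda>m. a (f m) * (of_real (s m) * \<phi> m x)) summable_on UNIV"
proof -
  obtain r where r: "r > 0" "smul (of_real (1 / r)) x \<in> U"
    using absorbing[OF U] by blast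
  have "(\<lambda>m. C * r * (1 / 2 :: real) ^ int_encode m) summable_on UNIV"
    by (intro summable_on_cmult_right half_powers_summable)
  then have "(\<lambda>m. norm (a (f m) * (of_real (s m) * \<phi> m x))) summable_on UNIV"
    by (rule Infinite_Sum.abs_summable_on_comparison_test') (rule dual_term_le[OF assms r])
  then show ?thesis by (rule Infinite_Sum.abs_summable_summable)
qed

text \<open>The bound depends on \<open>x\<close> only through \<open>r\<close>. Hence it yields
  both continuity of the functional and, as one \<open>r\<close> serves a whole bounded set,
  estimates in the strong topology.\<close>

lemma dual_synth_fun_le:
  assumes "\<And>m. norm (a m) \<le> C" "r > 0" "smul (of_real (1 / r)) x \<in> U"
  shows "norm (dual_synth_fun a x) \<le> C * r * half_powers"
proof -
  have "(\<lambda>m. C * r * (1 / 2 :: real) ^ int_encode m) summable_on UNIV"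
    by (intro summable_on_cmult_right half_powers_summable)
  then have "norm (dual_synth_fun a x) \<le> (\<Sum>\<^sub>\<infinity>m. C * r * (1 / 2) ^ int_encode m)"
    unfolding dual_synth_fun_def
    by (intro norm_infsum_le[OF has_sum_infsum has_sum_infsum])
      (rule dual_term_summable[OF assms(1)], assumption, rule dual_term_le[OF assms])
  also have "\<dots> = C * r * half_powers"
    unfolding half_powers_def by (rule infsum_cmult_right')
  finally show ?thesis .
qed

lemma half_powers_nonneg: "half_powers \<ge> 0"
  unfolding half_powers_def by (intro infsum_nonneg) simp

lemma dual_synth_fun_dual:
  assumes "\<And>m. norm (a m) \<le> C"
  shows "dual_synth_fun a \<in> continuous_dual smul"
proof (rule dualI)
  have sum: "(\<lambda>m. a (- m) * (of_real (s m) * \<phi> m x)) summable_on UNIV" for x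
    using dual_term_summable[OF assms] .
  show add: "dual_synth_fun a (x + y) = dual_synth_fun a x + dual_synth_fun a y" for x y
    unfolding dual_synth_fun_def dualD(1)[OF \<phi>_dual]
    using infsum_add[OF sum[of x] sum[of y]] by (simp add: algebra_simps)
  show "dual_synth_fun a (smul c x) = c * dual_synth_fun a x" for c x
    unfolding dual_synth_fun_def dualD(2)[OF \<phi>_dual]
    by (subst infsum_cmult_right'[symmetric]) (simp add: mult_ac)
  show "continuous_on UNIV (dual_synth_fun a)"
  proof (rule continuous_on_additive[OF add])
    fix W :: "'k set" assume "open W" "0 \<in> W"
    then obtain d where d: "d > 0" "ball 0 d \<subseteq> W" by (meson open_contains_ball)
    have "C \<ge> 0" using order_trans[OF norm_ge_zero assms] .
    define r where "r = d / (C * half_powers + 1)"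
    have "C * half_powers \<ge> 0" using \<open>C \<ge> 0\<close> half_powers_nonneg by simp
    then have r: "r > 0" "C * r * half_powers < d"
      using d(1) by (auto simp: r_def field_simps)
    let ?V = "(\<lambda>x. smul (of_real (1 / r)) x) -` U"
    have "open ?V" using U by (intro open_vimage continuous_intros)
    moreover have "0 \<in> ?V" using U by simp
    moreover have "dual_synth_fun a x \<in> W" if "x \<in> ?V" for x
    proof -
      have "norm (dual_synth_fun a x) \<le> C * r * half_powers"
        using that by (intro dual_synth_fun_le assms r) simp
      then have "dual_synth_fun a x \<in> ball 0 d" using r(2) by (simp add: dist_norm)
      then show ?thesis using d(2) by blast
    qed
    ultimately show "\<exists>V. open V \<and> 0 \<in> V \<and> dual_synth_fun a ` V \<subseteq> W" by blast
  qed
qed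

lemma dual_synth_fun_add:
  assumes "\<And>m. norm (a m) \<le> C" "\<And>m. norm (b m) \<le> D"
  shows "dual_synth_fun (\<lambda>m. a m + b m) x = dual_synth_fun a x + dual_synth_fun b x"
  unfolding dual_synth_fun_def
  using infsum_add[OF dual_term_summable[where a = a and f = uminus and x = x, OF assms(1)]
      dual_term_summable[where a = b and f = uminus and x = x, OF assms(2)]]
  by (simp add: algebra_simps)

lemma dual_synth_fun_cmult: "dual_synth_fun (\<lambda>m. c * a m) x = c * dual_synth_fun a x"
  unfolding dual_synth_fun_def
  by (subst infsum_cmult_right'[symmetric]) (simp add: mult_ac)

lemma dual_synth_fun_diff:
  assumes "\<And>m. norm (a m) \<le> C" "\<And>m. norm (b m) \<le> D"
  shows "dual_synth_fun (\<lambda>m. a m - b m) x = dual_synth_fun a x - dual_synth_fun b x"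
proof -
  have "dual_synth_fun (\<lambda>m. a m + (- 1) * b m) x = dual_synth_fun a x + dual_synth_fun (\<lambda>m. (- 1) * b m) x"
    using assms by (intro dual_synth_fun_add[where D = D]) auto
  then show ?thesis using dual_synth_fun_cmult[of "- 1" b x] by simp
qed

text \<open>
  The dual operator is the shift in the opposite direction along \<open>\<lambda>m. s m * \<phi> m\<close>; the reflection
  \<open>m \<mapsto> - m\<close> in \<open>dual_synth_fun\<close> turns it into a \<open>wshift\<close> again.
\<close>

definition dual_weight :: "int \<Rightarrow> real" where
  "dual_weight m = s (- m) / s (1 - m) * w (1 - m)"

lemma dual_weight_pos: "0 < dual_weight m"
  using s(1) w(1) by (simp add: dual_weight_def)

text \<open>Composing with \<open>shift\<close> sends \<open>\<phi> m\<close> to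
  \<open>\<phi> m + w (m + 1) * \<phi> (m + 1)\<close>. Collecting the terms at \<open>m + 1\<close>
  and rescaling by \<open>s\<close> produces the quotient \<open>s m / s (m + 1)\<close> in the
  weight.\<close>

lemma dual_shift:
  assumes a: "\<And>m. norm (a m) \<le> C" and v: "\<And>m. dual_weight m \<le> 1"
  shows "dual_operator shift (dual_synth_fun a) = dual_synth_fun (wshift dual_weight a)"
proof
  fix x
  obtain r where r: "\<And>m. norm (of_real (w m) * \<phi> m x) \<le> r"
    using shift_coeff_bounded by metis
  let ?b = "\<lambda>m. of_real (dual_weight (m + 1)) * a (m + 1)"
  have b: "norm (?b m) \<le> 1 * C" for m
    unfolding norm_mult using a[of "m + 1"] v[of "m + 1"] dual_weight_pos[of "m + 1"]
    by (intro mult_mono) auto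
  have "\<phi> m (shift x) = \<phi> m x + of_real (w (m + 1)) * \<phi> (m + 1) x" for m
    unfolding shift_def dualD(1)[OF \<phi>_dual] by (subst dual_synth) (use r in auto)
  then have "dual_operator shift (dual_synth_fun a) x =
      (\<Sum>\<^sub>\<infinity>m. a (- m) * (of_real (s m) * \<phi> m x) +
        a (- m) * (of_real (s m * w (m + 1)) * \<phi> (m + 1) x))"
    unfolding dual_operator_def dual_synth_fun_def by (simp add: algebra_simps)
  also have "(\<lambda>m. a (- m) * (of_real (s m * w (m + 1)) * \<phi> (m + 1) x)) =
      (\<lambda>m. ?b (- (m + 1)) * (of_real (s (m + 1)) * \<phi> (m + 1) x))"
  proof
    fix m
    have "s (m + 1) \<noteq> 0" using s(1)[of "m + 1"] by simp
    moreover have "dual_weight (- (m + 1) + 1) = s m / s (m + 1) * w (m + 1)"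
      by (simp add: dual_weight_def add.commute)
    ultimately show "a (- m) * (of_real (s m * w (m + 1)) * \<phi> (m + 1) x) =
        ?b (- (m + 1)) * (of_real (s (m + 1)) * \<phi> (m + 1) x)"
      by simp
  qed
  finally have eq: "dual_operator shift (dual_synth_fun a) x =
      (\<Sum>\<^sub>\<infinity>m. a (- m) * (of_real (s m) * \<phi> m x) +
        ?b (- (m + 1)) * (of_real (s (m + 1)) * \<phi> (m + 1) x))" .
  have bij: "bij_betw (\<lambda>m::int. m + 1) UNIV UNIV"
    by (rule bij_betwI[where g = "\<lambda>m. m - 1"]) auto
  have "(\<lambda>m. ?b (- (m + 1)) * (of_real (s (m + 1)) * \<phi> (m + 1) x)) summable_on UNIV"
    using dual_term_summable[where a = ?b and f = uminus and x = x, OF b]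
      summable_on_reindex_bij_betw[OF bij, of "\<lambda>m. ?b (- m) * (of_real (s m) * \<phi> m x)"] by blast
  then have "dual_operator shift (dual_synth_fun a) x =
      dual_synth_fun a x + (\<Sum>\<^sub>\<infinity>m. ?b (- (m + 1)) * (of_real (s (m + 1)) * \<phi> (m + 1) x))"
    unfolding eq dual_synth_fun_def by (intro infsum_add dual_term_summable[OF a])
  also have "(\<Sum>\<^sub>\<infinity>m. ?b (- (m + 1)) * (of_real (s (m + 1)) * \<phi> (m + 1) x)) = dual_synth_fun ?b x"
    unfolding dual_synth_fun_def
    by (rule infsum_reindex_bij_betw[OF bij, of "\<lambda>m. ?b (- m) * (of_real (s m) * \<phi> m x)"])
  also have "dual_synth_fun a x + \<dots> = dual_synth_fun (wshift dual_weight a) x"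
    unfolding wshift_def[abs_def] using dual_synth_fun_add[where a = a and b = ?b, OF a b] by simp
  finally show "dual_operator shift (dual_synth_fun a) x = dual_synth_fun (wshift dual_weight a) x" .
qed

lemma dual_shift_pow:
  assumes "\<And>m. norm (a m) \<le> C" "\<And>m. dual_weight m \<le> 1"
  shows "(dual_operator shift ^^ k) (dual_synth_fun a) = dual_synth_fun ((wshift dual_weight ^^ k) a)"
proof (induction k)
  case (Suc k)
  have "dual_operator shift (dual_synth_fun ((wshift dual_weight ^^ k) a)) =
      dual_synth_fun (wshift dual_weight ((wshift dual_weight ^^ k) a))"
    by (rule dual_shift[OF wshift_pow_bounded[OF assms(1) dual_weight_pos assms(2)] assms(2)])
  then show ?case using Suc by simp
qed simp

lemma dual_shift_hypercyclic:
  fixes z :: "int \<Rightarrow> 'k"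
  assumes v: "\<And>m. dual_weight m \<le> 1"
    and z: "\<And>m. norm (z m) \<le> C"
      "\<And>u d. finite {m. u m \<noteq> 0} \<Longrightarrow> 0 < d \<Longrightarrow>
        \<exists>k. \<forall>m. norm ((wshift dual_weight ^^ k) z m - u m) \<le> d"
    and dense: "\<And>f B d. f \<in> continuous_dual smul \<Longrightarrow> tvs_bounded smul B \<Longrightarrow> 0 < d \<Longrightarrow>
      \<exists>a D. finite {m. a m \<noteq> 0} \<and> (\<forall>m. norm (a m) \<le> D) \<and> (\<forall>x\<in>B. norm (dual_synth_fun a x - f x) < d)"
  shows "hypercyclic (strong_dual smul) (dual_operator shift)"
proof -
  let ?o = "\<lambda>k. (dual_operator shift ^^ k) (dual_synth_fun z)"
  have o: "?o k = dual_synth_fun ((wshift dual_weight ^^ k) z)" for k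
    by (rule dual_shift_pow[OF z(1) v])
  have zk: "norm ((wshift dual_weight ^^ k) z m) \<le> 2 ^ k * C" for k m
    by (rule wshift_pow_bounded[OF z(1) dual_weight_pos v])
  have o_dual: "?o k \<in> continuous_dual smul" for k
    unfolding o by (rule dual_synth_fun_dual[OF zk])
  have approx: "\<exists>k. ?o k \<in> W" if W: "strong_dual_open smul W" "f \<in> W" for f W
  proof -
    obtain B d where B: "tvs_bounded smul B" "0 < d"
      "{h \<in> continuous_dual smul. \<forall>x\<in>B. norm (h x - f x) < d} \<subseteq> W"
      using W unfolding strong_dual_open_def by blast
    have "f \<in> continuous_dual smul" using W unfolding strong_dual_open_def by blast
    then obtain a D where a: "finite {m. a m \<noteq> 0}" "\<And>m. norm (a m) \<le> D"
      "\<And>x. x \<in> B \<Longrightarrow> norm (dual_synth_fun a x - f x) < d / 2"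
      using dense[OF _ B(1), of f "d / 2"] B(2) by auto
    \<comment> \<open>Boundedness of \<open>B\<close> provides one radius for all its points, as
      \<open>dual_synth_fun_le\<close> needs for a uniform estimate.\<close>
    obtain r where r: "r > 0" "\<And>c. norm c \<ge> r \<Longrightarrow> B \<subseteq> smul c ` U"
      using B(1) U unfolding tvs_bounded_def by blast
    have rB: "smul (of_real (1 / r)) x \<in> U" if "x \<in> B" for x
    proof -
      have "x \<in> smul (of_real r) ` U" using r(2)[of "of_real r"] r(1) that by auto
      then show ?thesis using r(1) by auto
    qed
    define \<epsilon> where "\<epsilon> = d / 2 / (r * half_powers + 1)"
    have "r * half_powers \<ge> 0" using r(1) half_powers_nonneg by simp
    then have \<epsilon>: "\<epsilon> > 0" "\<epsilon> * r * half_powers \<le> d / 2"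
      using B(2) by (auto simp: \<epsilon>_def field_simps)
    obtain k where k: "\<And>m. norm ((wshift dual_weight ^^ k) z m - a m) \<le> \<epsilon>"
      using z(2)[OF a(1) \<epsilon>(1)] by blast
    have "norm (?o k x - f x) < d" if "x \<in> B" for x
    proof -
      have "norm (dual_synth_fun (\<lambda>m. (wshift dual_weight ^^ k) z m - a m) x) \<le> \<epsilon> * r * half_powers"
        by (rule dual_synth_fun_le[OF k r(1) rB[OF that]])
      then have "norm (?o k x - dual_synth_fun a x) \<le> d / 2"
        unfolding o dual_synth_fun_diff[where a = "(wshift dual_weight ^^ k) z" and b = a, OF zk a(2)] using \<epsilon>(2) by linarith
      then show ?thesis
        using a(3)[OF that] norm_triangle_ineq[of "?o k x - dual_synth_fun a x" "dual_synth_fun a x - f x"]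
        by simp
    qed
    then have "?o k \<in> W" using B(3) o_dual by blast
    then show ?thesis ..
  qed
  have "f \<in> strong_dual smul closure_of (range ?o)" if f: "f \<in> continuous_dual smul" for f
    unfolding in_closure_of topspace_strong_dual openin_strong_dual
  proof (intro conjI allI impI f)
    fix W assume "f \<in> W \<and> strong_dual_open smul W"
    then obtain k where "?o k \<in> W" using approx by blast
    then show "\<exists>y. y \<in> range ?o \<and> y \<in> W" by blast
  qed
  then have "strong_dual smul closure_of (range ?o) = continuous_dual smul"
    using closure_of_subset_topspace[of "strong_dual smul" "range ?o"]
    unfolding topspace_strong_dual by (intro equalityI subsetI) auto
  moreover have "range ?o \<subseteq> continuous_dual smul" using o_dual by auto
  ultimately have "dense_in (strong_dual smul) (range ?o)"
    unfolding dense_in_def topspace_strong_dual by (intro conjI)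
  then show ?thesis
    unfolding hypercyclic_def topspace_strong_dual by (rule bexI[OF _ dual_synth_fun_dual[OF z(1)]])
qed

end


section \<open>Choice of scalings and weights, and the final operator\<close>

lemma finite_support_bounded:
  fixes a :: "int \<Rightarrow> 'k::real_normed_vector"
  assumes "finite {m. a m \<noteq> 0}"
  obtains D where "\<And>m. norm (a m) \<le> D"
proof
  show "norm (a m) \<le> (\<Sum>m\<in>{m. a m \<noteq> 0}. norm (a m))" for m
    using assms by (cases "a m = 0") (auto intro!: member_le_sum sum_nonneg)
qed

context dual_ell1_frechet_space
begin

lemma dense_sequence:
  obtains u :: "nat \<Rightarrow> 'a" where "\<And>G. open G \<Longrightarrow> G \<noteq> {} \<Longrightarrow> \<exists>k. u k \<in> G"
proof -
  obtain D :: "'a set" where D: "countable D" "euclidean closure_of D = UNIV"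
    using separable by (auto simp: separable_space_def)
  have meets: "\<exists>y\<in>D. y \<in> G" if G: "open G" "G \<noteq> {}" for G
  proof -
    obtain y where "y \<in> G" using G(2) by blast
    moreover have "y \<in> euclidean closure_of D" using D(2) by simp
    ultimately show ?thesis using G(1) unfolding in_closure_of by auto
  qed
  then have "D \<noteq> {}" using meets[of UNIV] by auto
  then have range: "range (from_nat_into D) = D"
    using D(1) by (intro range_from_nat_into)
  have "\<exists>k. from_nat_into D k \<in> G" if "open G" "G \<noteq> {}" for G
    using meets[OF that] range by (metis imageE)
  then show ?thesis by (rule that)
qed

theorem dual_hypercyclic_exists: "\<exists>T. dual_hypercyclic smul T"
proof -
  obtain u :: "nat \<Rightarrow> 'a" where u: "\<And>G. open G \<Longrightarrow> G \<noteq> {} \<Longrightarrow> \<exists>k. u k \<in> G"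
    using dense_sequence by blast
  obtain x :: "nat \<Rightarrow> 'a" and \<phi> :: "nat \<Rightarrow> 'a \<Rightarrow> 'k"
    where \<phi>: "\<And>i. \<phi> i \<in> bounded_dual" "\<And>i j. \<phi> i (x j) = of_bool (i = j)"
    and u_span: "\<And>k. \<exists>n. u k = (\<Sum>i<n. smul (\<phi> i (u k)) (x i))"
    and g_span: "\<And>k. \<exists>n. \<forall>y. g k y = (\<Sum>i<n. g k (x i) * \<phi> i y)"
    by (rule biorthogonal_exists[of u]) (rule that; assumption)
  obtain t where t: "\<And>i. t i > 0" "fast_null (\<lambda>i. smul (of_real (t i)) (x i))"
    using fast_null_scaling_exists[of x] by blast
  have t_nz: "of_real (t i) \<noteq> (0 :: 'k)" for i
    using t(1)[of i] by simp
  define e where "e m = smul (of_real (t (int_encode m))) (x (int_encode m))" for m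
  \<comment> \<open>Scaled inversely to \<open>e\<close>, to keep the system biorthogonal.\<close>
  define \<zeta> where "\<zeta> m y = of_real (1 / t (int_encode m)) * \<phi> (int_encode m) y" for m y
  let ?U = equicontinuity_nbhd
  have \<zeta>_bd: "\<zeta> m \<in> bounded_dual" for m
    unfolding \<zeta>_def[abs_def] by (intro bounded_dual_cmult \<phi>)
  then have \<zeta>_dual: "\<zeta> m \<in> continuous_dual smul" for m
    by (simp add: bounded_dual_def)
  have "\<exists>C\<ge>1. \<forall>y\<in>?U. norm (\<zeta> m y) \<le> C" for m
  proof -
    obtain C where "\<forall>y\<in>?U. norm (\<zeta> m y) \<le> C"
      using \<zeta>_bd[of m] by (auto simp: bounded_dual_def)
    then show ?thesis by (intro exI[of _ "max 1 C"]) auto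
  qed
  then obtain C where C: "\<And>m. C m \<ge> 1" "\<And>m y. y \<in> ?U \<Longrightarrow> norm (\<zeta> m y) \<le> C m" by metis
  have C_pos: "C m > 0" for m using C(1)[of m] by linarith
  \<comment> \<open>\<open>C m\<close> cancels the bound of \<open>\<zeta> m\<close> on the
    neighbourhood; the power of \<open>1 / 2\<close> makes the bounds summable.\<close>
  define s where "s m = (1 / 2) ^ int_encode m / C m" for m
  have s: "0 < s m" for m using C_pos by (simp add: s_def)
  define \<gamma> where "\<gamma> m = s (- m) / s (1 - m)" for m
  have \<gamma>: "0 < \<gamma> m" for m using s by (simp add: \<gamma>_def)
  \<comment> \<open>The first bound keeps \<open>w m * \<zeta> m\<close> below 1 on the
    neighbourhood, the second keeps the dual weights at most 1; the argument \<open>1 - m\<close>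
    undoes the reflection.\<close>
  define \<beta> where "\<beta> m = min (1 / C m) (1 / \<gamma> (1 - m))" for m
  have \<beta>: "0 < \<beta> m" "\<beta> m \<le> 1" for m
    using C_pos[of m] C(1)[of m] \<gamma>[of "1 - m"] by (auto simp: \<beta>_def min_le_iff_disj)
  have \<gamma>\<beta>: "\<gamma> m * \<beta> (1 - m) \<le> 1" for m
  proof -
    have "\<gamma> m * \<beta> (1 - m) \<le> \<gamma> m * (1 / \<gamma> m)"
      using \<gamma>[of m] by (intro mult_left_mono) (auto simp: \<beta>_def)
    then show ?thesis using \<gamma>[of m] by simp
  qed
  obtain w where w: "\<And>m. 0 < w m" "\<And>m. w m \<le> \<beta> m" "\<And>m. \<gamma> m * w (1 - m) \<le> 1"
    and steer: "\<And>u v \<epsilon>. finite {m. u m \<noteq> (0::'k)} \<Longrightarrow> finite {m. v m \<noteq> 0} \<Longrightarrow> 0 < \<epsilon> \<Longrightarrow>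
      steers w u v \<epsilon> \<and> steers (\<lambda>m. \<gamma> m * w (1 - m)) u v \<epsilon>"
    by (rule bilateral_weights_exist[where \<beta> = \<beta> and \<gamma> = \<gamma> and ?'k = 'k, OF \<beta> \<gamma> \<gamma>\<beta>]) (rule that; assumption)
  interpret S: frechet_shift smul e \<zeta> w s ?U
  proof
    show "fast_null (\<lambda>i. e (int_decode i))"
      using t(2) by (simp add: e_def)
    show "\<zeta> m (e n) = of_bool (m = n)" for m n
    proof -
      have "\<phi> (int_encode m) \<in> continuous_dual smul" using \<phi>(1) by (simp add: bounded_dual_def)
      then show ?thesis
        using t_nz[of "int_encode m"]
        by (auto simp: \<zeta>_def e_def dualD(2) \<phi>(2) int_encode_eq)
    qed
    show "w m \<le> 1" for m using w(2)[of m] \<beta>(2)[of m] by linarith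
    show "w m * norm (\<zeta> m y) \<le> 1" if "y \<in> ?U" for m y
    proof -
      have "w m * norm (\<zeta> m y) \<le> (1 / C m) * C m"
        using w(1,2)[of m] C_pos[of m] C(2)[OF that, of m]
        by (intro mult_mono) (auto simp: \<beta>_def)
      then show ?thesis using C_pos[of m] by simp
    qed
    show "s m * norm (\<zeta> m y) \<le> (1 / 2) ^ int_encode m" if "y \<in> ?U" for m y
    proof -
      have "s m * norm (\<zeta> m y) \<le> s m * C m"
        using s[of m] C(2)[OF that, of m] by (intro mult_left_mono) auto
      then show ?thesis using C_pos[of m] by (simp add: s_def)
    qed
  qed (fact \<zeta>_dual equicontinuity_nbhd(1,2) w(1) s)+
  have dual_weight: "S.dual_weight = (\<lambda>m. \<gamma> m * w (1 - m))"
    by (simp add: S.dual_weight_def[abs_def] \<gamma>_def)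
  have weight_le: "S.dual_weight m \<le> 1" for m
    using w(3) by (simp add: dual_weight)
  obtain z :: "int \<Rightarrow> 'k" and K where z: "\<And>m. norm (z m) \<le> K"
    "\<And>u \<delta>. finite {m. u m \<noteq> 0} \<Longrightarrow> 0 < \<delta> \<Longrightarrow> \<exists>k. \<forall>m. norm ((wshift w ^^ k) z m - u m) \<le> \<delta>"
    by (rule hypercyclic_sequence[where w = w and ?'k = 'k, OF S.w(1,2) conjunct1[OF steer]])
      (assumption | (rule that; assumption))+
  have "hypercyclic euclidean S.shift"
  proof (rule S.shift_hypercyclic[OF z])
    fix G :: "'a set" assume "open G" "G \<noteq> {}"
    then obtain k where k: "u k \<in> G" using u by blast
    obtain n where n: "u k = (\<Sum>i<n. smul (\<phi> i (u k)) (x i))" using u_span by blast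
    have "smul (\<phi> i (u k) / of_real (t i)) (e (int_decode i)) = smul (\<phi> i (u k)) (x i)" for i
      using t_nz[of i] by (simp add: e_def)
    then have "(\<Sum>i<n. smul (\<phi> i (u k) / of_real (t i)) (e (int_decode i))) = u k"
      using n[symmetric] by simp
    then show "\<exists>v n. (\<Sum>i<n. smul (v i) (e (int_decode i))) \<in> G"
      using k by (intro exI[of _ "\<lambda>i. \<phi> i (u k) / of_real (t i)"] exI[of _ n]) simp
  qed
  moreover obtain z' :: "int \<Rightarrow> 'k" and K' where z': "\<And>m. norm (z' m) \<le> K'"
    "\<And>u \<delta>. finite {m. u m \<noteq> 0} \<Longrightarrow> 0 < \<delta> \<Longrightarrow> \<exists>k. \<forall>m. norm ((wshift S.dual_weight ^^ k) z' m - u m) \<le> \<delta>"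
    by (rule hypercyclic_sequence[where w = S.dual_weight and ?'k = 'k, OF S.dual_weight_pos weight_le
          conjunct2[OF steer, folded dual_weight]])
      (assumption | (rule that; assumption))+
  have "hypercyclic (strong_dual smul) (dual_operator S.shift)"
  proof (rule S.dual_shift_hypercyclic[OF weight_le z'])
    fix f :: "'a \<Rightarrow> 'k" and B :: "'a set" and d :: real
    assume fB: "f \<in> continuous_dual smul" "tvs_bounded smul B" "0 < d"
    interpret D: module "dual_smul :: 'k \<Rightarrow> ('a \<Rightarrow> 'k) \<Rightarrow> 'a \<Rightarrow> 'k" by (rule module_dual_smul)
    \<comment> \<open>The span of the \<open>g k\<close> consists of functionals synthesised from
      finitely supported sequences, so strong density of the span gives the targets for the dual
      orbit.\<close>
    have span: "\<exists>a. finite {m. a m \<noteq> 0} \<and> h = S.dual_synth_fun a" if "h \<in> D.span (range g)" for h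
      using that
    proof (induction rule: D.span_induct_alt)
      case base
      have "S.dual_synth_fun (\<lambda>_. 0) = 0" by (simp add: S.dual_synth_fun_def[abs_def] fun_eq_iff)
      then show ?case by (intro exI[of _ "\<lambda>_. 0"]) simp
    next
      case (step c h' h)
      then obtain k where k: "h' = g k" by blast
      obtain b where b: "finite {m. b m \<noteq> 0}" "h = S.dual_synth_fun b" using step by blast
      obtain n where n: "\<And>y. g k y = (\<Sum>i<n. g k (x i) * \<phi> i y)" using g_span by blast
      \<comment> \<open>The coefficients of \<open>g k\<close> along the \<open>\<phi> i\<close>,
        corrected for the scalings by \<open>t\<close> and \<open>s\<close> and placed at the
        reflected index.\<close>
      define a where "a m = (if int_encode (- m) < n
        then g k (x (int_encode (- m))) * of_real (t (int_encode (- m)) / s (- m)) else 0)" for m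
      have fin: "finite {m. a m \<noteq> 0}"
      proof (rule finite_subset)
        show "{m. a m \<noteq> 0} \<subseteq> (\<lambda>i. - int_decode i) ` {..<n}"
        proof
          fix m assume "m \<in> {m. a m \<noteq> 0}"
          then have "int_encode (- m) \<in> {..<n}" by (auto simp: a_def split: if_splits)
          moreover have "m = - int_decode (int_encode (- m))" by simp
          ultimately show "m \<in> (\<lambda>i. - int_decode i) ` {..<n}" by blast
        qed
      qed simp
      have "S.dual_synth_fun a y = g k y" for y
      proof -
        have s_nz: "of_real (s m) \<noteq> (0 :: 'k)" for m using s[of m] by simp
        have "S.dual_synth_fun a y = (\<Sum>\<^sub>\<infinity>m\<in>int_decode ` {..<n}. g k (x (int_encode m)) * \<phi> (int_encode m) y)"
          unfolding S.dual_synth_fun_def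
        proof (rule infsum_cong_neutral)
          fix m assume "m \<in> UNIV - int_decode ` {..<n}"
          then have "\<not> int_encode m < n" by (metis DiffE imageI int_encode_inverse lessThan_iff)
          then show "a (- m) * (of_real (s m) * \<zeta> m y) = 0" by (simp add: a_def)
        next
          fix m assume "m \<in> UNIV \<inter> int_decode ` {..<n}"
          then have "int_encode m < n" by auto
          then show "a (- m) * (of_real (s m) * \<zeta> m y) = g k (x (int_encode m)) * \<phi> (int_encode m) y"
            using s_nz[of m] t_nz[of "int_encode m"] by (simp add: a_def \<zeta>_def)
        qed auto
        also have "\<dots> = (\<Sum>i<n. g k (x i) * \<phi> i y)"
          by (simp add: sum.reindex[OF inj_int_decode])
        also have "\<dots> = g k y" by (rule n[symmetric])
        finally show ?thesis .
      qed
      then have ga: "g k = S.dual_synth_fun a" by (simp add: fun_eq_iff)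
      obtain C\<^sub>a C\<^sub>b where bounds: "\<And>m. norm (a m) \<le> C\<^sub>a" "\<And>m. norm (b m) \<le> C\<^sub>b"
        using finite_support_bounded[OF fin] finite_support_bounded[OF b(1)] by metis
      have ca: "norm (c * a m) \<le> norm c * C\<^sub>a" for m
        using bounds(1) by (simp add: norm_mult mult_left_mono)
      have "dual_smul c h' + h = S.dual_synth_fun (\<lambda>m. c * a m + b m)"
        using S.dual_synth_fun_add[where a = "\<lambda>m. c * a m" and b = b, OF ca bounds(2)]
        by (simp add: fun_eq_iff dual_smul_def k ga b(2) S.dual_synth_fun_cmult)
      moreover have "finite {m. c * a m + b m \<noteq> 0}"
        by (rule finite_subset[OF _ finite_UnI[OF fin b(1)]]) auto
      ultimately show ?case by (intro exI[of _ "\<lambda>m. c * a m + b m"] conjI)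
    qed
    obtain h where h: "h \<in> D.span (range g)" "\<And>y. y \<in> B \<Longrightarrow> norm (h y - f y) < d"
      using strong_dual_dense_approx[OF dense_span fB] by blast
    obtain a where a: "finite {m. a m \<noteq> 0}" "h = S.dual_synth_fun a" using span[OF h(1)] by blast
    obtain A where "\<And>m. norm (a m) \<le> A" using finite_support_bounded[OF a(1)] by blast
    then show "\<exists>a A. finite {m. a m \<noteq> 0} \<and> (\<forall>m. norm (a m) \<le> A) \<and>
        (\<forall>y\<in>B. norm (S.dual_synth_fun a y - f y) < d)"
      using a h(2) by blast
  qed
  ultimately show ?thesis
    unfolding dual_hypercyclic_def using S.shift_operator by blast
qed

end

theorem corollary1p16:
  fixes smul_real :: "real \<Rightarrow> 'a::{topological_ab_group_add, uniform_topological_group_add} \<Rightarrow> 'a"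
    and smul_complex :: "complex \<Rightarrow> 'b::{topological_ab_group_add, uniform_topological_group_add} \<Rightarrow> 'b"
  shows "(frechet_space smul_real \<and> separable_space (euclidean :: 'a topology)
        \<and> infinite_dimensional smul_real
        \<and> (\<exists>f. ell1_sequence dual_smul (strong_dual smul_real) f
              \<and> dense_in (strong_dual smul_real) (module.span dual_smul (range f)))
      \<longrightarrow> (\<exists>T. dual_hypercyclic smul_real T))
    \<and> (frechet_space smul_complex \<and> separable_space (euclidean :: 'b topology)
        \<and> infinite_dimensional smul_complex
        \<and> (\<exists>f. ell1_sequence dual_smul (strong_dual smul_complex) f
              \<and> dense_in (strong_dual smul_complex) (module.span dual_smul (range f)))
      \<longrightarrow> (\<exists>T. dual_hypercyclic smul_complex T))"
proof (intro conjI impI; elim conjE exE)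
  fix f
  assume "frechet_space smul_real" "separable_space (euclidean :: 'a topology)"
    "infinite_dimensional smul_real" "ell1_sequence dual_smul (strong_dual smul_real) f"
    "dense_in (strong_dual smul_real) (module.span dual_smul (range f))"
  \<comment> \<open>The two scalar fields differ only in how separation of points is
    supplied.\<close>
  then interpret dual_ell1_frechet_space smul_real f
    by (intro dual_ell1_frechet_space.intro dual_ell1_frechet_space_axioms.intro dual_separates_real)
  show "\<exists>T. dual_hypercyclic smul_real T" by (rule dual_hypercyclic_exists)
next
  fix f
  assume "frechet_space smul_complex" "separable_space (euclidean :: 'b topology)"
    "infinite_dimensional smul_complex" "ell1_sequence dual_smul (strong_dual smul_complex) f"
    "dense_in (strong_dual smul_complex) (module.span dual_smul (range f))"
  then interpret dual_ell1_frechet_space smul_complex f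
    by (intro dual_ell1_frechet_space.intro dual_ell1_frechet_space_axioms.intro dual_separates_complex)
  show "\<exists>T. dual_hypercyclic smul_complex T" by (rule dual_hypercyclic_exists)
qed

end
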